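(* Let $\eta$ satisfy (A1) and (A2). Then for $\eta$-a.e. $\omega$ and every initial height distribution $\pi$ (possibly depending measurably on $\omega$), $X_n/n$ satisfies a (full) large deviation principle under $P^\pi_\omega$ with deterministic, convex, lower semicontinuous rate function $I_\eta$, where the limit $\lim_{t\to\infty}J_\eta(t)/t$ appearing in the definition of $I_\eta(0)$ exists.
   Context: Setting. Fix an integer $d\ge1$ and write $[d]=\{1,\dots,d\}$. Let $\Sigma$ be the set of triples $(q,r,p)$ of $d\times d$ matrices with nonnegative real entries such that $(q+r+p)\mathbf 1=\mathbf 1$, where $\mathbf 1$ is the all-ones column vector. Let $\Omega=\Sigma^{\mathbb Z}$ (Borel σ-algebra), with elements $\omega=(\omega_n)_{n\in\mathbb Z}$, $\omega_n=(q_n,r_n,p_n)$, and shift $(\theta\omega)_k=\omega_{k+1}$. For $\omega\in\Omega$ and $(x,i)\in\mathbb Z\times[d]$, $P^{(x,i)}_\omega$ is the law of the Markov chain $\xi_n=(X_n,Y_n)$ on $\mathbb Z\times[d]$ with $\xi_0=(x,i)$ which, from $(k,i)$, jumps to $(k-1,j)$, $(k,j)$, $(k+1,j)$ with probabilities $q_k(i,j)$, $r_k(i,j)$, $p_k(i,j)$ respectively; $E^{(x,i)}_\omega$ is its expectation. For a probability vector $\pi$ on $[d]$, $P^\pi_\omega=\sum_i\pi(i)P^{(0,i)}_\omega$. Let $T_x=\inf\{n\ge0:X_n=x\}$. For $\kappa>0$, $\Sigma_\kappa$ is the set of $(q,r,p)\in\Sigma$ with $\sum_jq(i,j)\ge\kappa$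 and $\sum_jp(i,j)\ge\kappa$ for all $i$, and $((I-r)^{-1}q)(i,j)\ge\kappa$, $((I-r)^{-1}p)(i,j)\ge\kappa$ for all $i,j$; $\Omega_\kappa=\Sigma_\kappa^{\mathbb Z}$. Assumption (A1): $\eta$ is stationary and ergodic under $\theta$. Assumption (A2): there is $\kappa>0$ with $\eta(\Omega_\kappa)=1$. Rate functions. With $\Phi_k(\lambda)(i,j)=E^{(k,i)}_\omega[e^{\lambda T_{k+1}}\mathbf 1\{T_{k+1}<\infty,Y_{T_{k+1}}=j\}]$, $\Phi_{[m,n]}(\lambda)=\Phi_m(\lambda)\cdots\Phi_n(\lambda)$, $\lambda_{crit}(\eta)=\sup\{\lambda:\eta(\max_i\sum_j\Phi_0(\lambda)(i,j)<\infty)=1\}$, and for $\lambda\le\lambda_{crit}(\eta)$, $\mu_0(\lambda)=\lim_{m\to-\infty}e_i\Phi_{[m,-1]}(\lambda)/(e_i\Phi_{[m,-1]}(\lambda)\mathbf 1)$ (exists $\eta$-a.s., independent of $i$), define $\Lambda_\eta(\lambda)=E_\eta[\log(\mu_0(\lambda)\Phi_0(\lambda)\mathbf 1)]$ for $\lambda\le\lambda_{crit}(\eta)$, $+\infty$ otherwise, and $J_\eta(t)=\sup_\lambda\{\lambda t-\Lambda_\eta(\lambda)\}$. For $\omega\in\Omega$ let $\omega^{Inv}$ be the reflected environment, $(q_n,r_n,p_n)(\omega^{Inv})=(p_{-n},r_{-n},q_{-n})(\omega)$, and $\eta^{Inv}$ the law of $\omega^{Inv}$ under $\eta$. Define $I_\eta(x)=xJ_\eta(1/x)$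 for $x>0$, $I_\eta(0)=\lim_{t\to\infty}J_\eta(t)/t$, and $I_\eta(x)=|x|J_{\eta^{Inv}}(1/|x|)$ for $x<0$. *)

theory Defs
  imports "HOL-Probability.Probability"
begin

type_synonym 'd site = "(real^'d^'d) \<times> (real^'d^'d) \<times> (real^'d^'d)"
type_synonym 'd env = "int \<Rightarrow> 'd site"

definition qq :: "('d::finite) site \<Rightarrow> real^'d^'d" where "qq s = fst s"
definition rr :: "('d::finite) site \<Rightarrow> real^'d^'d" where "rr s = fst (snd s)"
definition pp :: "('d::finite) site \<Rightarrow> real^'d^'d" where "pp s = snd (snd s)"

definition in_Sigma :: "('d::finite) site \<Rightarrow> bool" where
  "in_Sigma s \<longleftrightarrow>
     (\<forall>i j. qq s $ i $ j \<ge> 0 \<and> rr s $ i $ j \<ge> 0 \<and> pp s $ i $ j \<ge> 0) \<and>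
     (\<forall>i. (\<Sum>j\<in>UNIV. qq s $ i $ j + rr s $ i $ j + pp s $ i $ j) = 1)"

definition in_Sigma_kappa :: "real \<Rightarrow> ('d::finite) site \<Rightarrow> bool" where
  "in_Sigma_kappa \<kappa> s \<longleftrightarrow> in_Sigma s \<and>
     (\<forall>i. (\<Sum>j\<in>UNIV. qq s $ i $ j) \<ge> \<kappa> \<and> (\<Sum>j\<in>UNIV. pp s $ i $ j) \<ge> \<kappa>) \<and>
     invertible (mat 1 - rr s) \<and>
     (\<forall>i j. (matrix_inv (mat 1 - rr s) ** qq s) $ i $ j \<ge> \<kappa> \<and>
            (matrix_inv (mat 1 - rr s) ** pp s) $ i $ j \<ge> \<kappa>)"

definition shift :: "('d::finite) env \<Rightarrow> 'd env" where
  "shift \<omega> = (\<lambda>k. \<omega> (k + 1))"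

definition env_inv :: "('d::finite) env \<Rightarrow> 'd env" where
  "env_inv \<omega> = (\<lambda>n. (pp (\<omega> (- n)), rr (\<omega> (- n)), qq (\<omega> (- n))))"

definition stationary_ergodic :: "('d::finite) env measure \<Rightarrow> bool" where
  "stationary_ergodic \<eta> \<longleftrightarrow>
     shift \<in> \<eta> \<rightarrow>\<^sub>M \<eta> \<and> distr \<eta> \<eta> shift = \<eta> \<and>
     (\<forall>A\<in>sets \<eta>. shift -` A \<inter> space \<eta> = A \<longrightarrow> prob_space.prob \<eta> A = 0 \<or> prob_space.prob \<eta> A = 1)"

definition uniformly_elliptic :: "('d::finite) env measure \<Rightarrow> bool" where
  "uniformly_elliptic \<eta> \<longleftrightarrow> (\<exists>\<kappa>>0. AE \<omega> in \<eta>. \<forall>n. in_Sigma_kappa \<kappa> (\<omega> n))"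

text \<open>pos_prob \<omega> n x i y j = P^{(x,i)}_\<omega>(\<xi>_n = (y,j)), by the Markov property
(first-step decomposition).\<close>
primrec pos_prob :: "('d::finite) env \<Rightarrow> nat \<Rightarrow> int \<Rightarrow> 'd \<Rightarrow> int \<Rightarrow> 'd \<Rightarrow> real" where
  "pos_prob \<omega> 0 x i y j = (if x = y \<and> i = j then 1 else 0)"
| "pos_prob \<omega> (Suc n) x i y j =
     (\<Sum>l\<in>UNIV. qq (\<omega> x) $ i $ l * pos_prob \<omega> n (x - 1) l y j
              + rr (\<omega> x) $ i $ l * pos_prob \<omega> n x l y j
              + pp (\<omega> x) $ i $ l * pos_prob \<omega> n (x + 1) l y j)"

text \<open>hit_prob \<omega> z n x i j = P^{(x,i)}_\<omega>(T_z = n, Y_n = j).\<close>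
primrec hit_prob :: "('d::finite) env \<Rightarrow> int \<Rightarrow> nat \<Rightarrow> int \<Rightarrow> 'd \<Rightarrow> 'd \<Rightarrow> real" where
  "hit_prob \<omega> z 0 x i j = (if x = z \<and> i = j then 1 else 0)"
| "hit_prob \<omega> z (Suc n) x i j =
     (if x = z then 0 else
     (\<Sum>l\<in>UNIV. qq (\<omega> x) $ i $ l * hit_prob \<omega> z n (x - 1) l j
              + rr (\<omega> x) $ i $ l * hit_prob \<omega> z n x l j
              + pp (\<omega> x) $ i $ l * hit_prob \<omega> z n (x + 1) l j))"

text \<open>P^\<pi>_\<omega>(X_n / n \<in> A).  (X_n ranges over [-n,n].)\<close>
definition law_Xn_over_n :: "('d::finite) env \<Rightarrow> ('d \<Rightarrow> real) \<Rightarrow> nat \<Rightarrow> real set \<Rightarrow> real" where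
  "law_Xn_over_n \<omega> \<pi> n A =
     (\<Sum>i\<in>UNIV. \<pi> i * (\<Sum>y\<in>{y\<in>{- int n..int n}. real_of_int y / real n \<in> A}.
                          \<Sum>j\<in>UNIV. pos_prob \<omega> n 0 i y j))"

definition prob_vec :: "('d::finite \<Rightarrow> real) \<Rightarrow> bool" where
  "prob_vec \<pi> \<longleftrightarrow> (\<forall>i. \<pi> i \<ge> 0) \<and> sum \<pi> UNIV = 1"

text \<open>\<Phi>_k(lam)(i,j) = E^{(k,i)}[e^{lam T_{k+1}}; T_{k+1} < \<infinity>, Y_{T_{k+1}} = j], in [0,\<infinity>].\<close>
definition Phi_enn :: "('d::finite) env \<Rightarrow> real \<Rightarrow> int \<Rightarrow> 'd \<Rightarrow> 'd \<Rightarrow> ennreal" where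
  "Phi_enn \<omega> lam k i j = (\<Sum>t. ennreal (exp (lam * real t) * hit_prob \<omega> (k + 1) t k i j))"

text \<open>Real matrix version (meaningful when all entries are finite).\<close>
definition Phi :: "('d::finite) env \<Rightarrow> real \<Rightarrow> int \<Rightarrow> real^'d^'d" where
  "Phi \<omega> lam k = (\<chi> i j. enn2real (Phi_enn \<omega> lam k i j))"

definition Phi_rows_finite :: "('d::finite) env \<Rightarrow> real \<Rightarrow> int \<Rightarrow> bool" where
  "Phi_rows_finite \<omega> lam k \<longleftrightarrow> (\<forall>i. (\<Sum>j\<in>UNIV. Phi_enn \<omega> lam k i j) < \<infinity>)"

definition Phi_prod :: "('d::finite) env \<Rightarrow> real \<Rightarrow> int \<Rightarrow> int \<Rightarrow> real^'d^'d" where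
  "Phi_prod \<omega> lam m n = foldr (\<lambda>k M. Phi \<omega> lam k ** M) [m..n] (mat 1)"

definition lambda_crit :: "('d::finite) env measure \<Rightarrow> ereal" where
  "lambda_crit \<eta> = Sup (ereal ` {lam. AE \<omega> in \<eta>. Phi_rows_finite \<omega> lam 0})"

text \<open>\<mu>_0(lam) = lim_{m\<rightarrow>-\<infinity>} e_i \<Phi>_{[m,-1]} / (e_i \<Phi>_{[m,-1]} 1); the limit is
independent of i, so a fixed (arbitrary) index is used.\<close>
definition mu0 :: "('d::finite) env \<Rightarrow> real \<Rightarrow> real^'d" where
  "mu0 \<omega> lam = lim (\<lambda>N::nat.
     let v = axis (undefined::'d) 1 v* Phi_prod \<omega> lam (- int N) (- 1)
     in (1 / (\<Sum>j\<in>UNIV. v $ j)) *\<^sub>R v)"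

definition eexpect :: "'a measure \<Rightarrow> ('a \<Rightarrow> ereal) \<Rightarrow> ereal" where
  "eexpect M f = enn2ereal (\<integral>\<^sup>+ x. e2ennreal (f x) \<partial>M) - enn2ereal (\<integral>\<^sup>+ x. e2ennreal (- f x) \<partial>M)"

definition Lambda_eta :: "('d::finite) env measure \<Rightarrow> real \<Rightarrow> ereal" where
  "Lambda_eta \<eta> lam =
     (if ereal lam \<le> lambda_crit \<eta> then
        eexpect \<eta> (\<lambda>\<omega>. if Phi_rows_finite \<omega> lam 0
                         then ereal (ln (\<Sum>j\<in>UNIV. (mu0 \<omega> lam v* Phi \<omega> lam 0) $ j))
                         else \<infinity>)
      else \<infinity>)"

definition J_eta :: "('d::finite) env measure \<Rightarrow> real \<Rightarrow> ereal" where
  "J_eta \<eta> t = (SUP lam. ereal (lam * t) - Lambda_eta \<eta> lam)"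

definition I_eta :: "('d::finite) env measure \<Rightarrow> real \<Rightarrow> ereal" where
  "I_eta \<eta> x =
     (if x > 0 then ereal x * J_eta \<eta> (1 / x)
      else if x = 0 then Lim at_top (\<lambda>t. J_eta \<eta> t / ereal t)
      else ereal \<bar>x\<bar> * J_eta (distr \<eta> borel env_inv) (1 / \<bar>x\<bar>))"

definition ereal_ln :: "real \<Rightarrow> ereal" where
  "ereal_ln p = (if p \<le> 0 then - \<infinity> else ereal (ln p))"

definition convex_ereal_fun :: "(real \<Rightarrow> ereal) \<Rightarrow> bool" where
  "convex_ereal_fun I \<longleftrightarrow>
     (\<forall>x y t. 0 \<le> t \<and> t \<le> 1 \<longrightarrow> I (t * x + (1 - t) * y) \<le> ereal t * I x + ereal (1 - t) * I y)"

definition lower_semicont :: "(real \<Rightarrow> ereal) \<Rightarrow> bool" where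
  "lower_semicont I \<longleftrightarrow> (\<forall>x c. c < I x \<longrightarrow> (\<forall>\<^sub>F y in at x. c < I y))"

definition rate_function :: "(real \<Rightarrow> ereal) \<Rightarrow> bool" where
  "rate_function I \<longleftrightarrow> (\<forall>x. I x \<ge> 0) \<and> lower_semicont I"

definition satisfies_LDP :: "(nat \<Rightarrow> real set \<Rightarrow> real) \<Rightarrow> (real \<Rightarrow> ereal) \<Rightarrow> bool" where
  "satisfies_LDP P I \<longleftrightarrow> rate_function I \<and>
     (\<forall>A\<in>sets borel.
        - (INF x\<in>interior A. I x) \<le> liminf (\<lambda>n. ereal_ln (P n A) / ereal (real n)) \<and>
        limsup (\<lambda>n. ereal_ln (P n A) / ereal (real n)) \<le> - (INF x\<in>closure A. I x))"

end

theory Submission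
  imports Defs
begin

text \<open>
  Write \<open>u\<^sub>z(x)\<close> for the generating function \<open>E\<^sup>x[exp (\<lambda> T\<^sub>z); T\<^sub>z < \<infinity>]\<close>. Products of the matrices \<open>\<Phi>\<close> make
  \<open>u\<close> multiplicative along levels up to constants, and for \<open>\<lambda> \<le> \<lambda>\<^sub>c\<^sub>r\<^sub>i\<^sub>t\<close> ellipticity bounds their entries
  above and below uniformly in the environment; hence the rows of the products contract,
  \<open>\<mu>\<^sub>0\<close> exists, and the ergodic theorem gives \<open>log u\<^sub>n(0) / n \<rightarrow> \<Lambda>(\<lambda>)\<close>.

  Upper bound: if \<open>z\<close> is so far to the right that it cannot be reached by time \<open>n\<close>, then
  \<open>u\<^sub>z(0) \<ge> exp (\<lambda> n) P(\<xi>\<^sub>n = (y, j)) u\<^sub>z(y)\<close>, so \<open>P(X\<^sub>n = y)\<close> is at most a constant times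
  \<open>exp (- \<lambda> n) u\<^sub>y(0)\<close> for \<open>y \<ge> 0\<close>. Optimising over \<open>\<lambda>\<close> yields \<open>I(x) = sup\<^sub>\<lambda> (\<lambda> - x \<Lambda>(\<lambda>))\<close>, and at \<open>x = 0\<close>
  the value \<open>\<lambda>\<^sub>c\<^sub>r\<^sub>i\<^sub>t\<close>.

  Lower bound: tilting by \<open>exp (\<lambda> T)\<close> at points where \<open>\<Lambda>\<close> is differentiable, moving ballistically, and
  staying near the origin (at cost \<open>\<lambda>\<^sub>c\<^sub>r\<^sub>i\<^sub>t\<close> per unit time, because \<open>\<Phi>\<close> is infinite somewhere for every
  larger \<open>\<lambda>\<close>) give attainable triples (displacement, time, cost). Concatenation makes them a
  convex cone, and a separating hyperplane shows that its closure contains \<open>(x, 1, I(x))\<close>.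
  No differentiability or steepness of \<open>\<Lambda>\<close> at particular points is needed.

  Negative velocities are handled by reflection. The two half lines fit together since
  crossing left and then right is a return: this gives \<open>\<Lambda> + \<Lambda>\<^sup>I\<^sup>n\<^sup>v \<le> 0\<close> below \<open>\<lambda>\<^sub>c\<^sub>r\<^sub>i\<^sub>t\<close>, so that \<open>I\<close> is
  a supremum of continuous convex functions on the whole line.
\<close>

section \<open>One-step dynamics\<close>

text \<open>Two asymmetries shape the construction. Time: crossing estimates yield a probability at
  a time that is known only up to a small multiple of \<open>n\<close>, whereas the claim concerns
  time exactly \<open>n\<close>. Since jumps have size at most one, the mismatch in time becomes an
  equally small error in position, which is harmless in an open set. Place: a site where the walk
  lingers at rate close to \<open>lcrit\<close> is known to exist at some fixed level only, so it is
  cheap to reach from the origin but not from a level of order \<open>n\<close>. Hence all rest is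
  taken at the start, while motion must be possible from every level \<open>u * n\<close>.

  Uniformity comes from ellipticity: the constant in all comparisons depends on \<lambda> and the
  ellipticity data, but not on the environment or the level. It is continuous in \<lambda>, so the
  bounds persist at \<open>lcrit\<close> itself. One event of full measure has to serve all
  \<lambda> below \<open>lcrit\<close>, since the \<lambda> in use varies with the velocity and with
  the error allowed.\<close>

definition walk_step :: "('d::finite) env \<Rightarrow> (int \<Rightarrow> 'd \<Rightarrow> real) \<Rightarrow> int \<Rightarrow> 'd \<Rightarrow> real" where
  "walk_step \<omega> g x i =
     (\<Sum>l\<in>UNIV. qq (\<omega> x) $ i $ l * g (x - 1) l
              + rr (\<omega> x) $ i $ l * g x l
              + pp (\<omega> x) $ i $ l * g (x + 1) l)"

lemma pos_prob_Suc: "pos_prob \<omega> (Suc n) x i y j = walk_step \<omega> (\<lambda>x l. pos_prob \<omega> n x l y j) x i"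
  by (simp add: walk_step_def)

lemma hit_prob_Suc:
  "x \<noteq> z \<Longrightarrow> hit_prob \<omega> z (Suc n) x i j = walk_step \<omega> (\<lambda>x l. hit_prob \<omega> z n x l j) x i"
  by (simp add: walk_step_def)

lemma hit_prob_self: "hit_prob \<omega> z n z i j = (if n = 0 \<and> i = j then 1 else 0)"
  by (cases n) auto

lemma walk_step_sum: "walk_step \<omega> (\<lambda>x l. \<Sum>a\<in>A. f a x l) x i = (\<Sum>a\<in>A. walk_step \<omega> (f a) x i)"
  unfolding walk_step_def by (subst sum.swap) (simp add: sum_distrib_left sum.distrib)

lemma walk_step_cmult: "walk_step \<omega> (\<lambda>x l. f x l * c) x i = walk_step \<omega> f x i * c"
  unfolding walk_step_def sum_distrib_right by (intro sum.cong) (simp_all add: algebra_simps)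

lemma walk_step_cong:
  assumes "\<And>l. f (x - 1) l = g (x - 1) l" "\<And>l. f x l = g x l" "\<And>l. f (x + 1) l = g (x + 1) l"
  shows "walk_step \<omega> f x i = walk_step \<omega> g x i"
  unfolding walk_step_def using assms by simp

definition walk_env :: "('d::finite) env \<Rightarrow> bool" where
  "walk_env \<omega> \<longleftrightarrow> (\<forall>n. in_Sigma (\<omega> n))"

lemma walk_env_nonneg:
  assumes "walk_env \<omega>"
  shows "qq (\<omega> x) $ i $ j \<ge> 0" "rr (\<omega> x) $ i $ j \<ge> 0" "pp (\<omega> x) $ i $ j \<ge> 0"
  using assms by (auto simp: walk_env_def in_Sigma_def)

lemma walk_step_mono:
  assumes "walk_env \<omega>"
    and "\<And>l. f (x - 1) l \<le> g (x - 1) l" "\<And>l. f x l \<le> g x l" "\<And>l. f (x + 1) l \<le> g (x + 1) l"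
  shows "walk_step \<omega> f x i \<le> walk_step \<omega> g x i"
  unfolding walk_step_def
  by (intro sum_mono add_mono mult_left_mono assms walk_env_nonneg)

lemma walk_step_one:
  assumes "walk_env \<omega>" shows "walk_step \<omega> (\<lambda>_ _. 1) x i = 1"
  using assms by (simp add: walk_step_def walk_env_def in_Sigma_def)

lemma walk_step_zero: "walk_step \<omega> (\<lambda>_ _. 0) x i = 0"
  by (simp add: walk_step_def)

section \<open>Transition and hitting probabilities: mass, composition, splitting at a level\<close>

lemma pos_prob_nonneg: "walk_env \<omega> \<Longrightarrow> pos_prob \<omega> n x i y j \<ge> 0"
proof (induction n arbitrary: x i)
  case (Suc n)
  then have "walk_step \<omega> (\<lambda>_ _. 0) x i \<le> walk_step \<omega> (\<lambda>x l. pos_prob \<omega> n x l y j) x i"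
    by (intro walk_step_mono) auto
  then show ?case unfolding pos_prob_Suc by (simp add: walk_step_zero)
qed simp

lemma hit_prob_nonneg: "walk_env \<omega> \<Longrightarrow> hit_prob \<omega> z n x i j \<ge> 0"
proof (induction n arbitrary: x i)
  case (Suc n)
  then have "walk_step \<omega> (\<lambda>_ _. 0) x i \<le> walk_step \<omega> (\<lambda>x l. hit_prob \<omega> z n x l j) x i"
    by (intro walk_step_mono) auto
  then show ?case by (cases "x = z") (simp_all add: hit_prob_self hit_prob_Suc walk_step_zero del: hit_prob.simps(2))
qed simp

lemma hit_prob_le_pos_prob: "walk_env \<omega> \<Longrightarrow> hit_prob \<omega> z n x i j \<le> pos_prob \<omega> n x i z j"
proof (induction n arbitrary: x i)
  case (Suc n)
  then have "walk_step \<omega> (\<lambda>x l. hit_prob \<omega> z n x l j) x i \<le> walk_step \<omega> (\<lambda>x l. pos_prob \<omega> n x l z j) x i"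
    by (intro walk_step_mono) auto
  then show ?case using pos_prob_nonneg[OF Suc.prems, of "Suc n" x i z j]
    by (cases "x = z") (simp_all add: hit_prob_self hit_prob_Suc pos_prob_Suc del: hit_prob.simps(2) pos_prob.simps(2))
qed simp

lemma pos_prob_eq_0: "int n < \<bar>x - y\<bar> \<Longrightarrow> pos_prob \<omega> n x i y j = 0"
proof (induction n arbitrary: x i)
  case (Suc n)
  have "walk_step \<omega> (\<lambda>x l. pos_prob \<omega> n x l y j) x i = walk_step \<omega> (\<lambda>_ _. 0) x i"
    using Suc.prems by (intro walk_step_cong Suc.IH) auto
  then show ?case unfolding pos_prob_Suc by (simp add: walk_step_zero)
qed auto

lemma pos_prob_sum:
  assumes "walk_env \<omega>" "finite Y" "{x - int n..x + int n} \<subseteq> Y"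
  shows "(\<Sum>y\<in>Y. \<Sum>j\<in>UNIV. pos_prob \<omega> n x i y j) = 1"
  using assms(3)
proof (induction n arbitrary: x i)
  case 0
  then have "x \<in> Y" by auto
  have "(\<Sum>y\<in>Y. \<Sum>j\<in>UNIV. pos_prob \<omega> 0 x i y j) = (\<Sum>y\<in>Y. if x = y then 1 else 0)"
    by (intro sum.cong) auto
  also have "\<dots> = 1" using \<open>x \<in> Y\<close> assms(2) by simp
  finally show ?case .
next
  case (Suc n)
  have sub: "{x - 1 - int n..x - 1 + int n} \<subseteq> Y" "{x - int n..x + int n} \<subseteq> Y"
     "{x + 1 - int n..x + 1 + int n} \<subseteq> Y"
    using Suc.prems by (auto simp: subset_iff)
  have "(\<Sum>y\<in>Y. \<Sum>j\<in>UNIV. pos_prob \<omega> (Suc n) x i y j) =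
     walk_step \<omega> (\<lambda>x l. \<Sum>y\<in>Y. \<Sum>j\<in>UNIV. pos_prob \<omega> n x l y j) x i"
    unfolding pos_prob_Suc by (simp only: walk_step_sum)
  also have "\<dots> = walk_step \<omega> (\<lambda>_ _. 1) x i"
    using sub by (intro walk_step_cong Suc.IH) auto
  finally show ?case using walk_step_one[OF assms(1)] by simp
qed

lemma pos_prob_le_1:
  assumes "walk_env \<omega>" shows "pos_prob \<omega> n x i y j \<le> 1"
proof -
  let ?Y = "insert y {x - int n..x + int n}"
  have "pos_prob \<omega> n x i y j \<le> (\<Sum>j\<in>UNIV. pos_prob \<omega> n x i y j)"
    by (rule member_le_sum) (auto simp: pos_prob_nonneg assms)
  also have "\<dots> \<le> (\<Sum>y\<in>?Y. \<Sum>j\<in>UNIV. pos_prob \<omega> n x i y j)"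
    by (rule member_le_sum) (auto intro!: sum_nonneg simp: pos_prob_nonneg assms)
  also have "\<dots> = 1" by (rule pos_prob_sum) (auto simp: assms)
  finally show ?thesis .
qed

lemma pos_prob_add_ge:
  assumes "walk_env \<omega>"
  shows "pos_prob \<omega> n x i y l * pos_prob \<omega> m y l z j \<le> pos_prob \<omega> (n + m) x i z j"
proof (induction n arbitrary: x i)
  case 0 then show ?case using pos_prob_nonneg[OF assms] by auto
next
  case (Suc n)
  show ?case unfolding add_Suc pos_prob_Suc walk_step_cmult[symmetric]
    by (intro walk_step_mono assms Suc.IH)
qed

text \<open>Before time \<open>z - x\<close> the walk cannot have reached \<open>z\<close>, so conditioning on the
  position at such a time does not interfere with the hitting event.\<close>
lemma pos_hit_prob_add_ge:
  assumes "walk_env \<omega>" "int n < z - x"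
  shows "pos_prob \<omega> n x i y l * hit_prob \<omega> z m y l j \<le> hit_prob \<omega> z (n + m) x i j"
  using assms(2)
proof (induction n arbitrary: x i)
  case 0 then show ?case using hit_prob_nonneg[OF assms(1)] by auto
next
  case (Suc n)
  then have "x \<noteq> z" by auto
  then show ?case
    unfolding add_Suc hit_prob_Suc[OF \<open>x \<noteq> z\<close>] pos_prob_Suc walk_step_cmult[symmetric]
    using Suc.prems by (intro walk_step_mono assms Suc.IH) auto
qed

text \<open>A walk that is at \<open>z\<close> after \<open>s\<close> more steps is within distance
  \<open>s\<close> of \<open>z\<close> now. The induction peels steps off the front, so this
  geometric fact enters only in the case \<open>n = 0\<close>.\<close>

lemma pos_prob_near_before:
  assumes "walk_env \<omega>" "finite Y" "{z - int s..z + int s} \<subseteq> Y"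
  shows "pos_prob \<omega> (n + s) x i z j \<le> (\<Sum>y\<in>Y. \<Sum>l\<in>UNIV. pos_prob \<omega> n x i y l)"
proof (induction n arbitrary: x i)
  case 0
  have eq: "(\<Sum>y\<in>Y. \<Sum>l\<in>UNIV. pos_prob \<omega> 0 x i y l) = (if x \<in> Y then 1 else 0)"
  proof -
    have "(\<Sum>y\<in>Y. \<Sum>l\<in>UNIV. pos_prob \<omega> 0 x i y l) = (\<Sum>y\<in>Y. if x = y then 1 else 0)"
      by (intro sum.cong) auto
    then show ?thesis using assms(2) by simp
  qed
  show ?case
  proof (cases "x \<in> Y")
    case True then show ?thesis unfolding eq using pos_prob_le_1[OF assms(1)] by simp
  next
    case False
    then have "x \<notin> {z - int s..z + int s}" using assms(3) by blast
    then have "int s < \<bar>x - z\<bar>" by auto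
    then show ?thesis unfolding eq using False pos_prob_eq_0[of s x z \<omega> i j] by simp
  qed
next
  case (Suc n)
  show ?case unfolding add_Suc pos_prob_Suc walk_step_sum[symmetric]
    by (intro walk_step_mono assms Suc.IH)
qed

lemma pos_prob_near_after:
  assumes "walk_env \<omega>" "finite Y" "{z - int s..z + int s} \<subseteq> Y"
  shows "pos_prob \<omega> n x i z j \<le> (\<Sum>y\<in>Y. \<Sum>l\<in>UNIV. pos_prob \<omega> (n + s) x i y l)"
proof -
  have "pos_prob \<omega> n x i z j = (\<Sum>y\<in>Y. \<Sum>l\<in>UNIV. pos_prob \<omega> n x i z j * pos_prob \<omega> s z j y l)"
    using pos_prob_sum[OF assms] by (simp flip: sum_distrib_left)
  also have "\<dots> \<le> (\<Sum>y\<in>Y. \<Sum>l\<in>UNIV. pos_prob \<omega> (n + s) x i y l)"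
    by (intro sum_mono pos_prob_add_ge assms)
  finally show ?thesis .
qed

text \<open>Moves a lower bound from time \<open>t\<close> to time \<open>n\<close>, whichever is
  later, at the price of a spatial window of radius \<open>\<bar>int n - int t\<bar>\<close>. This
  is how approximate timing is repaired in the lower bound.\<close>

lemma pos_prob_near:
  assumes "walk_env \<omega>" "finite Y" "{z - \<bar>int n - int t\<bar>..z + \<bar>int n - int t\<bar>} \<subseteq> Y"
  shows "pos_prob \<omega> t x i z j \<le> (\<Sum>y\<in>Y. \<Sum>l\<in>UNIV. pos_prob \<omega> n x i y l)"
proof (cases "t \<le> n")
  case True
  then show ?thesis using pos_prob_near_after[OF assms(1,2), of z "n - t" t x i j] assms(3) by simp
next
  case False
  then show ?thesis using pos_prob_near_before[OF assms(1,2), of z "t - n" n x i j] assms(3) by simp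
qed

text \<open>Jumps have size at most one, so a walk starting at or below \<open>w\<close> visits
  \<open>w\<close> no later than \<open>z\<close>; the identity is the Markov property at the
  hitting time of \<open>w\<close>. For \<open>x < w\<close> one jump stays in the range
  \<open>x \<le> w\<close>, so first-step induction applies.\<close>

lemma hit_prob_split:
  assumes "x \<le> w" "w \<le> z"
  shows "hit_prob \<omega> z t x i j = (\<Sum>l\<in>UNIV. \<Sum>s\<le>t. hit_prob \<omega> w s x i l * hit_prob \<omega> z (t - s) w l j)"
  using assms
proof (induction t arbitrary: x i)
  case 0
  have "(\<Sum>l\<in>UNIV. (if x = w \<and> i = l then 1 else 0) * (if w = z \<and> l = j then 1 else 0))
     = (\<Sum>l\<in>UNIV. if i = l then (if x = z \<and> i = j then 1 else 0) else (0::real))"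
    using 0 by (intro sum.cong) auto
  then show ?case by simp
next
  case (Suc t)
  show ?case
  proof (cases "x = w")
    case True
    have "(\<Sum>s\<le>Suc t. hit_prob \<omega> w s w i l * hit_prob \<omega> z (Suc t - s) w l j)
       = (if i = l then hit_prob \<omega> z (Suc t) w i j else 0)" for l
    proof -
      have "(\<Sum>s\<le>Suc t. hit_prob \<omega> w s w i l * hit_prob \<omega> z (Suc t - s) w l j)
        = (\<Sum>s\<le>Suc t. if s = 0 then (if i = l then hit_prob \<omega> z (Suc t) w i j else 0) else 0)"
        by (intro sum.cong) (auto simp: hit_prob_self simp del: hit_prob.simps)
      then show ?thesis by (simp del: hit_prob.simps)
    qed
    then show ?thesis using True by (simp del: hit_prob.simps)
  next
    case False
    then have xw: "x < w" "x \<noteq> w" "x \<noteq> z" using Suc.prems by auto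
    have "hit_prob \<omega> z (Suc t) x i j = walk_step \<omega> (\<lambda>x l. hit_prob \<omega> z t x l j) x i"
      using xw by (simp add: hit_prob_Suc del: hit_prob.simps)
    also have "\<dots> = walk_step \<omega> (\<lambda>x m. \<Sum>l\<in>UNIV. \<Sum>s\<le>t. hit_prob \<omega> w s x m l * hit_prob \<omega> z (t - s) w l j) x i"
      using xw Suc.prems by (intro walk_step_cong Suc.IH) auto
    also have "\<dots> = (\<Sum>l\<in>UNIV. \<Sum>s\<le>t. hit_prob \<omega> w (Suc s) x i l * hit_prob \<omega> z (t - s) w l j)"
      unfolding walk_step_sum walk_step_cmult hit_prob_Suc[OF xw(2)] ..
    also have "\<dots> = (\<Sum>l\<in>UNIV. \<Sum>s\<le>Suc t. hit_prob \<omega> w s x i l * hit_prob \<omega> z (Suc t - s) w l j)"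
      unfolding sum.atMost_Suc_shift using xw by simp
    finally show ?thesis .
  qed
qed

subsection \<open>Reflection and translation\<close>

lemma env_inv_simps [simp]:
  "qq (env_inv \<omega> x) = pp (\<omega> (- x))" "rr (env_inv \<omega> x) = rr (\<omega> (- x))" "pp (env_inv \<omega> x) = qq (\<omega> (- x))"
  by (simp_all add: env_inv_def qq_def pp_def rr_def)

lemma env_inv_env_inv [simp]: "env_inv (env_inv \<omega>) = \<omega>"
  by (rule ext) (simp add: env_inv_def[of "env_inv \<omega>"] del: env_inv_simps,
      simp add: env_inv_def qq_def pp_def rr_def)

lemma walk_step_env_inv: "walk_step (env_inv \<omega>) g (- x) i = walk_step \<omega> (\<lambda>x. g (- x)) x i"
proof -
  have *: "- x - 1 = - (x + 1)" "- x + 1 = - (x - 1)" by auto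
  show ?thesis unfolding walk_step_def * env_inv_simps by (intro sum.cong) simp_all
qed

lemma pos_prob_env_inv: "pos_prob (env_inv \<omega>) n (- x) i (- y) j = pos_prob \<omega> n x i y j"
  by (induction n arbitrary: x i) (simp_all only: pos_prob_Suc walk_step_env_inv pos_prob.simps(1) neg_equal_iff_equal)

lemma hit_prob_env_inv: "hit_prob (env_inv \<omega>) (- z) n (- x) i j = hit_prob \<omega> z n x i j"
proof (induction n arbitrary: x i)
  case (Suc n)
  then show ?case
    by (cases "x = z") (simp_all add: hit_prob_self hit_prob_Suc walk_step_env_inv del: hit_prob.simps(2))
qed simp

lemma in_Sigma_kappa_env_inv: "in_Sigma_kappa \<kappa> (env_inv \<omega> n) \<longleftrightarrow> in_Sigma_kappa \<kappa> (\<omega> (- n))"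
  unfolding in_Sigma_kappa_def in_Sigma_def env_inv_simps by (auto simp: add.commute add.left_commute)

lemma walk_step_shift: "walk_step (shift \<omega>) g x i = walk_step \<omega> (\<lambda>x. g (x - 1)) (x + 1) i"
  unfolding walk_step_def shift_def by (intro sum.cong) (simp_all add: algebra_simps)

lemma hit_prob_shift: "hit_prob (shift \<omega>) z n x i j = hit_prob \<omega> (z + 1) n (x + 1) i j"
proof (induction n arbitrary: x i)
  case (Suc n)
  then show ?case
    by (cases "x = z") (simp_all add: hit_prob_self hit_prob_Suc walk_step_shift del: hit_prob.simps(2))
qed simp

subsection \<open>Consequences of ellipticity\<close>

text \<open>The error \<open>M - a n\<close> is at most its image under the substochastic matrix
  \<open>r\<close> one step earlier, so it contracts by \<rho>; the initial error is controlled by a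
  maximum principle for the fixed point \<open>M\<close>.\<close>

lemma substochastic_iteration_bound:
  fixes r :: "'d::finite \<Rightarrow> 'd \<Rightarrow> real" and a :: "nat \<Rightarrow> 'd \<Rightarrow> real"
  assumes r: "\<And>i l. r i l \<ge> 0" "\<And>i. (\<Sum>l\<in>UNIV. r i l) \<le> \<rho>" and \<rho>: "\<rho> < 1"
    and p: "\<And>i. p i \<le> 1"
    and M: "\<And>i. M i = p i + (\<Sum>l\<in>UNIV. r i l * M l)" "\<And>i. M i \<ge> 0"
    and a: "\<And>i. a 0 i \<ge> 0" "\<And>n i. a (Suc n) i \<ge> p i + (\<Sum>l\<in>UNIV. r i l * a n l)"
  shows "M i - a n i \<le> \<rho> ^ n / (1 - \<rho>)"
proof (induction n arbitrary: i)
  case 0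
  \<comment> \<open>At an index where \<open>M\<close> is maximal the fixed point equation gives
    \<open>m \<le> 1 + \<rho> * m\<close>.\<close>
  define m where "m = Max (range M)"
  have m: "M i \<le> m" for i unfolding m_def by (rule Max_ge) auto
  have "m \<in> range M" unfolding m_def by (rule Max_in) auto
  then obtain k where k: "M k = m" by auto
  have "m \<ge> 0" using M(2)[of k] k by simp
  have "m = p k + (\<Sum>l\<in>UNIV. r k l * M l)" using M(1) k by metis
  also have "\<dots> \<le> 1 + (\<Sum>l\<in>UNIV. r k l * m)" by (intro add_mono p sum_mono mult_left_mono m r)
  also have "\<dots> = 1 + (\<Sum>l\<in>UNIV. r k l) * m" by (simp add: sum_distrib_right)
  also have "\<dots> \<le> 1 + \<rho> * m" using r(2)[of k] \<open>m \<ge> 0\<close> by (intro add_left_mono mult_right_mono)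
  finally have "m * (1 - \<rho>) \<le> 1" by (simp add: algebra_simps)
  then have "m \<le> 1 / (1 - \<rho>)" using \<rho> by (simp add: field_simps)
  then show ?case using m[of i] a(1)[of i] by simp
next
  case (Suc n)
  have \<rho>0: "0 \<le> \<rho>" using order_trans[OF sum_nonneg[of UNIV "r undefined"] r(2)] r(1) by simp
  have "M i - a (Suc n) i \<le> (\<Sum>l\<in>UNIV. r i l * M l) - (\<Sum>l\<in>UNIV. r i l * a n l)"
    using M(1)[of i] a(2)[of i n] by linarith
  also have "\<dots> = (\<Sum>l\<in>UNIV. r i l * (M l - a n l))" by (simp add: sum_subtractf algebra_simps)
  also have "\<dots> \<le> (\<Sum>l\<in>UNIV. r i l * (\<rho> ^ n / (1 - \<rho>)))" by (intro sum_mono mult_left_mono Suc r)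
  also have "\<dots> = (\<Sum>l\<in>UNIV. r i l) * (\<rho> ^ n / (1 - \<rho>))" by (rule sum_distrib_right[symmetric])
  also have "\<dots> \<le> \<rho> * (\<rho> ^ n / (1 - \<rho>))" using r(2)[of i] \<rho> \<rho>0 by (intro mult_right_mono) auto
  finally show ?case by simp
qed

lemma in_Sigma_kappa_row_sums:
  assumes "in_Sigma_kappa \<kappa> s"
  shows "(\<Sum>l\<in>UNIV. rr s $ i $ l) \<le> 1 - 2 * \<kappa>"
proof -
  have "(\<Sum>j\<in>UNIV. qq s $ i $ j) + (\<Sum>j\<in>UNIV. rr s $ i $ j) + (\<Sum>j\<in>UNIV. pp s $ i $ j) = 1"
    using assms unfolding in_Sigma_kappa_def in_Sigma_def by (simp add: sum.distrib)
  moreover have "(\<Sum>j\<in>UNIV. qq s $ i $ j) \<ge> \<kappa>" "(\<Sum>j\<in>UNIV. pp s $ i $ j) \<ge> \<kappa>"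
    using assms unfolding in_Sigma_kappa_def by auto
  ultimately show ?thesis by linarith
qed

lemma in_Sigma_kappa_le: "in_Sigma_kappa \<kappa> (s :: 'd::finite site) \<Longrightarrow> \<kappa> \<le> 1 / 2"
  using in_Sigma_kappa_row_sums[of \<kappa> s undefined] sum_nonneg[of UNIV "\<lambda>l. rr s $ undefined $ l"]
  by (auto simp: in_Sigma_kappa_def in_Sigma_def)

definition elliptic_env :: "real \<Rightarrow> ('d::finite) env \<Rightarrow> bool" where
  "elliptic_env \<kappa> \<omega> \<longleftrightarrow> (\<forall>n. in_Sigma_kappa \<kappa> (\<omega> n))"

lemma elliptic_env_walk_env: "elliptic_env \<kappa> \<omega> \<Longrightarrow> walk_env \<omega>"
  by (auto simp: elliptic_env_def walk_env_def in_Sigma_kappa_def)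

lemma elliptic_env_inv: "elliptic_env \<kappa> (env_inv \<omega>) \<longleftrightarrow> elliptic_env \<kappa> \<omega>"
  unfolding elliptic_env_def in_Sigma_kappa_env_inv by (metis minus_minus)

text \<open>The expansion \<open>(I - r)\<^sup>-\<^sup>1 p = p + r p + r\<^sup>2 p + \<dots>\<close> converges geometrically, so a bounded
  number of its terms already carries half of the lower bound \<open>\<kappa>\<close>.\<close>
lemma hit_right_lower:
  assumes "\<kappa> > 0"
  shows "\<exists>N c. c > 0 \<and> (\<forall>(\<omega> :: ('d::finite) env) x i j. elliptic_env \<kappa> \<omega> \<longrightarrow>
     (\<exists>t\<le>N. c \<le> hit_prob \<omega> (x + 1) t x i j))"
proof (cases "\<kappa> \<le> 1 / 2")
  case False
  then have "\<not> elliptic_env \<kappa> \<omega>" for \<omega> :: "'d env"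
    using in_Sigma_kappa_le[of \<kappa> "\<omega> 0"] by (auto simp: elliptic_env_def)
  then show ?thesis by (auto intro!: exI[of _ 1])
next
  case True
  define \<rho> where "\<rho> = 1 - 2 * \<kappa>"
  have \<rho>: "0 \<le> \<rho>" "\<rho> < 1" using assms True by (auto simp: \<rho>_def)
  have "(\<lambda>n. \<rho> ^ n / (1 - \<rho>)) \<longlonglongrightarrow> 0 / (1 - \<rho>)"
    using \<rho> by (intro tendsto_intros LIMSEQ_realpow_zero) auto
  then have "\<forall>\<^sub>F n in sequentially. \<rho> ^ n / (1 - \<rho>) < \<kappa> / 2"
    using assms by (intro order_tendstoD) auto
  then obtain N where N: "\<rho> ^ N / (1 - \<rho>) < \<kappa> / 2" by (auto simp: eventually_sequentially)
  \<comment> \<open>Half of \<kappa> spread over the \<open>N + 1\<close> times \<open>0..N\<close>: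
    some time carries at least this share.\<close>
  define c where "c = \<kappa> / (2 * (real N + 1))"
  have main: "\<exists>t\<le>N. c \<le> hit_prob \<omega> (x + 1) t x i j" if ell: "elliptic_env \<kappa> \<omega>" for \<omega> :: "'d env" and x i j
  proof -
    have we: "walk_env \<omega>" using ell by (rule elliptic_env_walk_env)
    have k: "in_Sigma_kappa \<kappa> (\<omega> x)" using ell by (simp add: elliptic_env_def)
    define R where "R = mat 1 - rr (\<omega> x)"
    define B where "B = matrix_inv R ** pp (\<omega> x)"
    have "invertible R" using k by (simp add: R_def in_Sigma_kappa_def)
    then have "R ** matrix_inv R = mat 1"
      unfolding invertible_def matrix_inv_def by (rule someI2_ex) simp
    then have RB: "R ** B = pp (\<omega> x)" unfolding B_def by (simp add: matrix_mul_assoc)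
    have B: "B $ i $ j = pp (\<omega> x) $ i $ j + (\<Sum>l\<in>UNIV. rr (\<omega> x) $ i $ l * B $ l $ j)" for i
    proof -
      have "(\<Sum>l\<in>UNIV. mat 1 $ i $ l * B $ l $ j) = (mat 1 ** B) $ i $ j"
        by (simp add: matrix_matrix_mult_def)
      then have "(\<Sum>l\<in>UNIV. R $ i $ l * B $ l $ j) = B $ i $ j - (\<Sum>l\<in>UNIV. rr (\<omega> x) $ i $ l * B $ l $ j)"
        by (simp add: R_def left_diff_distrib sum_subtractf)
      moreover have "(\<Sum>l\<in>UNIV. R $ i $ l * B $ l $ j) = (R ** B) $ i $ j"
        by (simp add: matrix_matrix_mult_def)
      ultimately show ?thesis using RB by (simp add: algebra_simps)
    qed
    have Bk: "B $ i $ j \<ge> \<kappa>" for i using k by (auto simp: B_def R_def in_Sigma_kappa_def)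
    define a where "a n i = (\<Sum>t\<le>n. hit_prob \<omega> (x + 1) t x i j)" for n i
    have "B $ i $ j - a N i \<le> \<rho> ^ N / (1 - \<rho>)"
    proof (rule substochastic_iteration_bound[where M = "\<lambda>i. B $ i $ j" and r = "\<lambda>i l. rr (\<omega> x) $ i $ l"
          and p = "\<lambda>i. pp (\<omega> x) $ i $ j"])
      show "pp (\<omega> x) $ i $ j \<le> 1" for i
      proof -
        have "pp (\<omega> x) $ i $ j \<le> (\<Sum>j\<in>UNIV. qq (\<omega> x) $ i $ j + rr (\<omega> x) $ i $ j + pp (\<omega> x) $ i $ j)"
          by (rule order_trans[OF _ member_le_sum[of j]])
            (auto simp: walk_env_nonneg[OF we] add_nonneg_nonneg)
        then show ?thesis using k by (simp add: in_Sigma_kappa_def in_Sigma_def)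
      qed
      show "a 0 i \<ge> 0" for i by (simp add: a_def)
      show "a (Suc n) i \<ge> pp (\<omega> x) $ i $ j + (\<Sum>l\<in>UNIV. rr (\<omega> x) $ i $ l * a n l)" for n i
      proof -
        let ?h = "\<lambda>x l. \<Sum>t\<le>n. hit_prob \<omega> (x + 1) t x l j"
        let ?g = "\<lambda>y l. \<Sum>t\<le>n. hit_prob \<omega> (x + 1) t y l j"
        have one: "?g (x + 1) l = (if l = j then 1 else 0)" for l
        proof -
          have "?g (x + 1) l = (\<Sum>t\<le>n. if t = 0 then (if l = j then 1 else 0) else 0)"
            by (intro sum.cong) (auto simp: hit_prob_self)
          then show ?thesis by simp
        qed
        have "a (Suc n) i = (\<Sum>t\<le>n. hit_prob \<omega> (x + 1) (Suc t) x i j)"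
          unfolding a_def by (subst sum.atMost_Suc_shift) simp
        also have "\<dots> = walk_step \<omega> ?g x i"
          by (simp add: hit_prob_Suc walk_step_sum del: hit_prob.simps)
        also have "\<dots> = (\<Sum>l\<in>UNIV. qq (\<omega> x) $ i $ l * ?g (x - 1) l) + (\<Sum>l\<in>UNIV. rr (\<omega> x) $ i $ l * ?g x l)
            + (\<Sum>l\<in>UNIV. pp (\<omega> x) $ i $ l * ?g (x + 1) l)"
          unfolding walk_step_def by (simp only: sum.distrib)
        also have "(\<Sum>l\<in>UNIV. pp (\<omega> x) $ i $ l * ?g (x + 1) l) = pp (\<omega> x) $ i $ j"
          unfolding one by (simp add: if_distrib cong: if_cong)
        finally have eq: "a (Suc n) i = (\<Sum>l\<in>UNIV. qq (\<omega> x) $ i $ l * ?g (x - 1) l)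
            + (\<Sum>l\<in>UNIV. rr (\<omega> x) $ i $ l * a n l) + pp (\<omega> x) $ i $ j"
          by (simp add: a_def)
        \<comment> \<open>Crossings that begin with a jump to the left are discarded here, which
          turns the recursion for \<open>a\<close> into an inequality.\<close>
        have "(\<Sum>l\<in>UNIV. qq (\<omega> x) $ i $ l * ?g (x - 1) l) \<ge> 0"
          by (intro sum_nonneg mult_nonneg_nonneg walk_env_nonneg[OF we] hit_prob_nonneg[OF we])
        then show ?thesis using eq by linarith
      qed
      show "0 \<le> B $ i $ j" for i using Bk[of i] assms by linarith
      show "(\<Sum>l\<in>UNIV. rr (\<omega> x) $ i $ l) \<le> \<rho>" for i
        unfolding \<rho>_def by (rule in_Sigma_kappa_row_sums[OF k])
    qed (use \<rho> in \<open>auto simp: walk_env_nonneg[OF we] intro: B\<close>)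
    then have "a N i > \<kappa> / 2" using Bk[of i] N by linarith
    show ?thesis
    proof (rule ccontr)
      assume "\<not> ?thesis"
      then have "a N i \<le> (\<Sum>t\<le>N. c)" unfolding a_def by (intro sum_mono) (meson atMost_iff linear)
      also have "\<dots> = \<kappa> / 2" by (simp add: c_def field_simps)
      finally show False using \<open>a N i > \<kappa> / 2\<close> by simp
    qed
  qed
  have "c > 0" using assms by (simp add: c_def)
  then show ?thesis using main by blast
qed

lemma pos_right_step_lower:
  assumes "elliptic_env \<kappa> \<omega>"
  shows "\<kappa> \<le> (\<Sum>j\<in>UNIV. pp (\<omega> x) $ i $ j)"
  using assms by (auto simp: elliptic_env_def in_Sigma_kappa_def)

section \<open>Generating functions of hitting times\<close>

definition hit_gf :: "('d::finite) env \<Rightarrow> real \<Rightarrow> int \<Rightarrow> int \<Rightarrow> 'd \<Rightarrow> 'd \<Rightarrow> real" where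
  "hit_gf \<omega> lam x z i j = (\<Sum>t. exp (lam * real t) * hit_prob \<omega> z t x i j)"

definition hit_mgf :: "('d::finite) env \<Rightarrow> real \<Rightarrow> int \<Rightarrow> int \<Rightarrow> 'd \<Rightarrow> real" where
  "hit_mgf \<omega> lam x z i = (\<Sum>j\<in>UNIV. hit_gf \<omega> lam x z i j)"

text \<open>Finiteness is asked on all levels at once, so that crossings of any length are products
  of finite matrices; it also makes the condition invariant under the shift.\<close>

definition gf_finite :: "('d::finite) env \<Rightarrow> real \<Rightarrow> bool" where
  "gf_finite \<omega> lam \<longleftrightarrow> (\<forall>k i j. summable (\<lambda>t. exp (lam * real t) * hit_prob \<omega> (k + 1) t k i j))"

lemma hit_gf_self: "hit_gf \<omega> lam x x i j = (if i = j then 1 else 0)"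
  and summable_hit_self: "summable (\<lambda>t. exp (lam * real t) * hit_prob \<omega> x t x i j)"
proof -
  have *: "(\<lambda>t. exp (lam * real t) * hit_prob \<omega> x t x i j) = (\<lambda>t. if t = 0 then (if i = j then 1 else 0) else 0)"
    by (rule ext) (simp add: hit_prob_self)
  show "hit_gf \<omega> lam x x i j = (if i = j then 1 else 0)"
    unfolding hit_gf_def * by (subst suminf_finite[of "{0}"]) auto
  show "summable (\<lambda>t. exp (lam * real t) * hit_prob \<omega> x t x i j)"
    unfolding * by (rule summable_finite[of "{0}"]) auto
qed

lemma hit_mgf_self: "hit_mgf \<omega> lam x x i = 1"
  by (simp add: hit_mgf_def hit_gf_self)

text \<open>The exponential weight factorises over \<open>s + (t - s)\<close>, so
  \<open>hit_prob_split\<close> exhibits the series as a finite sum of Cauchy products, absolutely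
  convergent by nonnegativity.\<close>

lemma hit_sums_mult:
  assumes "walk_env \<omega>" "x \<le> w" "w \<le> z"
    and "\<And>i j. summable (\<lambda>t. exp (lam * real t) * hit_prob \<omega> w t x i j)"
    and "\<And>i j. summable (\<lambda>t. exp (lam * real t) * hit_prob \<omega> z t w i j)"
  shows "(\<lambda>t. exp (lam * real t) * hit_prob \<omega> z t x i j) sums (\<Sum>l\<in>UNIV. hit_gf \<omega> lam x w i l * hit_gf \<omega> lam w z l j)"
proof -
  let ?a = "\<lambda>l t. exp (lam * real t) * hit_prob \<omega> w t x i l"
  let ?b = "\<lambda>l t. exp (lam * real t) * hit_prob \<omega> z t w l j"
  have "(\<lambda>t. \<Sum>l\<in>UNIV. \<Sum>s\<le>t. ?a l s * ?b l (t - s)) sums (\<Sum>l\<in>UNIV. hit_gf \<omega> lam x w i l * hit_gf \<omega> lam w z l j)"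
    unfolding hit_gf_def
    by (intro sums_sum Cauchy_product_sums)
       (use assms(4,5) in \<open>simp_all add: hit_prob_nonneg[OF assms(1)]\<close>)
  also have "(\<lambda>t. \<Sum>l\<in>UNIV. \<Sum>s\<le>t. ?a l s * ?b l (t - s)) = (\<lambda>t. exp (lam * real t) * hit_prob \<omega> z t x i j)"
  proof
    fix t
    have "?a l s * ?b l (t - s) = exp (lam * real t) * (hit_prob \<omega> w s x i l * hit_prob \<omega> z (t - s) w l j)"
      if "s \<le> t" for l s
    proof -
      have "lam * real t = lam * real s + lam * real (t - s)" using that by (simp add: algebra_simps of_nat_diff)
      then have "exp (lam * real t) = exp (lam * real s) * exp (lam * real (t - s))" by (simp only: exp_add)
      then show ?thesis by simp
    qed
    then show "(\<Sum>l\<in>UNIV. \<Sum>s\<le>t. ?a l s * ?b l (t - s)) = exp (lam * real t) * hit_prob \<omega> z t x i j"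
      unfolding hit_prob_split[OF assms(2,3), of \<omega> t i j] sum_distrib_left by (intro sum.cong) auto
  qed
  finally show ?thesis .
qed

lemma summable_hit:
  assumes "walk_env \<omega>" "gf_finite \<omega> lam" "x \<le> z"
  shows "summable (\<lambda>t. exp (lam * real t) * hit_prob \<omega> z t x i j)"
  using assms(3)
proof (induction z arbitrary: i j rule: int_ge_induct)
  case base show ?case by (rule summable_hit_self)
next
  case (step z)
  have "summable (\<lambda>t. exp (lam * real t) * hit_prob \<omega> (z + 1) t z i j)" for i j
    using assms(2) by (simp add: gf_finite_def)
  then show ?case using hit_sums_mult[OF assms(1) step.hyps, of "z + 1" lam] step.IH by (auto simp: sums_iff)
qed

lemma hit_gf_mult:
  assumes "walk_env \<omega>" "gf_finite \<omega> lam" "x \<le> w" "w \<le> z"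
  shows "hit_gf \<omega> lam x z i j = (\<Sum>l\<in>UNIV. hit_gf \<omega> lam x w i l * hit_gf \<omega> lam w z l j)"
  using hit_sums_mult[OF assms(1,3,4) summable_hit[OF assms(1-3)] summable_hit[OF assms(1,2,4)]]
  unfolding hit_gf_def[of _ _ x z] by (simp add: sums_iff)

lemma hit_mgf_mult:
  assumes "walk_env \<omega>" "gf_finite \<omega> lam" "x \<le> w" "w \<le> z"
  shows "hit_mgf \<omega> lam x z i = (\<Sum>l\<in>UNIV. hit_gf \<omega> lam x w i l * hit_mgf \<omega> lam w z l)"
  unfolding hit_mgf_def hit_gf_mult[OF assms] sum_distrib_left by (rule sum.swap)

lemma hit_gf_ge_term:
  assumes "walk_env \<omega>" "gf_finite \<omega> lam" "x \<le> z"
  shows "exp (lam * real t) * hit_prob \<omega> z t x i j \<le> hit_gf \<omega> lam x z i j"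
  unfolding hit_gf_def
  using sum_le_suminf[OF summable_hit[OF assms], of "{t}"] hit_prob_nonneg[OF assms(1)] by auto

lemma hit_gf_nonneg:
  assumes "walk_env \<omega>" "gf_finite \<omega> lam" "x \<le> z"
  shows "0 \<le> hit_gf \<omega> lam x z i j"
  unfolding hit_gf_def by (rule suminf_nonneg[OF summable_hit[OF assms]]) (simp add: hit_prob_nonneg[OF assms(1)])

lemma hit_mgf_nonneg:
  assumes "walk_env \<omega>" "gf_finite \<omega> lam" "x \<le> z"
  shows "0 \<le> hit_mgf \<omega> lam x z i"
  unfolding hit_mgf_def by (intro sum_nonneg hit_gf_nonneg assms)

lemma gf_finite_mono:
  assumes "walk_env \<omega>" "gf_finite \<omega> lam'" "lam \<le> lam'"
  shows "gf_finite \<omega> lam"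
  unfolding gf_finite_def
proof (intro allI)
  fix k i j
  have "summable (\<lambda>t. exp (lam' * real t) * hit_prob \<omega> (k + 1) t k i j)"
    using assms(2) by (simp add: gf_finite_def)
  then show "summable (\<lambda>t. exp (lam * real t) * hit_prob \<omega> (k + 1) t k i j)"
    by (rule summable_comparison_test'[where N = 0])
      (use assms(3) in \<open>auto simp: hit_prob_nonneg[OF assms(1)] abs_mult intro!: mult_right_mono\<close>)
qed

lemma hit_gf_mono:
  assumes "walk_env \<omega>" "gf_finite \<omega> lam'" "lam \<le> lam'" "x \<le> z"
  shows "hit_gf \<omega> lam x z i j \<le> hit_gf \<omega> lam' x z i j"
  unfolding hit_gf_def
  using assms(3) hit_prob_nonneg[OF assms(1)]
  by (intro suminf_le summable_hit assms gf_finite_mono[OF assms(1-3)]) (auto intro!: mult_right_mono)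

lemma hit_mgf_mono:
  assumes "walk_env \<omega>" "gf_finite \<omega> lam'" "lam \<le> lam'" "x \<le> z"
  shows "hit_mgf \<omega> lam x z i \<le> hit_mgf \<omega> lam' x z i"
  unfolding hit_mgf_def by (intro sum_mono hit_gf_mono assms)

text \<open>Keeping only the paths that sit at \<open>(y, l)\<close> at time \<open>n\<close> leaves
  a copy of the series shifted by \<open>n\<close>. The condition \<open>int n < z - x\<close>
  ensures that \<open>z\<close> has not been visited up to that time.\<close>

lemma pos_prob_hit_mgf_le:
  assumes we: "walk_env \<omega>" and gf: "gf_finite \<omega> lam" and n: "int n < z - x" and y: "y \<le> z"
  shows "exp (lam * real n) * pos_prob \<omega> n x i y l * hit_mgf \<omega> lam y z l \<le> hit_mgf \<omega> lam x z i"
proof -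
  have xz: "x \<le> z" using n by auto
  have "exp (lam * real n) * pos_prob \<omega> n x i y l * hit_gf \<omega> lam y z l j \<le> hit_gf \<omega> lam x z i j" for j
  proof -
    let ?f = "\<lambda>t. exp (lam * real t) * hit_prob \<omega> z t x i j"
    have sf: "summable ?f" by (rule summable_hit[OF we gf xz])
    have "exp (lam * real n) * pos_prob \<omega> n x i y l * hit_gf \<omega> lam y z l j
        = (\<Sum>t. exp (lam * real n) * pos_prob \<omega> n x i y l * (exp (lam * real t) * hit_prob \<omega> z t y l j))"
      unfolding hit_gf_def by (rule suminf_mult[symmetric, OF summable_hit[OF we gf y]])
    also have "\<dots> \<le> (\<Sum>t. ?f (t + n))"
    proof (rule suminf_le)
      fix t
      have "exp (lam * real n) * pos_prob \<omega> n x i y l * (exp (lam * real t) * hit_prob \<omega> z t y l j)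
        = exp (lam * real (t + n)) * (pos_prob \<omega> n x i y l * hit_prob \<omega> z t y l j)"
        by (simp add: exp_add algebra_simps)
      also have "\<dots> \<le> ?f (t + n)"
        using pos_hit_prob_add_ge[OF we n, of i y l t j] by (simp add: add.commute)
      finally show "exp (lam * real n) * pos_prob \<omega> n x i y l * (exp (lam * real t) * hit_prob \<omega> z t y l j) \<le> ?f (t + n)" .
      show "summable (\<lambda>t. ?f (t + n))" by (rule summable_ignore_initial_segment[OF sf])
    qed (intro summable_mult summable_hit we gf y)
    also have "\<dots> \<le> (\<Sum>t. ?f t)"
      using suminf_split_initial_segment[OF sf, of n] sum_nonneg[of "{..<n}" ?f] hit_prob_nonneg[OF we] by simp
    finally show ?thesis by (simp add: hit_gf_def)
  qed
  then show ?thesis unfolding hit_mgf_def sum_distrib_left by (intro sum_mono)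
qed

section \<open>Crossing estimates under two-sided bounds on the entries\<close>

lemma hit_mgf_pos_of_steps:
  assumes "walk_env \<omega>" "gf_finite \<omega> lam" and step: "\<And>k i j. 0 < hit_gf \<omega> lam k (k + 1) i j" and "x \<le> z"
  shows "0 < hit_mgf \<omega> lam x z i"
  using assms(4)
proof (induction x arbitrary: i rule: int_le_induct)
  case base show ?case by (simp add: hit_mgf_self)
next
  case (step x)
  have "hit_mgf \<omega> lam (x - 1) z i = (\<Sum>l\<in>UNIV. hit_gf \<omega> lam (x - 1) x i l * hit_mgf \<omega> lam x z l)"
    by (rule hit_mgf_mult[OF assms(1,2)]) (use step in auto)
  also have "\<dots> > 0" using assms(3)[of "x - 1"] step.IH by (intro sum_pos) auto
  finally show ?case .
qed

text \<open>\<open>B\<close> is uniform in the level, so the losses below are fixed powers of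
  \<open>B\<close>, independent of the distance crossed; after division of logarithms by
  \<open>n\<close> they disappear.\<close>

locale walk_gf =
  fixes \<omega> :: "('d::finite) env" and lam B :: real
  assumes we: "walk_env \<omega>" and gf: "gf_finite \<omega> lam" and B1: "1 \<le> B"
    and gf_lower: "\<And>k i j. 1 / B \<le> hit_gf \<omega> lam k (k + 1) i j"
    and gf_upper: "\<And>k i j. hit_gf \<omega> lam k (k + 1) i j \<le> B"
begin

lemma gf_step_pos: "0 < hit_gf \<omega> lam k (k + 1) i j"
  using gf_lower[of k i j] B1 by (smt (verit) zero_less_divide_iff)

lemma hit_mgf_pos: "x \<le> z \<Longrightarrow> 0 < hit_mgf \<omega> lam x z i"
  by (rule hit_mgf_pos_of_steps[OF we gf gf_step_pos])

text \<open>Only the first crossing matrix sees the starting state. Its entries lie between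
  \<open>1 / B\<close> and \<open>B\<close>, so corresponding entries of two rows differ by a factor
  of at most \<open>B\<^sup>2\<close>, and the rest of the crossing is common to both.\<close>

lemma hit_mgf_compare:
  assumes "x \<le> z" shows "hit_mgf \<omega> lam x z i \<le> B\<^sup>2 * hit_mgf \<omega> lam x z i'"
proof (cases "x = z")
  case True then show ?thesis using B1 by (simp add: hit_mgf_self one_le_power)
next
  case False
  then have xz: "x + 1 \<le> z" using assms by auto
  have *: "hit_mgf \<omega> lam x z i = (\<Sum>l\<in>UNIV. hit_gf \<omega> lam x (x + 1) i l * hit_mgf \<omega> lam (x + 1) z l)" for i
    by (rule hit_mgf_mult[OF we gf]) (use xz in auto)
  have "hit_gf \<omega> lam x (x + 1) i l \<le> B\<^sup>2 * hit_gf \<omega> lam x (x + 1) i' l" for l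
  proof -
    have "hit_gf \<omega> lam x (x + 1) i l \<le> B\<^sup>2 * (1 / B)"
      using gf_upper[of x i l] B1 by (simp add: power2_eq_square)
    also have "\<dots> \<le> B\<^sup>2 * hit_gf \<omega> lam x (x + 1) i' l" by (intro mult_left_mono gf_lower) auto
    finally show ?thesis .
  qed
  then show ?thesis unfolding * sum_distrib_left mult.assoc[symmetric]
    by (intro sum_mono mult_right_mono hit_mgf_nonneg we gf xz)
qed

text \<open>The random state at \<open>w\<close> is replaced by a fixed \<open>i'\<close> through
  \<open>hit_mgf_compare\<close>, which decouples the two crossings.\<close>

lemma hit_mgf_split_upper:
  assumes "x \<le> w" "w \<le> z"
  shows "hit_mgf \<omega> lam x z i \<le> B\<^sup>2 * (hit_mgf \<omega> lam x w i * hit_mgf \<omega> lam w z i')"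
proof -
  have "hit_mgf \<omega> lam x z i = (\<Sum>l\<in>UNIV. hit_gf \<omega> lam x w i l * hit_mgf \<omega> lam w z l)"
    by (rule hit_mgf_mult[OF we gf assms])
  also have "\<dots> \<le> (\<Sum>l\<in>UNIV. hit_gf \<omega> lam x w i l * (B\<^sup>2 * hit_mgf \<omega> lam w z i'))"
    by (intro sum_mono mult_left_mono hit_mgf_compare hit_gf_nonneg we gf assms)
  also have "\<dots> = B\<^sup>2 * (hit_mgf \<omega> lam x w i * hit_mgf \<omega> lam w z i')"
    by (simp add: hit_mgf_def[of _ _ x w] sum_distrib_right sum_distrib_left mult_ac)
  finally show ?thesis .
qed

lemma hit_mgf_split_lower:
  assumes "x \<le> w" "w \<le> z"
  shows "hit_mgf \<omega> lam x w i * hit_mgf \<omega> lam w z i' \<le> B\<^sup>2 * hit_mgf \<omega> lam x z i"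
proof -
  have "hit_mgf \<omega> lam x w i * hit_mgf \<omega> lam w z i' = (\<Sum>l\<in>UNIV. hit_gf \<omega> lam x w i l * hit_mgf \<omega> lam w z i')"
    by (simp add: hit_mgf_def[of _ _ x w] sum_distrib_right)
  also have "\<dots> \<le> (\<Sum>l\<in>UNIV. hit_gf \<omega> lam x w i l * (B\<^sup>2 * hit_mgf \<omega> lam w z l))"
    by (intro sum_mono mult_left_mono hit_mgf_compare hit_gf_nonneg we gf assms)
  also have "\<dots> = B\<^sup>2 * hit_mgf \<omega> lam x z i"
    unfolding hit_mgf_mult[OF we gf assms] by (simp add: sum_distrib_left mult_ac)
  finally show ?thesis .
qed

text \<open>The auxiliary target \<open>z\<close> lies beyond the reach of the walk at time \<open>n\<close>, so that
  passing through \<open>(y, j)\<close> at time \<open>n\<close> is one way of crossing from \<open>x\<close> to \<open>z\<close>.\<close>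
lemma pos_prob_upper_right:
  assumes "x \<le> y"
  shows "exp (lam * real n) * pos_prob \<omega> n x i y j \<le> B\<^sup>2 * hit_mgf \<omega> lam x y i"
proof -
  define z where "z = y + int n + 1"
  have z: "int n < z - x" "y \<le> z" using assms by (auto simp: z_def)
  have p: "0 < hit_mgf \<omega> lam y z j" by (rule hit_mgf_pos[OF z(2)])
  have "exp (lam * real n) * pos_prob \<omega> n x i y j * hit_mgf \<omega> lam y z j \<le> hit_mgf \<omega> lam x z i"
    by (rule pos_prob_hit_mgf_le[OF we gf z])
  also have "\<dots> \<le> B\<^sup>2 * hit_mgf \<omega> lam x y i * hit_mgf \<omega> lam y z j"
    using hit_mgf_split_upper[OF assms z(2), of i j] by (simp add: mult.assoc)
  finally show ?thesis using p by simp
qed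

text \<open>For a position behind the start: on its way from \<open>(y, j)\<close> to a far target
  the walk passes through \<open>x\<close> again, and the common crossing from \<open>x\<close> to
  the target cancels. The displacement is thus weighed against the cost of undoing it.\<close>

lemma pos_prob_upper_left:
  assumes "y \<le> x"
  shows "exp (lam * real n) * pos_prob \<omega> n x i y j * hit_mgf \<omega> lam y x j \<le> B\<^sup>2"
proof -
  define z where "z = x + int n + 1"
  have z: "int n < z - x" "x \<le> z" "y \<le> z" using assms by (auto simp: z_def)
  have p: "0 < hit_mgf \<omega> lam x z i" by (rule hit_mgf_pos[OF z(2)])
  have "exp (lam * real n) * pos_prob \<omega> n x i y j * hit_mgf \<omega> lam y x j * hit_mgf \<omega> lam x z i
      = exp (lam * real n) * pos_prob \<omega> n x i y j * (hit_mgf \<omega> lam y x j * hit_mgf \<omega> lam x z i)"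
    by simp
  also have "\<dots> \<le> exp (lam * real n) * pos_prob \<omega> n x i y j * (B\<^sup>2 * hit_mgf \<omega> lam y z j)"
    by (intro mult_left_mono hit_mgf_split_lower[OF assms z(2)]) (simp add: pos_prob_nonneg[OF we])
  also have "\<dots> = B\<^sup>2 * (exp (lam * real n) * pos_prob \<omega> n x i y j * hit_mgf \<omega> lam y z j)" by simp
  also have "\<dots> \<le> B\<^sup>2 * hit_mgf \<omega> lam x z i"
    by (intro mult_left_mono pos_prob_hit_mgf_le we gf z) auto
  finally show ?thesis using p by simp
qed

end

section \<open>Two-sided entry bounds from ellipticity\<close>

lemma pos_left_lower:
  assumes "\<forall>(\<omega> :: ('d::finite) env) x i j. elliptic_env \<kappa> \<omega> \<longrightarrow> (\<exists>t\<le>N. c \<le> hit_prob \<omega> (x + 1) t x i j)"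
    and "elliptic_env \<kappa> (\<omega> :: 'd env)"
  shows "\<exists>t\<le>N. c \<le> pos_prob \<omega> t x i (x - 1) j"
proof -
  have we: "walk_env (env_inv \<omega>)" using assms(2) by (simp add: elliptic_env_inv elliptic_env_walk_env)
  obtain t where "t \<le> N" "c \<le> hit_prob (env_inv \<omega>) (- x + 1) t (- x) i j"
    using assms elliptic_env_inv by blast
  moreover have "\<dots> \<le> pos_prob (env_inv \<omega>) t (- x) i (- (x - 1)) j"
    using hit_prob_le_pos_prob[OF we, of "- x + 1" t "- x" i j] by simp
  ultimately show ?thesis unfolding pos_prob_env_inv by force
qed

text \<open>A crossing accomplished at some time \<open>t \<le> N\<close> with probability at least
  \<open>c\<close> has tilted weight at least the inverse of this number, for either sign of
  \<open>lam\<close>. Continuity in \<open>lam\<close> matters later at the critical value.\<close>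

definition gf_const :: "real \<Rightarrow> nat \<Rightarrow> real \<Rightarrow> real" where
  "gf_const c N lam = exp (\<bar>lam\<bar> * real N) / c"

text \<open>For the upper bound: starting at \<open>k + 1\<close>, one way of crossing to a far target begins with a
  step back to \<open>k\<close>, of probability at least \<open>c\<close>, followed by a crossing from \<open>k\<close> to \<open>k + 1\<close>.\<close>
lemma walk_gfI:
  assumes cr: "\<forall>(\<omega> :: ('d::finite) env) x i j. elliptic_env \<kappa> \<omega> \<longrightarrow> (\<exists>t\<le>N. c \<le> hit_prob \<omega> (x + 1) t x i j)"
    and ell: "elliptic_env \<kappa> (\<omega> :: 'd env)" and c: "0 < c" and gf: "gf_finite \<omega> lam"
  shows "walk_gf \<omega> lam (gf_const c N lam)"
proof -
  have we: "walk_env \<omega>" using ell by (rule elliptic_env_walk_env)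
  have e: "exp (- (\<bar>lam\<bar> * real N)) \<le> exp (lam * real t)" if "t \<le> N" for t
  proof -
    have "- (lam * real t) \<le> \<bar>lam\<bar> * real t" by (metis abs_mult abs_of_nat abs_ge_minus_self)
    also have "\<dots> \<le> \<bar>lam\<bar> * real N" using that by (intro mult_left_mono) auto
    finally show ?thesis by simp
  qed
  have inv: "1 / gf_const c N lam = exp (- (\<bar>lam\<bar> * real N)) * c" by (simp add: gf_const_def exp_minus field_simps)
  have lower: "1 / gf_const c N lam \<le> hit_gf \<omega> lam k (k + 1) i j" for k i j
  proof -
    obtain t where t: "t \<le> N" "c \<le> hit_prob \<omega> (k + 1) t k i j" using cr ell by blast
    have "1 / gf_const c N lam \<le> exp (lam * real t) * hit_prob \<omega> (k + 1) t k i j"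
      unfolding inv using e[OF t(1)] t(2) c by (intro mult_mono) auto
    also have "\<dots> \<le> hit_gf \<omega> lam k (k + 1) i j" by (rule hit_gf_ge_term[OF we gf]) simp
    finally show ?thesis .
  qed
  have pos: "0 < 1 / gf_const c N lam" unfolding inv using c by simp
  have mgf_pos: "0 < hit_mgf \<omega> lam x z i" if "x \<le> z" for x z i
    by (rule hit_mgf_pos_of_steps[OF we gf less_le_trans[OF pos lower] that])
  have upper: "hit_gf \<omega> lam k (k + 1) i j \<le> gf_const c N lam" for k i j
  proof -
    \<comment> \<open>\<open>z\<close> lies \<open>N + 1\<close> levels beyond \<open>k + 1\<close>,
      out of reach for the backward move of duration at most \<open>N\<close>.\<close>
    define z where "z = k + 2 + int N"
    obtain t where t: "t \<le> N" "c \<le> pos_prob \<omega> t (k + 1) j k i"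
      using pos_left_lower[OF cr ell, of "k + 1" j i] by auto
    have p: "0 < hit_mgf \<omega> lam (k + 1) z j" by (rule mgf_pos) (simp add: z_def)
    have "hit_gf \<omega> lam k (k + 1) i j * hit_mgf \<omega> lam (k + 1) z j
       \<le> (\<Sum>l\<in>UNIV. hit_gf \<omega> lam k (k + 1) i l * hit_mgf \<omega> lam (k + 1) z l)"
      by (rule member_le_sum) (auto intro!: mult_nonneg_nonneg hit_gf_nonneg hit_mgf_nonneg we gf simp: z_def)
    also have "\<dots> = hit_mgf \<omega> lam k z i"
      by (rule hit_mgf_mult[symmetric, OF we gf]) (auto simp: z_def)
    finally have 1: "hit_gf \<omega> lam k (k + 1) i j * hit_mgf \<omega> lam (k + 1) z j \<le> hit_mgf \<omega> lam k z i" .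
    have "1 / gf_const c N lam * hit_mgf \<omega> lam k z i \<le> exp (lam * real t) * pos_prob \<omega> t (k + 1) j k i * hit_mgf \<omega> lam k z i"
      unfolding inv using e[OF t(1)] t(2) c
      by (intro mult_mono) (auto intro!: hit_mgf_nonneg we gf pos_prob_nonneg mult_nonneg_nonneg simp: z_def)
    also have "\<dots> \<le> hit_mgf \<omega> lam (k + 1) z j"
      by (rule pos_prob_hit_mgf_le[OF we gf]) (use t in \<open>auto simp: z_def\<close>)
    finally have "hit_mgf \<omega> lam k z i \<le> gf_const c N lam * hit_mgf \<omega> lam (k + 1) z j"
      using pos by (simp add: field_simps)
    with 1 have "hit_gf \<omega> lam k (k + 1) i j * hit_mgf \<omega> lam (k + 1) z j \<le> gf_const c N lam * hit_mgf \<omega> lam (k + 1) z j"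
      by linarith
    then show ?thesis using p by simp
  qed
  have "1 \<le> gf_const c N lam"
  proof -
    have "1 / gf_const c N lam \<le> gf_const c N lam" using lower upper order_trans by blast
    moreover have "gf_const c N lam > 0" using pos by simp
    ultimately have "1\<^sup>2 \<le> (gf_const c N lam)\<^sup>2" by (simp add: field_simps power2_eq_square)
    then show ?thesis using \<open>gf_const c N lam > 0\<close> by (smt (verit) power2_le_imp_le)
  qed
  then show ?thesis using we gf lower upper by unfold_locales auto
qed

section \<open>The matrices \<open>Phi\<close> and bounds on a single crossing\<close>

lemma suminf_ennreal_less_top_iff:
  assumes "\<And>t. 0 \<le> f t"
  shows "(\<Sum>t. ennreal (f t)) < \<infinity> \<longleftrightarrow> summable f"
  using summable_suminf_not_top[of f] suminf_ennreal2[of f] assms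
  by (metis ennreal_less_top infinity_ennreal_def less_irrefl)

lemma Phi_rows_finite_iff:
  assumes "walk_env \<omega>"
  shows "(\<forall>k. Phi_rows_finite \<omega> lam k) \<longleftrightarrow> gf_finite \<omega> lam"
proof -
  have "Phi_enn \<omega> lam k i j < \<infinity> \<longleftrightarrow> summable (\<lambda>t. exp (lam * real t) * hit_prob \<omega> (k + 1) t k i j)" for k i j
    unfolding Phi_enn_def by (rule suminf_ennreal_less_top_iff) (simp add: hit_prob_nonneg[OF assms])
  then show ?thesis unfolding Phi_rows_finite_def gf_finite_def by (simp add: less_top)
qed

lemma Phi_eq_hit_gf:
  assumes "walk_env \<omega>" "gf_finite \<omega> lam"
  shows "Phi \<omega> lam k $ i $ j = hit_gf \<omega> lam k (k + 1) i j"
proof -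
  have "Phi_enn \<omega> lam k i j = ennreal (hit_gf \<omega> lam k (k + 1) i j)"
    unfolding Phi_enn_def hit_gf_def
    by (rule suminf_ennreal2) (use assms in \<open>auto simp: hit_prob_nonneg gf_finite_def\<close>)
  then show ?thesis using hit_gf_nonneg[OF assms, of k "k + 1" i j] by (simp add: Phi_def)
qed

lemma Phi_prod_eq_hit_gf:
  assumes "walk_env \<omega>" "gf_finite \<omega> lam" "m \<le> n + 1"
  shows "Phi_prod \<omega> lam m n $ i $ j = hit_gf \<omega> lam m (n + 1) i j"
  using assms(3)
proof (induction m arbitrary: i j rule: int_le_induct)
  case base show ?case by (simp add: Phi_prod_def hit_gf_self mat_def)
next
  case (step m)
  have "[m - 1..n] = (m - 1) # [m..n]" using step.hyps upto_rec1[of "m - 1" n] by simp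
  then have "Phi_prod \<omega> lam (m - 1) n = Phi \<omega> lam (m - 1) ** Phi_prod \<omega> lam m n"
    by (simp add: Phi_prod_def)
  then show ?case
    using hit_gf_mult[OF assms(1,2), of "m - 1" m "n + 1" i j] step
    by (simp add: matrix_matrix_mult_def Phi_eq_hit_gf[OF assms(1,2)])
qed

lemma hit_prob_total_le_1:
  assumes "walk_env \<omega>"
  shows "(\<Sum>t<T. \<Sum>j\<in>UNIV. hit_prob \<omega> z t x i j) \<le> 1"
proof (induction T arbitrary: x i)
  case (Suc T)
  show ?case
  proof (cases "x = z")
    case True
    have "(\<Sum>t<Suc T. \<Sum>j\<in>UNIV. hit_prob \<omega> z t z i j) = (\<Sum>t<Suc T. if t = 0 then 1 else 0)"
      by (intro sum.cong) (auto simp: hit_prob_self simp del: hit_prob.simps)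
    then show ?thesis using True by simp
  next
    case False
    have "(\<Sum>t<Suc T. \<Sum>j\<in>UNIV. hit_prob \<omega> z t x i j) = (\<Sum>t<T. \<Sum>j\<in>UNIV. hit_prob \<omega> z (Suc t) x i j)"
      unfolding sum.lessThan_Suc_shift using False by simp
    also have "\<dots> = walk_step \<omega> (\<lambda>x i. \<Sum>t<T. \<Sum>j\<in>UNIV. hit_prob \<omega> z t x i j) x i"
      unfolding walk_step_sum hit_prob_Suc[OF False] ..
    also have "\<dots> \<le> walk_step \<omega> (\<lambda>_ _. 1) x i" by (intro walk_step_mono assms Suc.IH)
    finally show ?thesis using walk_step_one[OF assms] by simp
  qed
qed simp

lemma summable_hit_prob:
  assumes "walk_env \<omega>" shows "summable (\<lambda>t. hit_prob \<omega> z t x i j)"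
proof (rule summableI_nonneg_bounded[where x = 1])
  fix T
  have "(\<Sum>t<T. hit_prob \<omega> z t x i j) \<le> (\<Sum>t<T. \<Sum>j\<in>UNIV. hit_prob \<omega> z t x i j)"
    by (intro sum_mono member_le_sum) (auto simp: hit_prob_nonneg assms)
  then show "(\<Sum>t<T. hit_prob \<omega> z t x i j) \<le> 1" using hit_prob_total_le_1[OF assms, of z x i T] by simp
qed (simp add: hit_prob_nonneg assms)

lemma gf_finite_nonpos:
  assumes "walk_env \<omega>" "lam \<le> 0" shows "gf_finite \<omega> lam"
  by (rule gf_finite_mono[OF assms(1) _ assms(2)]) (simp add: gf_finite_def summable_hit_prob[OF assms(1)])

lemma hit_mgf_sums:
  assumes "walk_env \<omega>" "gf_finite \<omega> lam" "x \<le> z"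
  shows "(\<lambda>t. exp (lam * real t) * (\<Sum>j\<in>UNIV. hit_prob \<omega> z t x i j)) sums hit_mgf \<omega> lam x z i"
  unfolding hit_mgf_def sum_distrib_left hit_gf_def
  by (intro sums_sum summable_sums summable_hit assms)

text \<open>The hitting time of the next level is at least one, so
  \<open>exp (lam * t) \<le> exp lam\<close> when \<open>lam \<le> 0\<close>, and escape to the left
  only loses mass. This is the source of an infinite rate beyond speed one.\<close>

lemma hit_mgf_step_nonpos:
  assumes "walk_env \<omega>" "lam \<le> 0"
  shows "hit_mgf \<omega> lam k (k + 1) i \<le> exp lam"
proof -
  let ?p = "\<lambda>t. \<Sum>j\<in>UNIV. hit_prob \<omega> (k + 1) t k i j"
  have s: "(\<lambda>t. exp (lam * real t) * ?p t) sums hit_mgf \<omega> lam k (k + 1) i"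
    by (intro hit_mgf_sums gf_finite_nonpos assms) simp
  have sp: "summable ?p" by (intro summable_sum summable_hit_prob assms)
  have "hit_mgf \<omega> lam k (k + 1) i = (\<Sum>t. exp (lam * real t) * ?p t)" using s by (simp add: sums_iff)
  also have "\<dots> \<le> (\<Sum>t. exp lam * ?p t)"
  proof (rule suminf_le)
    fix t show "exp (lam * real t) * ?p t \<le> exp lam * ?p t"
    proof (cases t)
      case (Suc t')
      have "lam * real t \<le> lam * 1" using assms(2) Suc by (intro mult_left_mono_neg) auto
      then show ?thesis by (intro mult_right_mono) (auto intro!: sum_nonneg hit_prob_nonneg assms)
    qed simp
  qed (use s sp in \<open>auto simp: sums_iff intro!: summable_mult\<close>)
  also have "\<dots> = exp lam * (\<Sum>t. ?p t)" by (rule suminf_mult[OF sp])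
  also have "\<dots> \<le> exp lam * 1"
    by (intro mult_left_mono suminf_le_const[OF sp] hit_prob_total_le_1 assms) auto
  finally show ?thesis by simp
qed

text \<open>Only the immediate jump to the right is kept.\<close>

lemma hit_mgf_step_ge:
  assumes "elliptic_env \<kappa> \<omega>" "gf_finite \<omega> lam"
  shows "\<kappa> * exp lam \<le> hit_mgf \<omega> lam k (k + 1) i"
proof -
  have we: "walk_env \<omega>" by (rule elliptic_env_walk_env[OF assms(1)])
  have one: "pp (\<omega> k) $ i $ j \<le> hit_prob \<omega> (k + 1) 1 k i j" for j
  proof -
    have "hit_prob \<omega> (k + 1) 1 k i j = (\<Sum>l\<in>UNIV. pp (\<omega> k) $ i $ l * (if l = j then 1 else 0))"
      by simp
    also have "\<dots> = (\<Sum>l\<in>UNIV. if l = j then pp (\<omega> k) $ i $ l else 0)"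
      by (intro sum.cong) auto
    finally show ?thesis by simp
  qed
  have "\<kappa> * exp lam \<le> (\<Sum>j\<in>UNIV. pp (\<omega> k) $ i $ j) * exp lam"
    using pos_right_step_lower[OF assms(1)] by simp
  also have "\<dots> \<le> (\<Sum>j\<in>UNIV. exp (lam * real 1) * hit_prob \<omega> (k + 1) 1 k i j)"
    using sum_mono[of UNIV "\<lambda>j. pp (\<omega> k) $ i $ j", OF one]
    by (simp add: sum_distrib_left[symmetric] mult.commute del: hit_prob.simps)
  also have "\<dots> \<le> hit_mgf \<omega> lam k (k + 1) i"
    unfolding hit_mgf_def by (intro sum_mono hit_gf_ge_term we assms) simp
  finally show ?thesis .
qed

subsection \<open>Convergence of the normalised rows\<close>

text \<open>Doeblin's argument: an average with all weights at least \<delta> shrinks the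
  oscillation \<open>hi - lo\<close> by the factor \<open>1 - \<delta>\<close>, while
  \<open>lo\<close> increases and \<open>hi\<close> decreases, so all coordinates share one
  limit.\<close>

lemma averaging_contraction:
  fixes p :: "nat \<Rightarrow> 'd::finite \<Rightarrow> real"
  assumes p: "\<And>n i. p (Suc n) i = (\<Sum>l\<in>UNIV. w n i l * p n l)"
    and w: "\<And>n i. (\<Sum>l\<in>UNIV. w n i l) = 1" "\<And>n i l. \<delta> \<le> w n i l" and \<delta>: "0 < \<delta>"
  shows "\<exists>L. \<forall>i. (\<lambda>n. p n i) \<longlonglongrightarrow> L"
proof -
  define hi where "hi n = Max (range (p n))" for n
  define lo where "lo n = Min (range (p n))" for n
  have hi: "p n i \<le> hi n" and lo: "lo n \<le> p n i" for n i
    by (auto simp: hi_def lo_def)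
  have "hi n \<in> range (p n)" "lo n \<in> range (p n)" for n
    unfolding hi_def lo_def by (rule Max_in Min_in; simp)+
  then have ex: "\<exists>i. p n i = hi n" "\<exists>i. p n i = lo n" for n by (metis rangeE)+
  have le: "lo n \<le> hi n" for n using hi lo order_trans by blast
  have w0: "0 \<le> w n i l" for n i l using w(2)[of n i l] \<delta> by linarith
  have lo_mono: "lo n \<le> lo (Suc n)" for n
  proof -
    obtain i where i: "p (Suc n) i = lo (Suc n)" using ex by blast
    have "lo n = (\<Sum>l\<in>UNIV. w n i l * lo n)" using w(1)[of n i] by (simp flip: sum_distrib_right)
    also have "\<dots> \<le> (\<Sum>l\<in>UNIV. w n i l * p n l)" by (intro sum_mono mult_left_mono lo w0)
    finally show ?thesis using p i by simp
  qed
  have hi_step: "p (Suc n) i \<le> hi n - \<delta> * (hi n - lo n)" for n i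
  proof -
    obtain m where m: "p n m = lo n" using ex by blast
    have "hi n - p (Suc n) i = (\<Sum>l\<in>UNIV. w n i l * hi n) - (\<Sum>l\<in>UNIV. w n i l * p n l)"
      using w(1)[of n i] by (simp add: p flip: sum_distrib_right)
    also have "\<dots> = (\<Sum>l\<in>UNIV. w n i l * (hi n - p n l))" by (simp add: sum_subtractf algebra_simps)
    \<comment> \<open>All terms are nonnegative; the coordinate with the minimal value enters with
      weight at least \<delta>.\<close>
    also have "\<dots> \<ge> w n i m * (hi n - p n m)"
      by (rule member_le_sum) (auto intro!: mult_nonneg_nonneg simp: w0 hi)
    also have "w n i m * (hi n - p n m) \<ge> \<delta> * (hi n - lo n)"
      unfolding m using le w(2) by (intro mult_right_mono) auto
    finally show ?thesis by linarith
  qed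
  have gap: "hi (Suc n) - lo (Suc n) \<le> (1 - \<delta>) * (hi n - lo n)" for n
  proof -
    obtain i where i: "p (Suc n) i = hi (Suc n)" using ex by blast
    show ?thesis using hi_step[of n i] lo_mono[of n] i by (simp add: algebra_simps)
  qed
  have \<delta>1: "\<delta> \<le> 1"
  proof -
    have "\<delta> \<le> w 0 undefined undefined" by (rule w)
    also have "\<dots> \<le> (\<Sum>l\<in>UNIV. w 0 undefined l)" by (rule member_le_sum) (auto simp: w0)
    finally show ?thesis using w(1) by simp
  qed
  have gapn: "hi n - lo n \<le> (1 - \<delta>) ^ n * (hi 0 - lo 0)" for n
  proof (induction n)
    case (Suc n)
    have "hi (Suc n) - lo (Suc n) \<le> (1 - \<delta>) * ((1 - \<delta>) ^ n * (hi 0 - lo 0))"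
      using \<delta>1 by (intro order_trans[OF gap] mult_left_mono Suc) auto
    then show ?case by simp
  qed simp
  have "(\<lambda>n. (1 - \<delta>) ^ n * (hi 0 - lo 0)) \<longlonglongrightarrow> 0 * (hi 0 - lo 0)"
    using \<delta> \<delta>1 by (intro tendsto_intros LIMSEQ_realpow_zero) auto
  then have gap0: "(\<lambda>n. hi n - lo n) \<longlonglongrightarrow> 0"
    by (intro tendsto_sandwich[where f = "\<lambda>_. 0" and g = "\<lambda>n. hi n - lo n", OF _ _ tendsto_const]) (auto simp: le gapn)
  have "incseq lo" using lo_mono by (rule incseq_SucI)
  have hi_dec: "decseq hi"
  proof (rule decseq_SucI)
    fix n
    obtain i where i: "p (Suc n) i = hi (Suc n)" using ex by blast
    have "0 \<le> \<delta> * (hi n - lo n)" using \<delta> le by simp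
    then show "hi (Suc n) \<le> hi n" using hi_step[of n i] i by linarith
  qed
  have "lo n \<le> hi 0" for n using le[of n] decseqD[OF hi_dec, of 0 n] by simp
  then obtain L where L: "lo \<longlonglongrightarrow> L" using incseq_convergent[OF \<open>incseq lo\<close>] by blast
  have hiL: "hi \<longlonglongrightarrow> L" using tendsto_add[OF L gap0] by simp
  have "(\<lambda>n. p n i) \<longlonglongrightarrow> L" for i
    by (rule tendsto_sandwich[OF _ _ L hiL]) (auto simp: hi lo)
  then show ?thesis by blast
qed

definition log_drift :: "real \<Rightarrow> ('d::finite) env \<Rightarrow> real" where
  "log_drift lam \<omega> = ln (\<Sum>j\<in>UNIV. (mu0 \<omega> lam v* Phi \<omega> lam 0) $ j)"

context walk_gf
begin

text \<open>Prepending a level replaces each normalised row by an average of the previous normalised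
  rows. The weights \<open>w\<close> are those of the Doob transform by \<open>hit_mgf\<close>, and
  the entry bounds keep them away from zero.\<close>

lemma hit_gf_row_convergent:
  "\<exists>L. \<forall>i. (\<lambda>N. hit_gf \<omega> lam (- int N) 0 i j / hit_mgf \<omega> lam (- int N) 0 i) \<longlonglongrightarrow> L"
proof (rule averaging_contraction)
  define w where "w N i l = hit_gf \<omega> lam (- int (Suc N)) (- int N) i l * hit_mgf \<omega> lam (- int N) 0 l
     / hit_mgf \<omega> lam (- int (Suc N)) 0 i" for N i l
  have pos: "0 < hit_mgf \<omega> lam (- int N) 0 l" for N l by (rule hit_mgf_pos) simp
  have mult: "hit_mgf \<omega> lam (- int (Suc N)) 0 i =
      (\<Sum>l\<in>UNIV. hit_gf \<omega> lam (- int (Suc N)) (- int N) i l * hit_mgf \<omega> lam (- int N) 0 l)" for N i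
    by (rule hit_mgf_mult[OF we gf]) auto
  have S: "- int N = - int (Suc N) + 1" for N by simp
  show "hit_gf \<omega> lam (- int (Suc n)) 0 i j / hit_mgf \<omega> lam (- int (Suc n)) 0 i =
    (\<Sum>l\<in>UNIV. w n i l * (hit_gf \<omega> lam (- int n) 0 l j / hit_mgf \<omega> lam (- int n) 0 l))" for n i
  proof -
    have "w n i l * (hit_gf \<omega> lam (- int n) 0 l j / hit_mgf \<omega> lam (- int n) 0 l)
      = hit_gf \<omega> lam (- int (Suc n)) (- int n) i l * hit_gf \<omega> lam (- int n) 0 l j / hit_mgf \<omega> lam (- int (Suc n)) 0 i" for l
      using pos[of n l] by (simp add: w_def)
    then show ?thesis
      using hit_gf_mult[OF we gf, of "- int (Suc n)" "- int n" 0 i j]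
      by (simp add: sum_divide_distrib del: of_nat_Suc)
  qed
  show "(\<Sum>l\<in>UNIV. w n i l) = 1" for n i
    using pos[of "Suc n" i] by (simp add: w_def mult del: of_nat_Suc flip: sum_divide_distrib)
  \<comment> \<open>The numerator of the weight is at least \<open>?u / B\<close>; the denominator
    is at most \<open>CARD('d) * B ^ 3 * ?u\<close>, with one factor \<open>B\<close> from
    \<open>gf_upper\<close> and two from \<open>hit_mgf_compare\<close>.\<close>
  show "1 / (real CARD('d) * B ^ 4) \<le> w n i l" for n i l
  proof -
    let ?u = "hit_mgf \<omega> lam (- int n) 0 l"
    have "hit_mgf \<omega> lam (- int (Suc n)) 0 i \<le> (\<Sum>l'\<in>(UNIV::'d set). B * (B\<^sup>2 * ?u))"
      unfolding mult using gf_upper[of "- int (Suc n)", folded S] B1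
      by (intro sum_mono mult_mono hit_mgf_compare) (auto intro!: hit_mgf_nonneg we gf)
    then have 1: "hit_mgf \<omega> lam (- int (Suc n)) 0 i \<le> real CARD('d) * B ^ 3 * ?u"
      by (simp add: power2_eq_square power3_eq_cube mult_ac)
    have 2: "1 / B * ?u \<le> hit_gf \<omega> lam (- int (Suc n)) (- int n) i l * ?u"
      using gf_lower[of "- int (Suc n)", folded S] pos[of n l] by (intro mult_right_mono) auto
    have "1 / (real CARD('d) * B ^ 4) = (1 / B * ?u) / (real CARD('d) * B ^ 3 * ?u)"
      using pos[of n l] B1 by (simp add: field_simps power4_eq_xxxx power3_eq_cube)
    also have "\<dots> \<le> w n i l"
      unfolding w_def using 1 2 pos[of "Suc n" i] pos[of n l] B1
      by (intro frac_le mult_nonneg_nonneg hit_gf_nonneg hit_mgf_nonneg we gf) auto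
    finally show ?thesis .
  qed
  show "0 < 1 / (real CARD('d) * B ^ 4)" using B1 by simp
qed

text \<open>The limit is common to all starting states, so the arbitrary index in \<open>mu0\<close>
  is harmless and any row may be used to approximate it.\<close>

lemma mu0_tendsto:
  "(\<lambda>N. hit_gf \<omega> lam (- int N) 0 i j / hit_mgf \<omega> lam (- int N) 0 i) \<longlonglongrightarrow> mu0 \<omega> lam $ j"
proof -
  let ?p = "\<lambda>N i j. hit_gf \<omega> lam (- int N) 0 i j / hit_mgf \<omega> lam (- int N) 0 i"
  obtain L where L: "\<And>i j. (\<lambda>N. ?p N i j) \<longlonglongrightarrow> L j" using hit_gf_row_convergent by metis
  have row: "(axis undefined 1 v* Phi_prod \<omega> lam (- int N) (- 1)) $ j = hit_gf \<omega> lam (- int N) 0 undefined j" for N j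
  proof -
    have "(axis undefined 1 v* Phi_prod \<omega> lam (- int N) (- 1)) $ j =
        (\<Sum>i\<in>UNIV. if i = undefined then hit_gf \<omega> lam (- int N) 0 i j else 0)"
      unfolding vector_matrix_mult_def axis_def vec_lambda_beta
      by (intro sum.cong) (auto simp: Phi_prod_eq_hit_gf[OF we gf])
    then show ?thesis by simp
  qed
  have "mu0 \<omega> lam = lim (\<lambda>N. \<chi> j. ?p N undefined j)"
    unfolding mu0_def Let_def
    by (rule arg_cong[where f = lim], rule ext) (simp add: vec_eq_iff row hit_mgf_def)
  also have "\<dots> = (\<chi> j. L j)"
    by (rule limI, rule vec_tendstoI) (simp add: L)
  finally show ?thesis using L by simp
qed

lemma log_drift_tendsto:
  "(\<lambda>N. hit_mgf \<omega> lam (- int N) 1 i / hit_mgf \<omega> lam (- int N) 0 i) \<longlonglongrightarrow> (\<Sum>j\<in>UNIV. (mu0 \<omega> lam v* Phi \<omega> lam 0) $ j)"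
proof -
  have eq: "(\<Sum>j\<in>UNIV. (mu0 \<omega> lam v* Phi \<omega> lam 0) $ j) = (\<Sum>l\<in>UNIV. mu0 \<omega> lam $ l * hit_mgf \<omega> lam 0 1 l)"
    unfolding vector_matrix_mult_def hit_mgf_def
    by (simp add: Phi_eq_hit_gf[OF we gf] sum_distrib_left mult.commute) (rule sum.swap)
  have "hit_mgf \<omega> lam (- int N) 1 i / hit_mgf \<omega> lam (- int N) 0 i =
      (\<Sum>l\<in>UNIV. hit_gf \<omega> lam (- int N) 0 i l / hit_mgf \<omega> lam (- int N) 0 i * hit_mgf \<omega> lam 0 1 l)" for N
    using hit_mgf_mult[OF we gf, of "- int N" 0 1 i] by (simp add: sum_divide_distrib)
  then show ?thesis unfolding eq by (simp only:) (intro tendsto_intros mu0_tendsto)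
qed

text \<open>The approximating ratio is an average of the numbers
  \<open>hit_mgf \<omega> lam 0 1 l\<close>, with the normalised row as weights; it therefore
  inherits their bounds, and positivity of \<open>a\<close> lets the logarithm pass to the
  limit.\<close>

lemma log_drift_bounds:
  assumes "0 < a" "\<And>l. a \<le> hit_mgf \<omega> lam 0 1 l" "\<And>l. hit_mgf \<omega> lam 0 1 l \<le> b"
  shows "ln a \<le> log_drift lam \<omega>" "log_drift lam \<omega> \<le> ln b"
    "(\<lambda>N. ln (hit_mgf \<omega> lam (- int N) 1 i / hit_mgf \<omega> lam (- int N) 0 i)) \<longlonglongrightarrow> log_drift lam \<omega>"
proof -
  let ?s = "\<Sum>j\<in>UNIV. (mu0 \<omega> lam v* Phi \<omega> lam 0) $ j"
  let ?g = "\<lambda>N. hit_gf \<omega> lam (- int N) 0 i" and ?u = "\<lambda>N. hit_mgf \<omega> lam (- int N) 0 i"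
  have pos: "0 < ?u N" for N by (rule hit_mgf_pos) simp
  have nn: "0 \<le> ?g N l" for N l by (rule hit_gf_nonneg[OF we gf]) simp
  have m: "hit_mgf \<omega> lam (- int N) 1 i = (\<Sum>l\<in>UNIV. ?g N l * hit_mgf \<omega> lam 0 1 l)" for N
    by (rule hit_mgf_mult[OF we gf]) auto
  have "a * ?u N \<le> hit_mgf \<omega> lam (- int N) 1 i" "hit_mgf \<omega> lam (- int N) 1 i \<le> b * ?u N" for N
    unfolding m hit_mgf_def[of _ _ _ 0] sum_distrib_left
    using mult_left_mono[OF assms(2) nn] mult_left_mono[OF assms(3) nn]
    by (auto intro!: sum_mono simp: mult.commute)
  then have "a \<le> hit_mgf \<omega> lam (- int N) 1 i / ?u N" "hit_mgf \<omega> lam (- int N) 1 i / ?u N \<le> b" for N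
    using pos[of N] by (auto simp: field_simps)
  then have ab: "a \<le> ?s" "?s \<le> b"
    using log_drift_tendsto[of i] by (auto intro: LIMSEQ_le_const LIMSEQ_le_const2)
  show "ln a \<le> log_drift lam \<omega>" "log_drift lam \<omega> \<le> ln b"
    using ab assms(1) by (auto simp: log_drift_def)
  show "(\<lambda>N. ln (hit_mgf \<omega> lam (- int N) 1 i / hit_mgf \<omega> lam (- int N) 0 i)) \<longlonglongrightarrow> log_drift lam \<omega>"
    unfolding log_drift_def using ab assms(1) by (intro tendsto_ln log_drift_tendsto) auto
qed

lemma hit_mgf_step_bounds:
  "1 / B \<le> hit_mgf \<omega> lam k (k + 1) l" "hit_mgf \<omega> lam k (k + 1) l \<le> real CARD('d) * B"
proof -
  have "1 / B \<le> hit_gf \<omega> lam k (k + 1) l undefined" by (rule gf_lower)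
  also have "\<dots> \<le> hit_mgf \<omega> lam k (k + 1) l" unfolding hit_mgf_def
    by (rule member_le_sum) (auto intro: hit_gf_nonneg[OF we gf])
  finally show "1 / B \<le> hit_mgf \<omega> lam k (k + 1) l" .
  show "hit_mgf \<omega> lam k (k + 1) l \<le> real CARD('d) * B"
    unfolding hit_mgf_def using sum_bounded_above[of UNIV, OF gf_upper[of k l]] by simp
qed

end

section \<open>Translated environments and the additive form of the logarithm\<close>

lemma shift_funpow: "(shift ^^ k) \<omega> = (\<lambda>x. \<omega> (x + int k))"
  by (induction k arbitrary: \<omega>) (auto simp: shift_def funpow_swap1 algebra_simps simp del: funpow.simps(2), simp add: shift_def algebra_simps)

lemma hit_prob_shift_funpow: "hit_prob ((shift ^^ k) \<omega>) z n x i j = hit_prob \<omega> (z + int k) n (x + int k) i j"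
  by (induction k arbitrary: z x) (simp_all add: hit_prob_shift algebra_simps del: hit_prob.simps)

lemma hit_gf_shift_funpow: "hit_gf ((shift ^^ k) \<omega>) lam x z i j = hit_gf \<omega> lam (x + int k) (z + int k) i j"
  by (simp add: hit_gf_def hit_prob_shift_funpow)

lemma hit_mgf_shift_funpow: "hit_mgf ((shift ^^ k) \<omega>) lam x z i = hit_mgf \<omega> lam (x + int k) (z + int k) i"
  by (simp add: hit_mgf_def hit_gf_shift_funpow)

lemma walk_env_shift_funpow: "walk_env \<omega> \<Longrightarrow> walk_env ((shift ^^ k) \<omega>)"
  by (simp add: walk_env_def shift_funpow)

lemma gf_finite_shift_funpow: "gf_finite \<omega> lam \<Longrightarrow> gf_finite ((shift ^^ k) \<omega>) lam"
  unfolding gf_finite_def hit_prob_shift_funpow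
  by (metis add.assoc add.commute)

context walk_gf
begin

lemma walk_gf_shift_funpow: "walk_gf ((shift ^^ k) \<omega>) lam B"
proof
  show "1 / B \<le> hit_gf ((shift ^^ k) \<omega>) lam x (x + 1) i j" "hit_gf ((shift ^^ k) \<omega>) lam x (x + 1) i j \<le> B" for x i j
    unfolding hit_gf_shift_funpow using gf_lower[of "x + int k" i j] gf_upper[of "x + int k" i j]
    by (simp_all add: algebra_simps)
qed (use we gf B1 in \<open>auto simp: walk_env_shift_funpow gf_finite_shift_funpow\<close>)

text \<open>Each drift is the limit of an increment of
  \<open>ln (hit_mgf \<omega> lam (- int N) k i)\<close> in \<open>k\<close>. The increments
  telescope, and splitting the crossing at level 0 costs at most \<open>2 * ln B\<close> for every
  \<open>N\<close>.\<close>

lemma log_drift_sum: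
  "\<bar>(\<Sum>k<n. log_drift lam ((shift ^^ k) \<omega>)) - ln (hit_mgf \<omega> lam 0 (int n) i)\<bar> \<le> 2 * ln B"
proof -
  let ?u = "\<lambda>N z. hit_mgf \<omega> lam (- int N) z i"
  have lim: "(\<lambda>N. ln (?u N (int k + 1) / ?u N (int k))) \<longlonglongrightarrow> log_drift lam ((shift ^^ k) \<omega>)" for k
  proof -
    interpret s: walk_gf "(shift ^^ k) \<omega>" lam B by (rule walk_gf_shift_funpow)
    have "(\<lambda>N. ln (hit_mgf ((shift ^^ k) \<omega>) lam (- int N) 1 i / hit_mgf ((shift ^^ k) \<omega>) lam (- int N) 0 i))
        \<longlonglongrightarrow> log_drift lam ((shift ^^ k) \<omega>)"
      by (rule s.log_drift_bounds[of "1 / B" "real CARD('d) * B"])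
        (use s.hit_mgf_step_bounds[of 0] B1 in auto)
    then have "(\<lambda>N. ln (hit_mgf \<omega> lam (- int N + int k) (int k + 1) i / hit_mgf \<omega> lam (- int N + int k) (int k) i))
        \<longlonglongrightarrow> log_drift lam ((shift ^^ k) \<omega>)"
      by (simp add: hit_mgf_shift_funpow add.commute)
    \<comment> \<open>Replacing \<open>N\<close> by \<open>N + k\<close> gives all summands the same
      starting level \<open>- int N\<close>, as telescoping requires.\<close>
    then have "(\<lambda>N. ln (hit_mgf \<omega> lam (- int (N + k) + int k) (int k + 1) i / hit_mgf \<omega> lam (- int (N + k) + int k) (int k) i))
        \<longlonglongrightarrow> log_drift lam ((shift ^^ k) \<omega>)"
      by (rule LIMSEQ_ignore_initial_segment)
    then show ?thesis by simp
  qed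
  have upos: "0 < ?u N (int k)" for N k by (rule hit_mgf_pos) auto
  have tele: "(\<Sum>k<n. ln (?u N (int k + 1) / ?u N (int k))) = ln (?u N (int n) / ?u N 0)" for N
  proof (induction n)
    case 0 then show ?case using upos[of N 0] by simp
  next
    case (Suc n)
    have "0 < ?u N (int n + 1)" using upos[of N "Suc n"] by (simp add: add.commute)
    then show ?case using upos[of N 0] upos[of N n]
      unfolding sum.lessThan_Suc Suc.IH by (simp add: ln_div add.commute)
  qed
  have lims: "(\<lambda>N. ln (?u N (int n) / ?u N 0)) \<longlonglongrightarrow> (\<Sum>k<n. log_drift lam ((shift ^^ k) \<omega>))"
    unfolding tele[symmetric] by (intro tendsto_sum lim)
  have bd: "\<bar>ln (?u N (int n) / ?u N 0) - ln (hit_mgf \<omega> lam 0 (int n) i)\<bar> \<le> 2 * ln B" for N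
  proof -
    let ?v = "hit_mgf \<omega> lam 0 (int n) i"
    have v: "0 < ?v" by (rule hit_mgf_pos) simp
    have u: "0 < ?u N (int n)" "0 < ?u N 0" using upos[of N n] upos[of N 0] by auto
    have "?u N (int n) \<le> B\<^sup>2 * (?u N 0 * ?v)" by (rule hit_mgf_split_upper) auto
    then have "ln (?u N (int n)) \<le> ln (B\<^sup>2 * (?u N 0 * ?v))" using u by (intro ln_mono) auto
    also have "\<dots> = 2 * ln B + ln (?u N 0) + ln ?v" using u v B1 by (simp add: ln_mult ln_realpow)
    finally have 1: "ln (?u N (int n)) \<le> 2 * ln B + ln (?u N 0) + ln ?v" .
    have "?u N 0 * ?v \<le> B\<^sup>2 * ?u N (int n)" by (rule hit_mgf_split_lower) auto
    then have "ln (?u N 0 * ?v) \<le> ln (B\<^sup>2 * ?u N (int n))" using u v by (intro ln_mono) auto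
    then have 2: "ln (?u N 0) + ln ?v \<le> 2 * ln B + ln (?u N (int n))" using u v B1 by (simp add: ln_mult ln_realpow)
    show ?thesis using 1 2 u by (simp add: ln_div abs_le_iff)
  qed
  show ?thesis
    by (rule LIMSEQ_le_const2[OF tendsto_rabs[OF tendsto_diff[OF lims tendsto_const]]]) (use bd in auto)
qed

end

section \<open>The ergodic theorem\<close>

locale ergodic_system = prob_space M for M :: "'a measure" +
  fixes T :: "'a \<Rightarrow> 'a"
  assumes T_meas [measurable]: "T \<in> measurable M M" and T_pres: "distr M M T = M"
    and T_erg: "\<And>A. A \<in> sets M \<Longrightarrow> T -` A \<inter> space M = A \<Longrightarrow> prob A = 0 \<or> prob A = 1"
begin

lemma T_space: "x \<in> space M \<Longrightarrow> T x \<in> space M"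
  using T_meas by (rule measurable_space)

lemma integrable_T: "integrable M f \<Longrightarrow> integrable M (\<lambda>x. f (T x))" for f :: "'a \<Rightarrow> real"
  using integrable_distr[of T M M f] T_pres by simp

lemma integral_T: "integrable M f \<Longrightarrow> (\<integral>x. f (T x) \<partial>M) = (\<integral>x. f x \<partial>M)" for f :: "'a \<Rightarrow> real"
  using integral_distr[of T M M f] T_pres by simp

text \<open>The maximum of the partial sums of lengths \<open>0\<close> to \<open>n\<close> along
  the orbit, in the recursive form that links level \<open>n + 1\<close> at \<open>x\<close> with
  level \<open>n\<close> at \<open>T x\<close>.\<close>

primrec max_sum :: "('a \<Rightarrow> real) \<Rightarrow> nat \<Rightarrow> 'a \<Rightarrow> real" where
  "max_sum g 0 x = 0"
| "max_sum g (Suc n) x = max 0 (g x + max_sum g n (T x))"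

lemma max_sum_nonneg: "0 \<le> max_sum g n x"
  by (cases n) auto

lemma max_sum_mono: "max_sum g n x \<le> max_sum g (Suc n) x"
proof (induction n arbitrary: x)
  case (Suc n)
  have "max_sum g n (T x) \<le> max_sum g (Suc n) (T x)" by (rule Suc.IH)
  then show ?case unfolding max_sum.simps(2)[of g _ x] by linarith
qed simp

lemma sum_le_max_sum: "(\<Sum>k<n. g ((T ^^ k) x)) \<le> max_sum g n x"
proof (induction n arbitrary: x)
  case (Suc n)
  have "(\<Sum>k<Suc n. g ((T ^^ k) x)) = g x + (\<Sum>k<n. g ((T ^^ k) (T x)))"
    unfolding sum.lessThan_Suc_shift by (simp add: funpow_swap1)
  also have "\<dots> \<le> max_sum g (Suc n) x" using Suc[of "T x"] by simp
  finally show ?case .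
qed simp

lemma integrable_max_sum: "integrable M g \<Longrightarrow> integrable M (max_sum g n)"
proof (induction n)
  case 0
  have "max_sum g 0 = (\<lambda>_. 0)" by (rule ext) simp
  then show ?case by simp
next
  case (Suc n)
  then show ?case by (auto intro!: integrable_max Bochner_Integration.integrable_add integrable_T)
qed

text \<open>Garsia's argument: on the set where the running maximum \<open>M\<^sub>n\<^sub>+\<^sub>1\<close> is positive,
  \<open>g = M\<^sub>n\<^sub>+\<^sub>1 - M\<^sub>n \<circ> T\<close>, so \<open>g\<close> has nonnegative integral there; if the
  maxima were unbounded almost surely, that set would exhaust the space.\<close>
lemma sums_bounded_above:
  fixes g :: "'a \<Rightarrow> real"
  assumes g: "integrable M g" and neg: "(\<integral>x. g x \<partial>M) < 0"
  shows "AE x in M. \<exists>K. \<forall>n. (\<Sum>k<n. g ((T ^^ k) x)) \<le> K"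
proof -
  note im = integrable_max_sum[OF g]
  note [measurable] = borel_measurable_integrable[OF g] borel_measurable_integrable[OF im]
  \<comment> \<open>Natural bounds \<open>K\<close> keep the quantifiers countable. The set is
    invariant because passing from \<open>x\<close> to \<open>T x\<close> changes the maxima by the
    finite amount \<open>g x\<close> and one index.\<close>
  define A where "A = {x\<in>space M. \<forall>K::nat. \<exists>n. real K < max_sum g n x}"
  have A_sets: "A \<in> sets M" unfolding A_def by measurable
  have "T -` A \<inter> space M = A"
  proof (intro set_eqI iffI)
    fix x assume x: "x \<in> T -` A \<inter> space M"
    have "\<exists>n. real K < max_sum g n x" for K
    proof -
      obtain K' :: nat where K': "real K - g x \<le> real K'" using real_arch_simple by blast
      obtain n where "real K' < max_sum g n (T x)" using x by (auto simp: A_def)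
      then have "real K < max_sum g (Suc n) x" using K' by simp
      then show ?thesis by blast
    qed
    then show "x \<in> A" using x by (auto simp: A_def)
  next
    fix x assume x: "x \<in> A"
    have "\<exists>n. real K < max_sum g n (T x)" for K
    proof -
      obtain K' :: nat where K': "max 0 (g x + real K) \<le> real K'" using real_arch_simple by blast
      obtain n where n: "real K' < max_sum g n x" using x by (auto simp: A_def)
      then have "0 < max_sum g n x" by simp
      then obtain m where m: "n = Suc m" by (cases n) auto
      have "real K' < max 0 (g x + max_sum g m (T x))" using n unfolding m max_sum.simps .
      then have "real K' < g x + max_sum g m (T x)" by (auto simp: less_max_iff_disj)
      moreover have "g x + real K \<le> real K'" using K' by simp
      ultimately have "real K < max_sum g m (T x)" by linarith
      then show ?thesis by blast
    qed
    then show "x \<in> T -` A \<inter> space M" using x T_space by (auto simp: A_def)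
  qed
  then have "prob A = 0 \<or> prob A = 1" by (rule T_erg[OF A_sets])
  then show ?thesis
  proof
    assume "prob A = 0"
    then have "AE x in M. x \<notin> A" using A_sets by (simp add: prob_eq_0)
    with AE_space show ?thesis
    proof eventually_elim
      case (elim x)
      then obtain K :: nat where "max_sum g n x \<le> real K" for n by (auto simp: A_def not_less)
      then have "(\<Sum>k<n. g ((T ^^ k) x)) \<le> real K" for n using sum_le_max_sum order_trans by blast
      then show ?case by blast
    qed
  next
    assume "prob A = 1"
    then have AE_A: "AE x in M. x \<in> A" using A_sets by (simp add: prob_eq_1)
    define h where "h n x = (if 0 < max_sum g (Suc n) x then g x else 0)" for n x
    have h_meas [measurable]: "h n \<in> borel_measurable M" for n unfolding h_def by measurable
    have ih: "integrable M (h n)" for n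
      by (rule Bochner_Integration.integrable_bound[OF g]) (auto simp: h_def)
    have "0 \<le> (\<integral>x. h n x \<partial>M)" for n
    proof -
      have "0 \<le> (\<integral>x. max_sum g (Suc n) x \<partial>M) - (\<integral>x. max_sum g n x \<partial>M)"
        using integral_mono[OF im im max_sum_mono] by simp
      also have "\<dots> = (\<integral>x. max_sum g (Suc n) x \<partial>M) - (\<integral>x. max_sum g n (T x) \<partial>M)"
        by (simp only: integral_T[OF im])
      also have "\<dots> = (\<integral>x. max_sum g (Suc n) x - max_sum g n (T x) \<partial>M)"
        by (rule Bochner_Integration.integral_diff[symmetric]) (intro im integrable_T)+
      also have "\<dots> \<le> (\<integral>x. h n x \<partial>M)"
      proof (rule integral_mono)
        show "integrable M (\<lambda>x. max_sum g (Suc n) x - max_sum g n (T x))"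
          by (intro Bochner_Integration.integrable_diff im integrable_T)
        fix x show "max_sum g (Suc n) x - max_sum g n (T x) \<le> h n x"
          using max_sum_nonneg[of g n "T x"] by (auto simp: h_def max_def)
      qed (rule ih)
      finally show ?thesis .
    qed
    moreover have "(\<lambda>n. \<integral>x. h n x \<partial>M) \<longlonglongrightarrow> (\<integral>x. g x \<partial>M)"
    proof (rule integral_dominated_convergence[where w = "\<lambda>x. norm (g x)"])
      show "AE x in M. (\<lambda>n. h n x) \<longlonglongrightarrow> g x"
        using AE_A
      proof eventually_elim
        case (elim x)
        then obtain m where m: "real 0 < max_sum g m x" unfolding A_def by blast
        have "max_sum g m x \<le> max_sum g (Suc n) x" if "m \<le> n" for n
          using that by (intro lift_Suc_mono_le[of "\<lambda>n. max_sum g n x", OF max_sum_mono]) simp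
        then have "h n x = g x" if "m \<le> n" for n using m that by (force simp: h_def simp del: max_sum.simps)
        then show ?case by (intro tendsto_eventually eventually_sequentiallyI)
      qed
    qed (use g in \<open>auto simp: h_def\<close>)
    ultimately have "0 \<le> (\<integral>x. g x \<partial>M)" by (intro LIMSEQ_le_const) auto
    then show ?thesis using neg by simp
  qed
qed

text \<open>Subtracting \<open>a\<close>, which exceeds the mean by \<open>e / 2\<close>, makes the
  mean negative; the sums are then bounded by some \<open>K\<close>, and \<open>K / n\<close> is
  absorbed by the other \<open>e / 2\<close>.\<close>

lemma birkhoff_upper:
  fixes f :: "'a \<Rightarrow> real"
  assumes f: "integrable M f" and e: "0 < e"
  shows "AE x in M. \<forall>\<^sub>F n in sequentially. (\<Sum>k<n. f ((T ^^ k) x)) / real n \<le> (\<integral>x. f x \<partial>M) + e"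
proof -
  define a where "a = (\<integral>x. f x \<partial>M) + e / 2"
  have "AE x in M. \<exists>K. \<forall>n. (\<Sum>k<n. f ((T ^^ k) x) - a) \<le> K"
    by (rule sums_bounded_above) (use f e in \<open>auto simp: a_def prob_space\<close>)
  then show ?thesis
  proof eventually_elim
    case (elim x)
    then obtain K where K: "(\<Sum>k<n. f ((T ^^ k) x)) - real n * a \<le> K" for n by (auto simp: sum_subtractf)
    obtain m :: nat where m: "2 * \<bar>K\<bar> / e \<le> real m" using real_arch_simple by blast
    show ?case
    proof (rule eventually_sequentiallyI[of "Suc m"])
      fix n assume n: "Suc m \<le> n"
      have "2 * \<bar>K\<bar> / e \<le> real n" using m n by linarith
      then have "K \<le> real n * (e / 2)" using e by (simp add: field_simps)
      then have "(\<Sum>k<n. f ((T ^^ k) x)) \<le> real n * (a + e / 2)" using K[of n] by (simp add: algebra_simps)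
      then have "(\<Sum>k<n. f ((T ^^ k) x)) / real n \<le> a + e / 2" using n by (simp add: field_simps)
      then show "(\<Sum>k<n. f ((T ^^ k) x)) / real n \<le> (\<integral>x. f x \<partial>M) + e" by (simp add: a_def)
    qed
  qed
qed

theorem birkhoff:
  fixes f :: "'a \<Rightarrow> real"
  assumes f: "integrable M f"
  shows "AE x in M. (\<lambda>n. (\<Sum>k<n. f ((T ^^ k) x)) / real n) \<longlonglongrightarrow> (\<integral>x. f x \<partial>M)"
proof -
  let ?S = "\<lambda>f x n. (\<Sum>k<n. f ((T ^^ k) x)) / real n"
  have "AE x in M. \<forall>m::nat. \<forall>\<^sub>F n in sequentially. ?S f x n \<le> (\<integral>x. f x \<partial>M) + 1 / real (Suc m)"
    unfolding AE_all_countable by (intro allI birkhoff_upper[OF f]) simp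
  moreover have "AE x in M. \<forall>m::nat. \<forall>\<^sub>F n in sequentially. ?S (\<lambda>x. - f x) x n \<le> (\<integral>x. - f x \<partial>M) + 1 / real (Suc m)"
    unfolding AE_all_countable using f by (intro allI birkhoff_upper) auto
  ultimately show ?thesis
  proof eventually_elim
    case (elim x)
    show ?case
    proof (rule tendstoI)
      fix e :: real assume "0 < e"
      then obtain m where m: "1 / real (Suc m) < e" using nat_approx_posE by blast
      show "\<forall>\<^sub>F n in sequentially. dist (?S f x n) (\<integral>x. f x \<partial>M) < e"
        using elim(1)[rule_format, of m] elim(2)[rule_format, of m]
      proof eventually_elim
        case (elim n)
        then show ?case using m by (simp add: dist_real_def sum_negf abs_less_iff del: of_nat_Suc)
      qed
    qed
  qed
qed

end

section \<open>Measurability\<close>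

lemma continuous_on_site [continuous_intros]: "continuous_on A (\<lambda>\<omega> :: ('d::finite) env. \<omega> x)"
  by (rule continuous_on_subset[OF continuous_on_product_coordinates]) simp

lemma continuous_on_transition [continuous_intros]:
  "continuous_on A (\<lambda>\<omega> :: ('d::finite) env. qq (\<omega> x) $ i $ j)"
  "continuous_on A (\<lambda>\<omega> :: ('d::finite) env. rr (\<omega> x) $ i $ j)"
  "continuous_on A (\<lambda>\<omega> :: ('d::finite) env. pp (\<omega> x) $ i $ j)"
  unfolding qq_def rr_def pp_def by (intro continuous_intros)+

lemma continuous_on_hit_prob: "continuous_on UNIV (\<lambda>\<omega> :: ('d::finite) env. hit_prob \<omega> z n x i j)"
proof (induction n arbitrary: x i)
  case (Suc n)
  then show ?case by (cases "x = z") (auto intro!: continuous_intros)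
qed simp

lemma hit_prob_measurable [measurable]:
  "(\<lambda>\<omega> :: ('d::finite) env. hit_prob \<omega> z n x i j) \<in> borel_measurable borel"
  by (rule borel_measurable_continuous_onI[OF continuous_on_hit_prob])

lemma hit_mgf_measurable [measurable]:
  "(\<lambda>\<omega> :: ('d::finite) env. hit_mgf \<omega> lam x z i) \<in> borel_measurable borel"
  unfolding hit_mgf_def hit_gf_def by measurable

lemma Phi_rows_finite_measurable [measurable]:
  "Measurable.pred borel (\<lambda>\<omega> :: ('d::finite) env. Phi_rows_finite \<omega> lam k)"
  unfolding Phi_rows_finite_def Phi_enn_def by measurable

lemma continuous_on_env_inv: "continuous_on UNIV (env_inv :: ('d::finite) env \<Rightarrow> 'd env)"
  unfolding env_inv_def pp_def rr_def qq_def
  by (intro continuous_on_coordinatewise_then_product continuous_intros)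

lemma env_inv_measurable [measurable]: "(env_inv :: ('d::finite) env \<Rightarrow> 'd env) \<in> borel_measurable borel"
  by (rule borel_measurable_continuous_onI[OF continuous_on_env_inv])

text \<open>Agrees with \<open>log_drift\<close> wherever the generating functions are finite, but is measurable
  by construction.\<close>
definition drift :: "real \<Rightarrow> ('d::finite) env \<Rightarrow> real" where
  "drift lam \<omega> = lim (\<lambda>N. ln (hit_mgf \<omega> lam (- int N) 1 undefined / hit_mgf \<omega> lam (- int N) 0 undefined))"

lemma drift_measurable [measurable]: "drift lam \<in> borel_measurable (borel :: ('d::finite) env measure)"
  unfolding drift_def by (rule borel_measurable_lim_metric) measurable

lemma (in walk_gf) drift_eq: "drift lam \<omega> = log_drift lam \<omega>"
  unfolding drift_def
  by (intro limI log_drift_bounds(3)[of "1 / B" "real CARD('d) * B"]) (use hit_mgf_step_bounds[of 0] B1 in auto)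

lemma (in walk_gf) drift_sum:
  "\<bar>(\<Sum>k<n. drift lam ((shift ^^ k) \<omega>)) - ln (hit_mgf \<omega> lam 0 (int n) i)\<bar> \<le> 2 * ln B"
  using log_drift_sum[of n i] walk_gf.drift_eq[OF walk_gf_shift_funpow] by simp

lemma Phi_rows_finite_shift: "Phi_rows_finite (shift \<omega>) lam k = Phi_rows_finite \<omega> lam (k + 1)"
  unfolding Phi_rows_finite_def Phi_enn_def hit_prob_shift ..

section \<open>Return probabilities and admissible parameters\<close>

lemma pos_prob_return_power:
  assumes "walk_env \<omega>" "0 \<le> c" "c \<le> pos_prob \<omega> t x i x i"
  shows "c ^ m \<le> pos_prob \<omega> (m * t) x i x i"
proof (induction m)
  case (Suc m)
  have "c ^ Suc m \<le> pos_prob \<omega> t x i x i * pos_prob \<omega> (m * t) x i x i"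
    using Suc assms by (auto intro!: mult_mono)
  also have "\<dots> \<le> pos_prob \<omega> (t + m * t) x i x i" by (rule pos_prob_add_ge[OF assms(1)])
  finally show ?case by simp
qed simp

text \<open>Repeating the loop \<open>m\<close> times yields tilted weight at least
  \<open>(exp (lam * t) * c) ^ m\<close>, while \<open>pos_prob_upper_right\<close> with
  \<open>y = x\<close> bounds it by \<open>B\<^sup>2\<close> for every \<open>m\<close>.\<close>

lemma (in walk_gf) return_bound:
  assumes "0 \<le> c" "c \<le> pos_prob \<omega> t x i x i"
  shows "exp (lam * real t) * c \<le> 1"
proof (rule ccontr)
  assume "\<not> ?thesis"
  then obtain m where m: "B\<^sup>2 < (exp (lam * real t) * c) ^ m"
    using real_arch_pow by (metis not_le)
  also have "\<dots> = exp (lam * real (m * t)) * c ^ m"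
    by (simp add: power_mult_distrib exp_of_nat_mult[symmetric] mult_ac)
  also have "\<dots> \<le> exp (lam * real (m * t)) * pos_prob \<omega> (m * t) x i x i"
    by (intro mult_left_mono pos_prob_return_power we assms) auto
  also have "\<dots> \<le> B\<^sup>2" using pos_prob_upper_right[of x x "m * t" i i] by (simp add: hit_mgf_self)
  finally show False by simp
qed

section \<open>Critical parameter and limiting logarithmic generating function\<close>

text \<open>Hoelder's inequality for the sum over hitting times: both series are normalised to total
  mass one, and convexity of \<open>exp\<close> is applied term by term.\<close>

lemma hit_mgf_log_convex:
  assumes we: "walk_env \<omega>" and gf: "gf_finite \<omega> l1" "gf_finite \<omega> l2" and xz: "x \<le> z"
    and u: "0 \<le> u" "0 \<le> v" "u + v = 1"
    and pos: "0 < hit_mgf \<omega> l1 x z i" "0 < hit_mgf \<omega> l2 x z i" "0 < hit_mgf \<omega> (u * l1 + v * l2) x z i"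
  shows "ln (hit_mgf \<omega> (u * l1 + v * l2) x z i) \<le> u * ln (hit_mgf \<omega> l1 x z i) + v * ln (hit_mgf \<omega> l2 x z i)"
proof -
  let ?l = "u * l1 + v * l2" and ?A = "hit_mgf \<omega> l1 x z i" and ?B = "hit_mgf \<omega> l2 x z i"
  let ?C = "u * ln ?A + v * ln ?B"
  define p where "p t = (\<Sum>j\<in>UNIV. hit_prob \<omega> z t x i j)" for t
  have p0: "0 \<le> p t" for t unfolding p_def by (intro sum_nonneg hit_prob_nonneg we)
  have "?l \<le> max l1 l2"
  proof -
    have "?l \<le> u * max l1 l2 + v * max l1 l2" using u by (intro add_mono mult_left_mono) auto
    then show ?thesis using u(3) by (simp flip: distrib_right)
  qed
  then have gfl: "gf_finite \<omega> ?l" using gf gf_finite_mono[OF we] by (metis max_def)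
  have s: "(\<lambda>t. exp (lam * real t) * p t) sums hit_mgf \<omega> lam x z i" if "gf_finite \<omega> lam" for lam
    unfolding p_def by (rule hit_mgf_sums[OF we that xz])
  have "(\<lambda>t. exp (- ?C) * (exp (?l * real t) * p t)) sums (exp (- ?C) * hit_mgf \<omega> ?l x z i)"
    by (rule sums_mult[OF s[OF gfl]])
  moreover have "(\<lambda>t. u / ?A * (exp (l1 * real t) * p t) + v / ?B * (exp (l2 * real t) * p t)) sums (u / ?A * ?A + v / ?B * ?B)"
    by (intro sums_add sums_mult s gf)
  moreover have "exp (- ?C) * (exp (?l * real t) * p t) \<le> u / ?A * (exp (l1 * real t) * p t) + v / ?B * (exp (l2 * real t) * p t)" for t
  proof -
    have "exp (- ?C) * exp (?l * real t) = exp (u * (l1 * real t - ln ?A) + v * (l2 * real t - ln ?B))"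
      by (simp flip: exp_add) (simp add: algebra_simps)
    also have "\<dots> \<le> u * exp (l1 * real t - ln ?A) + v * exp (l2 * real t - ln ?B)"
    proof -
      have *: "1 - v = u" using u by simp
      show ?thesis
        using convex_onD[OF exp_convex, of v "l1 * real t - ln ?A" "l2 * real t - ln ?B"] u
        unfolding * by simp
    qed
    also have "\<dots> = u / ?A * exp (l1 * real t) + v / ?B * exp (l2 * real t)"
      using pos by (simp add: exp_diff)
    finally have "exp (- ?C) * exp (?l * real t) * p t \<le> (u / ?A * exp (l1 * real t) + v / ?B * exp (l2 * real t)) * p t"
      by (intro mult_right_mono p0)
    then show ?thesis by (simp add: algebra_simps)
  qed
  ultimately have "exp (- ?C) * hit_mgf \<omega> ?l x z i \<le> u / ?A * ?A + v / ?B * ?B" by (rule sums_le[rotated])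
  also have "\<dots> = 1" using pos u by simp
  finally have "exp ?C * (exp (- ?C) * hit_mgf \<omega> ?l x z i) \<le> exp ?C * 1"
    by (intro mult_left_mono) simp_all
  moreover have "exp ?C * exp (- ?C) = 1" by (simp only: exp_minus_inverse)
  ultimately have "hit_mgf \<omega> ?l x z i \<le> exp ?C" by (simp only: mult.assoc[symmetric] mult_1_left mult_1_right)
  then have "ln (hit_mgf \<omega> ?l x z i) \<le> ln (exp ?C)" using pos(3) by (intro ln_mono) simp_all
  then show ?thesis by (simp only: ln_exp)
qed

text \<open>A crossing to the right followed by one back is a loop of probability at least
  \<open>c * c\<close> and duration at least one, so \<open>return_bound\<close> limits
  \<open>lam\<close>. This makes the critical parameter finite.\<close>

lemma walk_gf_lam_bound:
  assumes cr: "\<forall>(\<omega> :: ('d::finite) env) x i j. elliptic_env \<kappa> \<omega> \<longrightarrow> (\<exists>t\<le>N. c \<le> hit_prob \<omega> (x + 1) t x i j)"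
    and ell: "elliptic_env \<kappa> (\<omega> :: 'd env)" and w: "walk_gf \<omega> lam B" and c: "0 < c" and lam: "0 \<le> lam"
  shows "lam \<le> - ln (c * c)"
proof -
  have we: "walk_env \<omega>" using w by (rule walk_gf.we)
  have "\<exists>t\<le>N. c \<le> hit_prob \<omega> (0 + 1) t 0 undefined undefined" using cr ell by (elim allE impE) assumption
  then obtain t where t: "c \<le> hit_prob \<omega> 1 t 0 undefined undefined" by (elim exE conjE) simp
  have "\<exists>t\<le>N. c \<le> pos_prob \<omega> t 1 undefined (1 - 1) undefined" by (rule pos_left_lower[OF cr ell])
  then obtain t' where t': "c \<le> pos_prob \<omega> t' 1 undefined 0 undefined" by (elim exE conjE) simp
  \<comment> \<open>At \<open>t = 0\<close> the walk is still on level 0, so the probability of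
    having hit level 1 would vanish.\<close>
  have t1: "1 \<le> real (t + t')" using t c by (cases "t = 0") simp_all
  have "c * c \<le> pos_prob \<omega> t 0 undefined 1 undefined * pos_prob \<omega> t' 1 undefined 0 undefined"
    by (intro mult_mono order_trans[OF t hit_prob_le_pos_prob[OF we]] t' pos_prob_nonneg we less_imp_le[OF c])
  also have "\<dots> \<le> pos_prob \<omega> (t + t') 0 undefined 0 undefined" by (rule pos_prob_add_ge[OF we])
  finally have "exp (lam * real (t + t')) * (c * c) \<le> 1"
    using c by (intro walk_gf.return_bound[OF w]) (simp only: mult_nonneg_nonneg less_imp_le)
  moreover have "exp (lam * 1) * (c * c) \<le> exp (lam * real (t + t')) * (c * c)"
    using mult_left_mono[OF t1 lam] c by (intro mult_right_mono) (simp_all only: exp_le_cancel_iff mult_nonneg_nonneg less_imp_le)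
  ultimately have "exp lam * (c * c) \<le> 1" by simp
  then have "ln (exp lam * (c * c)) \<le> ln 1" using c by (intro ln_mono) simp_all
  then show ?thesis using c by (simp add: ln_mult_pos)
qed

section \<open>The critical parameter of an ergodic elliptic environment\<close>

locale elliptic_ergodic_env =
  fixes \<eta> :: "('d::finite) env measure" and \<kappa> c :: real and N :: nat
  assumes prob: "prob_space \<eta>" and sets_eq: "sets \<eta> = sets borel" and erg: "stationary_ergodic \<eta>"
    and \<kappa>: "0 < \<kappa>" and ell: "AE \<omega> in \<eta>. elliptic_env \<kappa> \<omega>"
    and c: "0 < c" and crossing: "\<forall>(\<omega> :: 'd env) x i j. elliptic_env \<kappa> \<omega> \<longrightarrow>
       (\<exists>t\<le>N. c \<le> hit_prob \<omega> (x + 1) t x i j)"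
begin

sublocale ergodic_system \<eta> shift
proof -
  interpret prob_space \<eta> by (rule prob)
  show "ergodic_system \<eta> shift"
    by unfold_locales (use erg in \<open>auto simp: stationary_ergodic_def\<close>)
qed

lemma space_\<eta> [simp]: "space \<eta> = UNIV"
  using sets_eq_imp_space_eq[OF sets_eq] by simp

lemma borel_meas: "f \<in> measurable borel M \<Longrightarrow> f \<in> measurable \<eta> M"
  using measurable_cong_sets[OF sets_eq refl, of M] by simp

lemma AE_shift:
  assumes "Measurable.pred borel P"
  shows "(AE \<omega> in \<eta>. P (shift \<omega>)) \<longleftrightarrow> (AE \<omega> in \<eta>. P \<omega>)"
proof -
  have "{\<omega>\<in>space \<eta>. P \<omega>} \<in> sets \<eta>"
    using assms by (simp only: pred_def sets_eq space_\<eta> space_borel)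
  from AE_distr_iff[OF T_meas this] show ?thesis unfolding T_pres by (rule sym)
qed

lemma AE_rows_finite_all:
  assumes "AE \<omega> in \<eta>. Phi_rows_finite \<omega> lam 0"
  shows "AE \<omega> in \<eta>. \<forall>k. Phi_rows_finite \<omega> lam k"
proof -
  have step: "(AE \<omega> in \<eta>. Phi_rows_finite \<omega> lam (k + 1)) \<longleftrightarrow> (AE \<omega> in \<eta>. Phi_rows_finite \<omega> lam k)" for k
    using AE_shift[OF Phi_rows_finite_measurable, of lam k] by (simp add: Phi_rows_finite_shift)
  have "AE \<omega> in \<eta>. Phi_rows_finite \<omega> lam k" for k
  proof (induction k rule: int_induct[of _ 0])
    case base show ?case by (rule assms)
  next
    case (step1 i) then show ?case unfolding step by simp
  next
    case (step2 i) then show ?case using step[of "i - 1"] by simp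
  qed
  then show ?thesis by (simp add: AE_all_countable)
qed

lemma AE_gf_finite_iff: "(AE \<omega> in \<eta>. Phi_rows_finite \<omega> lam 0) \<longleftrightarrow> (AE \<omega> in \<eta>. gf_finite \<omega> lam)"
proof
  assume "AE \<omega> in \<eta>. Phi_rows_finite \<omega> lam 0"
  from AE_rows_finite_all[OF this] ell show "AE \<omega> in \<eta>. gf_finite \<omega> lam"
  proof eventually_elim
    case (elim \<omega>)
    show ?case by (rule Phi_rows_finite_iff[OF elliptic_env_walk_env, THEN iffD1]) (rule elim)+
  qed
next
  assume "AE \<omega> in \<eta>. gf_finite \<omega> lam"
  with ell show "AE \<omega> in \<eta>. Phi_rows_finite \<omega> lam 0"
  proof eventually_elim
    case (elim \<omega>)
    have "\<forall>k. Phi_rows_finite \<omega> lam k"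
      by (rule Phi_rows_finite_iff[OF elliptic_env_walk_env, THEN iffD2]) (rule elim)+
    then show ?case by simp
  qed
qed

lemma AE_walk_gf_iff: "(AE \<omega> in \<eta>. gf_finite \<omega> lam) \<longleftrightarrow> (AE \<omega> in \<eta>. walk_gf \<omega> lam (gf_const c N lam))"
proof
  assume "AE \<omega> in \<eta>. gf_finite \<omega> lam"
  with ell show "AE \<omega> in \<eta>. walk_gf \<omega> lam (gf_const c N lam)"
    by eventually_elim (rule walk_gfI[OF crossing _ c])
next
  assume "AE \<omega> in \<eta>. walk_gf \<omega> lam (gf_const c N lam)"
  then show "AE \<omega> in \<eta>. gf_finite \<omega> lam" by eventually_elim (rule walk_gf.gf)
qed

definition subcritical :: "real set" where
  "subcritical = {lam. AE \<omega> in \<eta>. gf_finite \<omega> lam}"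

lemma lambda_crit_eq_Sup: "lambda_crit \<eta> = Sup (ereal ` subcritical)"
  by (simp add: lambda_crit_def subcritical_def AE_gf_finite_iff)

lemma subcritical_nonpos: "lam \<le> 0 \<Longrightarrow> lam \<in> subcritical"
  unfolding subcritical_def
  using ell by (auto elim!: eventually_mono intro: gf_finite_nonpos elliptic_env_walk_env)

lemma subcritical_mono:
  assumes "lam' \<in> subcritical" "lam \<le> lam'" shows "lam \<in> subcritical"
proof -
  have "AE \<omega> in \<eta>. gf_finite \<omega> lam'" using assms by (simp add: subcritical_def)
  with ell have "AE \<omega> in \<eta>. gf_finite \<omega> lam"
    by eventually_elim (rule gf_finite_mono[OF elliptic_env_walk_env _ assms(2)])
  then show ?thesis by (simp add: subcritical_def)
qed

lemma AE_witness:
  assumes "AE \<omega> in \<eta>. P \<omega>" shows "\<exists>\<omega>. P \<omega>"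
proof (rule ccontr)
  assume "\<not> ?thesis"
  then have "AE \<omega> in \<eta>. False" using assms by (auto elim: eventually_mono)
  then show False by simp
qed

lemma subcritical_bound:
  assumes "lam \<in> subcritical" shows "lam \<le> max 0 (- ln (c * c))"
proof (cases "lam \<le> 0")
  case False
  have "AE \<omega> in \<eta>. gf_finite \<omega> lam" using assms by (simp only: subcritical_def mem_Collect_eq)
  then have "AE \<omega> in \<eta>. walk_gf \<omega> lam (gf_const c N lam)" by (rule AE_walk_gf_iff[THEN iffD1])
  with ell have "AE \<omega> in \<eta>. elliptic_env \<kappa> \<omega> \<and> walk_gf \<omega> lam (gf_const c N lam)"
    by eventually_elim (rule conjI)
  from AE_witness[OF this] obtain \<omega> :: "'d env"
    where \<omega>: "elliptic_env \<kappa> \<omega> \<and> walk_gf \<omega> lam (gf_const c N lam)" by (rule exE)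
  show ?thesis using walk_gf_lam_bound[OF crossing conjunct1[OF \<omega>] conjunct2[OF \<omega>] c] False by linarith
qed linarith

definition lcrit :: real where "lcrit = Sup subcritical"

lemma subcritical_bdd: "bdd_above subcritical"
  using subcritical_bound by (rule bdd_aboveI)

lemma subcritical_less:
  assumes "lam < lcrit" shows "lam \<in> subcritical"
proof -
  obtain l where "l \<in> subcritical" "lam < l"
    using assms less_cSup_iff[OF _ subcritical_bdd] subcritical_nonpos unfolding lcrit_def by blast
  then show ?thesis by (intro subcritical_mono[of l lam]) simp_all
qed

lemma lcrit_ge: "lam \<in> subcritical \<Longrightarrow> lam \<le> lcrit"
  unfolding lcrit_def by (rule cSup_upper[OF _ subcritical_bdd])

lemma lcrit_nonneg: "0 \<le> lcrit"
  by (rule lcrit_ge[OF subcritical_nonpos]) simp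

text \<open>Below \<open>lcrit\<close> the partial sums are bounded by
  \<open>gf_const c N lam\<close>, which is continuous in \<open>lam\<close>; the bound passes to
  the limit, so the supremum is attained.\<close>

lemma lcrit_subcritical: "lcrit \<in> subcritical"
proof -
  define l where "l n = lcrit - 1 / real (Suc n)" for n
  have "AE \<omega> in \<eta>. \<forall>n. gf_finite \<omega> (l n)"
    unfolding AE_all_countable
  proof
    fix n
    have "l n \<in> subcritical" by (rule subcritical_less) (simp add: l_def)
    then show "AE \<omega> in \<eta>. gf_finite \<omega> (l n)" by (simp add: subcritical_def)
  qed
  with ell have "AE \<omega> in \<eta>. gf_finite \<omega> lcrit"
  proof eventually_elim
    case (elim \<omega>)
    have we: "walk_env \<omega>" using elim by (auto intro: elliptic_env_walk_env)
    have lim: "l \<longlonglongrightarrow> lcrit"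
    proof -
      have "(\<lambda>n. lcrit - 1 / real (Suc n)) \<longlonglongrightarrow> lcrit - 0" by (intro tendsto_intros lim_1_over_n[THEN LIMSEQ_Suc])
      then show ?thesis unfolding l_def by simp
    qed
    show ?case unfolding gf_finite_def
    proof (intro allI)
      fix k i j
      show "summable (\<lambda>t. exp (lcrit * real t) * hit_prob \<omega> (k + 1) t k i j)"
      proof (rule summableI_nonneg_bounded[where x = "gf_const c N lcrit"])
        fix T
        have "(\<Sum>t<T. exp (l n * real t) * hit_prob \<omega> (k + 1) t k i j) \<le> gf_const c N (l n)" for n
        proof -
          interpret walk_gf \<omega> "l n" "gf_const c N (l n)"
            by (rule walk_gfI[OF crossing _ c]) (use elim in auto)
          have "(\<Sum>t<T. exp (l n * real t) * hit_prob \<omega> (k + 1) t k i j) \<le> hit_gf \<omega> (l n) k (k + 1) i j"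
            unfolding hit_gf_def
            by (intro sum_le_suminf summable_hit we gf) (auto simp: hit_prob_nonneg[OF we])
          also have "\<dots> \<le> gf_const c N (l n)" by (rule gf_upper)
          finally show ?thesis .
        qed
        moreover have "(\<lambda>n. \<Sum>t<T. exp (l n * real t) * hit_prob \<omega> (k + 1) t k i j) \<longlonglongrightarrow> (\<Sum>t<T. exp (lcrit * real t) * hit_prob \<omega> (k + 1) t k i j)"
          by (intro tendsto_intros lim)
        moreover have "(\<lambda>n. gf_const c N (l n)) \<longlonglongrightarrow> gf_const c N lcrit"
          unfolding gf_const_def using c by (intro tendsto_intros lim) auto
        ultimately show "(\<Sum>t<T. exp (lcrit * real t) * hit_prob \<omega> (k + 1) t k i j) \<le> gf_const c N lcrit"
          by (meson LIMSEQ_le)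
      qed (simp add: hit_prob_nonneg[OF we])
    qed
  qed
  then show ?thesis by (simp add: subcritical_def)
qed

lemma subcritical_eq: "subcritical = {..lcrit}"
proof (intro set_eqI iffI)
  fix l assume "l \<in> {..lcrit}"
  then show "l \<in> subcritical" by (intro subcritical_mono[OF lcrit_subcritical]) simp
qed (simp add: lcrit_ge)

lemma lambda_crit_eq: "lambda_crit \<eta> = ereal lcrit"
  unfolding lambda_crit_eq_Sup subcritical_eq by (intro Sup_eqI) auto

lemma AE_gf_finite: "lam \<le> lcrit \<Longrightarrow> AE \<omega> in \<eta>. gf_finite \<omega> lam"
proof -
  assume "lam \<le> lcrit"
  then have "lam \<in> subcritical" unfolding subcritical_eq by simp
  then show "AE \<omega> in \<eta>. gf_finite \<omega> lam" unfolding subcritical_def by simp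
qed

lemma AE_walk_gf: "lam \<le> lcrit \<Longrightarrow> AE \<omega> in \<eta>. walk_gf \<omega> lam (gf_const c N lam)"
  by (subst AE_walk_gf_iff[symmetric]) (rule AE_gf_finite)

text \<open>The definition of \<open>lcrit\<close> merely denies that finiteness holds almost
  surely. Finiteness on all levels is a shift invariant event, so ergodicity upgrades this to
  probability zero.\<close>

lemma AE_not_gf_finite:
  assumes "lcrit < lam" shows "AE \<omega> in \<eta>. \<not> gf_finite \<omega> lam"
proof -
  define A where "A = {\<omega> :: 'd env. \<forall>k. Phi_rows_finite \<omega> lam k}"
  have "{\<omega> :: 'd env\<in>space borel. \<forall>k. Phi_rows_finite \<omega> lam k} \<in> sets borel" by measurable
  then have A: "A \<in> sets \<eta>" by (simp add: A_def sets_eq)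
  have "shift -` A \<inter> space \<eta> = A"
  proof -
    have "(\<forall>k. Phi_rows_finite (shift \<omega>) lam k) \<longleftrightarrow> (\<forall>k. Phi_rows_finite \<omega> lam k)" for \<omega> :: "'d env"
      unfolding Phi_rows_finite_shift by (metis diff_add_cancel)
    then show ?thesis unfolding A_def by auto
  qed
  then have "prob A = 0 \<or> prob A = 1" by (rule T_erg[OF A])
  then show ?thesis
  proof
    assume "prob A = 0"
    then have "AE \<omega> in \<eta>. \<omega> \<notin> A" using A by (simp add: prob_eq_0)
    with ell show ?thesis
    proof eventually_elim
      case (elim \<omega>)
      then show ?case using Phi_rows_finite_iff[OF elliptic_env_walk_env[OF elim(1)], of lam] by (simp add: A_def)
    qed
  next
    assume "prob A = 1"
    then have "AE \<omega> in \<eta>. \<omega> \<in> A" using A by (simp add: prob_eq_1)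
    then have "AE \<omega> in \<eta>. Phi_rows_finite \<omega> lam 0" by eventually_elim (auto simp: A_def)
    then have "lam \<in> subcritical" by (simp add: AE_gf_finite_iff subcritical_def)
    then show ?thesis using assms by (simp add: subcritical_eq)
  qed
qed

section \<open>The deterministic function \<open>Lam\<close>\<close>

definition Lam :: "real \<Rightarrow> real" where
  "Lam lam = (\<integral>\<omega>. drift lam \<omega> \<partial>\<eta>)"

lemma AE_drift_bounds:
  assumes "lam \<le> lcrit"
  shows "AE \<omega> in \<eta>. \<bar>drift lam \<omega>\<bar> \<le> ln (real CARD('d) * gf_const c N lam) \<and> lam + ln \<kappa> \<le> drift lam \<omega>"
  using AE_walk_gf[OF assms] ell
proof eventually_elim
  case (elim \<omega>)
  then interpret walk_gf \<omega> lam "gf_const c N lam" by simp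
  let ?B = "gf_const c N lam"
  have d: "1 \<le> real CARD('d)" by (simp add: Suc_le_eq)
  have "ln (1 / ?B) \<le> log_drift lam \<omega>" "log_drift lam \<omega> \<le> ln (real CARD('d) * ?B)"
    using hit_mgf_step_bounds[of 0] B1 by (auto intro!: log_drift_bounds(1)[where b = "real CARD('d) * ?B"] log_drift_bounds(2)[where a = "1 / ?B"])
  moreover have "- ln (real CARD('d) * ?B) \<le> ln (1 / ?B)"
    using B1 d by (simp add: ln_div ln_mult)
  moreover have "ln (\<kappa> * exp lam) \<le> log_drift lam \<omega>"
    by (rule log_drift_bounds(1)[where b = "real CARD('d) * ?B"])
      (use hit_mgf_step_bounds[of 0] hit_mgf_step_ge[OF elim(2) gf, of 0] \<kappa> in auto)
  moreover have "ln (\<kappa> * exp lam) = lam + ln \<kappa>" using \<kappa> by (simp add: ln_mult)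
  ultimately show ?case unfolding drift_eq by auto
qed

lemma integrable_drift:
  assumes "lam \<le> lcrit" shows "integrable \<eta> (drift lam)"
  by (rule integrable_const_bound[of _ "ln (real CARD('d) * gf_const c N lam)"])
    (use AE_drift_bounds[OF assms] borel_meas[OF drift_measurable] in \<open>auto elim: eventually_mono\<close>)

text \<open>The integrand in \<open>Lambda_eta\<close> is exchanged almost surely for the measurable
  \<open>drift\<close>, whose almost sure bounds make both the positive and the negative part of the
  extended expectation finite.\<close>

lemma Lambda_eta_eq:
  assumes "lam \<le> lcrit" shows "Lambda_eta \<eta> lam = ereal (Lam lam)"
proof -
  let ?f = "\<lambda>\<omega>. if Phi_rows_finite \<omega> lam 0 then ereal (ln (\<Sum>j\<in>UNIV. (mu0 \<omega> lam v* Phi \<omega> lam 0) $ j)) else \<infinity>"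
  have f: "AE \<omega> in \<eta>. ?f \<omega> = ereal (drift lam \<omega>)"
    using AE_walk_gf[OF assms] ell
  proof eventually_elim
    case (elim \<omega>)
    then interpret walk_gf \<omega> lam "gf_const c N lam" by simp
    have "Phi_rows_finite \<omega> lam 0" using Phi_rows_finite_iff[OF we] gf by blast
    then show ?case unfolding drift_eq by (simp add: log_drift_def)
  qed
  have 1: "(\<integral>\<^sup>+ \<omega>. e2ennreal (?f \<omega>) \<partial>\<eta>) = (\<integral>\<^sup>+ \<omega>. ennreal (drift lam \<omega>) \<partial>\<eta>)"
    by (rule nn_integral_cong_AE) (use f in \<open>eventually_elim, simp add: ennreal_def\<close>)
  have 2: "(\<integral>\<^sup>+ \<omega>. e2ennreal (- ?f \<omega>) \<partial>\<eta>) = (\<integral>\<^sup>+ \<omega>. ennreal (- drift lam \<omega>) \<partial>\<eta>)"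
    by (rule nn_integral_cong_AE) (use f in \<open>eventually_elim, simp add: ennreal_def\<close>)
  note i = integrable_drift[OF assms]
  have fin: "(\<integral>\<^sup>+ \<omega>. ennreal (drift lam \<omega>) \<partial>\<eta>) < \<infinity>" "(\<integral>\<^sup>+ \<omega>. ennreal (- drift lam \<omega>) \<partial>\<eta>) < \<infinity>"
    using i by (auto simp: real_integrable_def less_top)
  have "eexpect \<eta> ?f = enn2ereal (\<integral>\<^sup>+ \<omega>. ennreal (drift lam \<omega>) \<partial>\<eta>) - enn2ereal (\<integral>\<^sup>+ \<omega>. ennreal (- drift lam \<omega>) \<partial>\<eta>)"
    unfolding eexpect_def 1 2 ..
  also have "\<dots> = ereal (enn2real (\<integral>\<^sup>+ \<omega>. ennreal (drift lam \<omega>) \<partial>\<eta>)) - ereal (enn2real (\<integral>\<^sup>+ \<omega>. ennreal (- drift lam \<omega>) \<partial>\<eta>))"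
  proof -
    have "enn2ereal x = ereal (enn2real x)" if "x < \<infinity>" for x
      using that by (cases x) (auto simp: enn2ereal_ennreal)
    then show ?thesis using fin by simp
  qed
  also have "\<dots> = ereal (Lam lam)" unfolding Lam_def real_lebesgue_integral_def[OF i] by simp
  finally show ?thesis using assms by (simp add: Lambda_eta_def lambda_crit_eq)
qed

lemma Lambda_eta_infinite: "lcrit < lam \<Longrightarrow> Lambda_eta \<eta> lam = \<infinity>"
  by (simp add: Lambda_eta_def lambda_crit_eq)

lemma AE_log_mgf_limit:
  assumes "lam \<le> lcrit"
  shows "AE \<omega> in \<eta>. \<forall>i. (\<lambda>n. ln (hit_mgf \<omega> lam 0 (int n) i) / real n) \<longlonglongrightarrow> Lam lam"
  using birkhoff[OF integrable_drift[OF assms]] AE_walk_gf[OF assms]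
proof eventually_elim
  case (elim \<omega>)
  then interpret walk_gf \<omega> lam "gf_const c N lam" by simp
  let ?S = "\<lambda>n. (\<Sum>k<n. drift lam ((shift ^^ k) \<omega>))"
  show ?case
  proof
    fix i
    let ?h = "\<lambda>n. ln (hit_mgf \<omega> lam 0 (int n) i)"
    have "(\<lambda>n. (?h n - ?S n) / real n) \<longlonglongrightarrow> 0"
    proof (rule Lim_null_comparison)
      show "\<forall>\<^sub>F n in sequentially. norm ((?h n - ?S n) / real n) \<le> 2 * ln (gf_const c N lam) / real n"
        using drift_sum by (auto intro!: always_eventually divide_right_mono simp: abs_minus_commute)
      show "(\<lambda>n. 2 * ln (gf_const c N lam) / real n) \<longlonglongrightarrow> 0" by (rule lim_const_over_n)
    qed
    from tendsto_add[OF this elim(1)] show "(\<lambda>n. ?h n / real n) \<longlonglongrightarrow> Lam lam"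
      by (simp add: Lam_def diff_divide_distrib)
  qed
qed

lemma Lam_lower: "lam \<le> lcrit \<Longrightarrow> lam + ln \<kappa> \<le> Lam lam"
  unfolding Lam_def
  by (rule integral_ge_const[OF integrable_drift]) (use AE_drift_bounds in \<open>auto elim: eventually_mono\<close>)

lemma Lam_upper_nonpos:
  assumes "lam \<le> 0" shows "Lam lam \<le> lam"
proof -
  have l: "lam \<le> lcrit" using assms lcrit_nonneg by simp
  have "AE \<omega> in \<eta>. drift lam \<omega> \<le> lam"
    using AE_walk_gf[OF l]
  proof eventually_elim
    case (elim \<omega>)
    then interpret walk_gf \<omega> lam "gf_const c N lam" by simp
    have "log_drift lam \<omega> \<le> ln (exp lam)"
      by (rule log_drift_bounds(2)[where a = "1 / gf_const c N lam"])
        (use hit_mgf_step_bounds(1)[of 0] hit_mgf_step_nonpos[OF we assms, of 0] B1 in auto)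
    then show ?case by (simp add: drift_eq)
  qed
  then show ?thesis unfolding Lam_def by (intro integral_le_const integrable_drift l)
qed

lemma Lam_mono:
  assumes "lam \<le> lam'" "lam' \<le> lcrit" shows "Lam lam \<le> Lam lam'"
proof -
  have l: "lam \<le> lcrit" using assms by simp
  have "AE \<omega> in \<eta>. Lam lam \<le> Lam lam'"
    using AE_log_mgf_limit[OF l] AE_log_mgf_limit[OF assms(2)] AE_walk_gf[OF l] AE_walk_gf[OF assms(2)]
  proof eventually_elim
    case (elim \<omega>)
    then interpret a: walk_gf \<omega> lam "gf_const c N lam" by simp
    interpret b: walk_gf \<omega> lam' "gf_const c N lam'" using elim by simp
    show ?case
    proof (rule LIMSEQ_le[OF elim(1)[rule_format, of undefined] elim(2)[rule_format, of undefined]])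
      show "\<exists>M. \<forall>n\<ge>M. ln (hit_mgf \<omega> lam 0 (int n) undefined) / real n \<le> ln (hit_mgf \<omega> lam' 0 (int n) undefined) / real n"
        using a.hit_mgf_pos by (auto intro!: divide_right_mono ln_mono hit_mgf_mono a.we b.gf assms)
    qed
  qed
  then show ?thesis by (auto dest: AE_witness)
qed

lemma Lam_convex: "convex_on {..lcrit} Lam"
proof (rule convex_onI)
  fix t x y :: real assume t: "0 < t" "t < 1" and x: "x \<in> {..lcrit}" and y: "y \<in> {..lcrit}"
  let ?l = "(1 - t) * x + t * y"
  have l: "?l \<le> lcrit"
    using convexD[of "{..lcrit}" x y "1 - t" t] t x y by (auto simp: convex_real_interval)
  have xy: "x \<le> lcrit" "y \<le> lcrit" using x y by auto
  have "AE \<omega> in \<eta>. Lam ?l \<le> (1 - t) * Lam x + t * Lam y"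
    using AE_log_mgf_limit[OF xy(1)] AE_log_mgf_limit[OF xy(2)] AE_log_mgf_limit[OF l]
      AE_walk_gf[OF xy(1)] AE_walk_gf[OF xy(2)] AE_walk_gf[OF l]
  proof eventually_elim
    case (elim \<omega>)
    interpret a: walk_gf \<omega> x "gf_const c N x" using elim by simp
    interpret b: walk_gf \<omega> y "gf_const c N y" using elim by simp
    interpret m: walk_gf \<omega> ?l "gf_const c N ?l" using elim by simp
    let ?h = "\<lambda>l n. ln (hit_mgf \<omega> l 0 (int n) undefined)"
    have "(\<lambda>n. (1 - t) * (?h x n / real n) + t * (?h y n / real n)) \<longlonglongrightarrow> (1 - t) * Lam x + t * Lam y"
      by (intro tendsto_intros elim(1,2)[rule_format])
    moreover have "?h ?l n / real n \<le> (1 - t) * (?h x n / real n) + t * (?h y n / real n)" for n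
    proof -
      have "?h ?l n \<le> (1 - t) * ?h x n + t * ?h y n"
        by (rule hit_mgf_log_convex) (use t in \<open>auto intro: a.we a.gf b.gf a.hit_mgf_pos b.hit_mgf_pos m.hit_mgf_pos\<close>)
      then have "?h ?l n / real n \<le> ((1 - t) * ?h x n + t * ?h y n) / real n" by (rule divide_right_mono) simp
      then show ?thesis by (simp add: add_divide_distrib)
    qed
    ultimately show ?case using elim(3)[rule_format, of undefined] by (meson LIMSEQ_le)
  qed
  then show "Lam ((1 - t) *\<^sub>R x + t *\<^sub>R y) \<le> (1 - t) * Lam x + t * Lam y" by (auto dest: AE_witness)
qed simp

text \<open>The case \<open>x = - int n\<close>, a block that ends at the origin, follows from the
  block starting there by stationarity. It serves to weigh a left crossing from 0 against the way
  back.\<close>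

lemma expectation_log_mgf:
  assumes "lam \<le> lcrit" and x: "x = 0 \<or> x = - int n"
  shows "integrable \<eta> (\<lambda>\<omega>. ln (hit_mgf \<omega> lam x (x + int n) i))"
    "\<bar>(\<integral>\<omega>. ln (hit_mgf \<omega> lam x (x + int n) i) \<partial>\<eta>) - real n * Lam lam\<bar> \<le> 2 * ln (gf_const c N lam)"
proof -
  let ?h = "\<lambda>x \<omega>. ln (hit_mgf \<omega> lam x (x + int n) i)"
  let ?S = "\<lambda>\<omega>. (\<Sum>k<n. drift lam ((shift ^^ k) \<omega>))"
  let ?B = "2 * ln (gf_const c N lam)"
  note ID = integrable_drift[OF assms(1)]
  have it: "integrable \<eta> (\<lambda>\<omega>. f ((shift ^^ k) \<omega>)) \<and> (\<integral>\<omega>. f ((shift ^^ k) \<omega>) \<partial>\<eta>) = (\<integral>\<omega>. f \<omega> \<partial>\<eta>)"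
    if "integrable \<eta> f" for k and f :: "'d env \<Rightarrow> real"
    using that
  proof (induction k arbitrary: f)
    case (Suc k)
    show ?case using Suc.IH[OF integrable_T[OF Suc.prems]] integral_T[OF Suc.prems] by simp
  qed simp
  have hm: "?h x \<in> borel_measurable \<eta>" for x by (rule borel_meas) measurable
  have S: "integrable \<eta> ?S" using it[OF ID] by (intro Bochner_Integration.integrable_sum) auto
  have intS: "(\<integral>\<omega>. ?S \<omega> \<partial>\<eta>) = real n * Lam lam"
    using it[OF ID] by (simp add: Bochner_Integration.integral_sum Lam_def)
  have bd: "AE \<omega> in \<eta>. \<bar>?S \<omega> - ?h 0 \<omega>\<bar> \<le> ?B"
    using AE_walk_gf[OF assms(1)] by eventually_elim (use walk_gf.drift_sum in auto)
  have D: "integrable \<eta> (\<lambda>\<omega>. ?S \<omega> - ?h 0 \<omega>)"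
  proof (rule integrable_const_bound[of _ ?B])
    show "(\<lambda>\<omega>. ?S \<omega> - ?h 0 \<omega>) \<in> borel_measurable \<eta>"
      by (intro borel_measurable_diff borel_measurable_integrable[OF S] hm)
  qed (use bd in simp)
  have i0: "integrable \<eta> (?h 0)"
    using Bochner_Integration.integrable_diff[OF S D] by simp
  have e0: "\<bar>(\<integral>\<omega>. ?h 0 \<omega> \<partial>\<eta>) - real n * Lam lam\<bar> \<le> ?B"
  proof -
    have "(\<integral>\<omega>. ?S \<omega> - ?h 0 \<omega> \<partial>\<eta>) = real n * Lam lam - (\<integral>\<omega>. ?h 0 \<omega> \<partial>\<eta>)"
      by (simp only: Bochner_Integration.integral_diff[OF S i0] intS)
    moreover have "(\<integral>\<omega>. ?S \<omega> - ?h 0 \<omega> \<partial>\<eta>) \<le> ?B"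
      by (rule integral_le_const[OF D]) (use bd in \<open>auto elim: eventually_mono\<close>)
    moreover have "- ?B \<le> (\<integral>\<omega>. ?S \<omega> - ?h 0 \<omega> \<partial>\<eta>)"
      by (rule integral_ge_const[OF D]) (use bd in \<open>auto elim: eventually_mono\<close>)
    ultimately show ?thesis by linarith
  qed
  have sh: "(\<lambda>\<omega>. ?h (- int n) ((shift ^^ n) \<omega>)) = ?h 0"
    by (simp add: hit_mgf_shift_funpow)
  have dn: "distr \<eta> \<eta> (shift ^^ n) = \<eta>" and mn: "(shift ^^ n) \<in> measurable \<eta> \<eta>"
  proof (induction n)
    case (Suc n)
    { case 1 show ?case using distr_distr[OF T_meas Suc(2)] Suc(1) T_pres by (simp add: comp_def) }
    { case 2 show ?case using measurable_comp[OF Suc(2) T_meas] by simp }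
  qed (simp_all add: id_def distr_id[unfolded id_def])
  have "integrable \<eta> (?h (- int n))"
    using integrable_distr_eq[OF mn hm[of "- int n"]] i0 dn sh by simp
  moreover have "(\<integral>\<omega>. ?h (- int n) \<omega> \<partial>\<eta>) = (\<integral>\<omega>. ?h 0 \<omega> \<partial>\<eta>)"
    using integral_distr[OF mn hm[of "- int n"]] dn sh by simp
  ultimately show "integrable \<eta> (?h x)" "\<bar>(\<integral>\<omega>. ?h x \<omega> \<partial>\<eta>) - real n * Lam lam\<bar> \<le> ?B"
    using i0 e0 x by auto
qed

end

section \<open>Lower bounds for the walk\<close>

lemma pos_prob_positive_trans:
  assumes "walk_env \<omega>" "\<exists>t. 0 < pos_prob \<omega> t x i y l" "\<exists>t. 0 < pos_prob \<omega> t y l z j"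
  shows "\<exists>t. 0 < pos_prob \<omega> t x i z j"
proof -
  obtain s t where "0 < pos_prob \<omega> s x i y l" "0 < pos_prob \<omega> t y l z j" using assms by blast
  then have "0 < pos_prob \<omega> (s + t) x i z j"
    using pos_prob_add_ge[OF assms(1), of s x i y l t z j] mult_pos_pos less_le_trans by blast
  then show ?thesis by blast
qed

lemma pos_prob_irreducible:
  fixes \<omega> :: "('d::finite) env"
  assumes cr: "\<forall>(\<omega> :: 'd env) x i j. elliptic_env \<kappa> \<omega> \<longrightarrow> (\<exists>t\<le>N. c \<le> hit_prob \<omega> (x + 1) t x i j)"
    and ell: "elliptic_env \<kappa> \<omega>" and c: "0 < c"
  shows "\<exists>t. 0 < pos_prob \<omega> t x i y j"
proof -
  have we: "walk_env \<omega>" by (rule elliptic_env_walk_env[OF ell])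
  have right: "\<exists>t. 0 < pos_prob \<omega> t x i (x + 1) j" for x i j
  proof -
    obtain t where "c \<le> hit_prob \<omega> (x + 1) t x i j" using cr ell by blast
    then have "0 < pos_prob \<omega> t x i (x + 1) j" using hit_prob_le_pos_prob[OF we, of "x + 1" t x i j] c by linarith
    then show ?thesis by blast
  qed
  have left: "\<exists>t. 0 < pos_prob \<omega> t x i (x - 1) j" for x i j
    using pos_left_lower[OF cr ell, of x i j] c by (meson less_le_trans)
  show ?thesis
  proof (induction y arbitrary: j rule: int_induct[of _ x])
    \<comment> \<open>To change the state on the same level, go one level to the right and
      return.\<close>
    case base
    show ?case using pos_prob_positive_trans[OF we right[of x i undefined] left[of "x + 1" undefined j, simplified]] .
  next
    case (step1 y) then show ?case using pos_prob_positive_trans[OF we _ right] by blast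
  next
    case (step2 y) then show ?case using pos_prob_positive_trans[OF we _ left] by blast
  qed
qed

text \<open>Otherwise \<open>h\<close> would eventually lie below
  \<open>exp (- (lam' * real t))\<close> and the series would be dominated by a geometric one of
  ratio \<open>exp (lam - lam')\<close>.\<close>

lemma infinitely_often_of_not_summable:
  fixes h :: "nat \<Rightarrow> real"
  assumes "\<And>t. 0 \<le> h t" "\<not> summable (\<lambda>t. exp (lam * real t) * h t)" "lam < lam'"
  shows "\<exists>t\<ge>M. exp (- (lam' * real t)) \<le> h t"
proof (rule ccontr)
  assume "\<not> ?thesis"
  then have small: "h t \<le> exp (- (lam' * real t))" if "t \<ge> M" for t using that by (meson linorder_linear)
  have "summable (\<lambda>t. exp (lam - lam') ^ t)" using assms(3) by (intro summable_geometric) simp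
  then have "summable (\<lambda>t. exp (lam * real t) * h t)"
  proof (rule summable_comparison_test'[where N = M])
    fix t assume "M \<le> t"
    have "exp (lam * real t) * h t \<le> exp (lam * real t) * exp (- (lam' * real t))"
      using small[OF \<open>M \<le> t\<close>] by (intro mult_left_mono) auto
    also have "\<dots> = exp (lam - lam') ^ t"
      by (simp add: exp_of_nat_mult[symmetric] exp_add[symmetric] algebra_simps)
    finally show "norm (exp (lam * real t) * h t) \<le> exp (lam - lam') ^ t"
      using assms(1)[of t] by simp
  qed
  then show False using assms(2) by simp
qed

text \<open>Divergence at some level \<open>k\<close> supplies arbitrarily long crossings from
  \<open>k\<close> to \<open>k + 1\<close> that are not too unlikely; closed up by one fixed way
  back they form a loop. Its iterates are tied to the origin by paths of bounded length, whence
  \<open>R\<close> and \<open>a\<close>.\<close>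

lemma return_lower:
  fixes \<omega> :: "('d::finite) env"
  assumes cr: "\<forall>(\<omega> :: 'd env) x i j. elliptic_env \<kappa> \<omega> \<longrightarrow> (\<exists>t\<le>N. c \<le> hit_prob \<omega> (x + 1) t x i j)"
    and ell: "elliptic_env \<kappa> \<omega>" and c: "0 < c"
    and inf: "\<not> gf_finite \<omega> lam" and lam: "lam < lam'"
  shows "\<exists>T R a. 0 < T \<and> 0 < a \<and> (\<forall>m i. \<exists>r\<le>R. \<exists>j. a * exp (- (lam' * real (m * T))) \<le> pos_prob \<omega> (m * T + r) 0 i 0 j)"
proof -
  have we: "walk_env \<omega>" by (rule elliptic_env_walk_env[OF ell])
  note irr = pos_prob_irreducible[OF cr ell c]
  obtain k i0 j0 where ns: "\<not> summable (\<lambda>t. exp (lam * real t) * hit_prob \<omega> (k + 1) t k i0 j0)"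
    using inf by (auto simp: gf_finite_def)
  obtain r0 where r0: "0 < pos_prob \<omega> r0 (k + 1) j0 k i0" using irr by blast
  define b where "b = pos_prob \<omega> r0 (k + 1) j0 k i0"
  \<comment> \<open>The crossing is found at rate \<open>lam1\<close>; over a long time
    \<open>t\<close> the margin up to \<open>lam'\<close> pays for the factor \<open>b\<close> of
    the way back, which fixes \<open>M\<close>.\<close>
  define lam1 where "lam1 = (lam + lam') / 2"
  have l1: "lam < lam1" "lam1 < lam'" using lam by (auto simp: lam1_def)
  obtain M where M: "(- ln b - lam' * real r0) / (lam' - lam1) \<le> real M" using real_arch_simple by blast
  obtain t where t: "Suc M \<le> t" "exp (- (lam1 * real t)) \<le> hit_prob \<omega> (k + 1) t k i0 j0"
    using infinitely_often_of_not_summable[OF hit_prob_nonneg[OF we] ns l1(1)] by blast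
  define T where "T = t + r0"
  have T: "0 < T" using t by (simp add: T_def)
  have ret: "exp (- (lam' * real T)) \<le> pos_prob \<omega> T k i0 k i0"
  proof -
    have "- ln b - lam' * real r0 \<le> real M * (lam' - lam1)"
      using M l1 by (simp add: pos_divide_le_eq)
    also have "\<dots> \<le> real t * (lam' - lam1)" using t l1 by (intro mult_right_mono) auto
    finally have "- (lam' * real T) \<le> - (lam1 * real t) + ln b" by (simp add: T_def algebra_simps)
    then have "exp (- (lam' * real T)) \<le> exp (- (lam1 * real t)) * b"
      using r0 by (metis b_def exp_le_cancel_iff exp_add exp_ln)
    also have "\<dots> \<le> pos_prob \<omega> t k i0 (k + 1) j0 * b"
      using t hit_prob_le_pos_prob[OF we, of "k + 1" t k i0 j0] r0 by (intro mult_right_mono) (auto simp: b_def)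
    also have "\<dots> \<le> pos_prob \<omega> T k i0 k i0"
      unfolding b_def T_def by (rule pos_prob_add_ge[OF we])
    finally show ?thesis .
  qed
  have "\<forall>i. \<exists>t. 0 < pos_prob \<omega> t 0 i k i0" using irr by blast
  then obtain r1 where r1: "\<And>i. 0 < pos_prob \<omega> (r1 i) 0 i k i0" by metis
  obtain r2 where r2: "0 < pos_prob \<omega> r2 k i0 0 undefined" using irr by blast
  define a1 where "a1 = Min (range (\<lambda>i. pos_prob \<omega> (r1 i) 0 i k i0))"
  have a1: "0 < a1" "\<And>i. a1 \<le> pos_prob \<omega> (r1 i) 0 i k i0"
    unfolding a1_def using r1 by auto
  define a where "a = a1 * pos_prob \<omega> r2 k i0 0 undefined"
  define R where "R = Max (range r1) + r2"
  have "\<exists>r\<le>R. \<exists>j. a * exp (- (lam' * real (m * T))) \<le> pos_prob \<omega> (m * T + r) 0 i 0 j" for m i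
  proof (intro exI conjI)
    show "r1 i + r2 \<le> R" unfolding R_def by (intro add_right_mono Max_ge) auto
    have "exp (- (lam' * real (m * T))) = exp (- (lam' * real T)) ^ m"
      by (simp add: exp_of_nat_mult[symmetric] mult_ac)
    also have "\<dots> \<le> pos_prob \<omega> (m * T) k i0 k i0" by (rule pos_prob_return_power[OF we _ ret]) simp
    finally have "a * exp (- (lam' * real (m * T))) \<le> a * pos_prob \<omega> (m * T) k i0 k i0"
      using a1 r2 by (intro mult_left_mono) (auto simp: a_def)
    also have "\<dots> = a1 * pos_prob \<omega> (m * T) k i0 k i0 * pos_prob \<omega> r2 k i0 0 undefined" by (simp add: a_def)
    also have "\<dots> \<le> pos_prob \<omega> (r1 i) 0 i k i0 * pos_prob \<omega> (m * T) k i0 k i0 * pos_prob \<omega> r2 k i0 0 undefined"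
      by (intro mult_right_mono a1 pos_prob_nonneg we)
    also have "\<dots> \<le> pos_prob \<omega> (r1 i + m * T) 0 i k i0 * pos_prob \<omega> r2 k i0 0 undefined"
      by (intro mult_right_mono pos_prob_add_ge pos_prob_nonneg we)
    also have "\<dots> \<le> pos_prob \<omega> (r1 i + m * T + r2) 0 i 0 undefined" by (rule pos_prob_add_ge[OF we])
    finally show "a * exp (- (lam' * real (m * T))) \<le> pos_prob \<omega> (m * T + (r1 i + r2)) 0 i 0 undefined"
      by (simp add: add_ac)
  qed
  moreover have "0 < a" using a1 r2 by (simp add: a_def)
  ultimately show ?thesis using T by blast
qed

subsection \<open>Attainable displacement, time and cost\<close>

definition attainable :: "('d::finite) env \<Rightarrow> real \<Rightarrow> real \<Rightarrow> real \<Rightarrow> real \<Rightarrow> bool" where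
  "attainable \<omega> u a \<tau> \<gamma> \<longleftrightarrow> (\<forall>\<epsilon>>0. \<forall>\<^sub>F n in sequentially. \<forall>i. \<exists>t j.
     \<bar>real t - real n * \<tau>\<bar> \<le> real n * \<epsilon> \<and>
     exp (- (real n * (\<gamma> + \<epsilon>))) \<le> pos_prob \<omega> t \<lfloor>u * real n\<rfloor> i \<lfloor>(u + a) * real n\<rfloor> j)"

lemma eventually_linear_le:
  fixes a K :: real assumes "0 < a"
  shows "\<forall>\<^sub>F n in sequentially. K \<le> real n * a"
proof -
  obtain m :: nat where "K / a \<le> real m" using real_arch_simple by blast
  then have "K \<le> real n * a" if "m \<le> n" for n
  proof -
    have "K / a \<le> real n" using \<open>K / a \<le> real m\<close> that by linarith
    then show ?thesis using assms by (simp add: field_simps)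
  qed
  then show ?thesis by (rule eventually_sequentiallyI)
qed

lemma attainable_zero: "attainable \<omega> u 0 0 0"
  unfolding attainable_def
proof (intro allI impI always_eventually)
  fix \<epsilon> :: real and n i assume "0 < \<epsilon>"
  then show "\<exists>t j. \<bar>real t - real n * 0\<bar> \<le> real n * \<epsilon> \<and>
     exp (- (real n * (0 + \<epsilon>))) \<le> pos_prob \<omega> t \<lfloor>u * real n\<rfloor> i \<lfloor>(u + 0) * real n\<rfloor> j"
    by (intro exI[of _ 0] exI[of _ i]) simp
qed

lemma attainable_mono: "attainable \<omega> u a \<tau> \<gamma> \<Longrightarrow> \<gamma> \<le> \<gamma>' \<Longrightarrow> attainable \<omega> u a \<tau> \<gamma>'"
  unfolding attainable_def
proof (intro allI impI)
  fix \<epsilon> :: real assume *: "\<gamma> \<le> \<gamma>'" "0 < \<epsilon>" and "\<forall>\<epsilon>>0. \<forall>\<^sub>F n in sequentially. \<forall>i. \<exists>t j.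
     \<bar>real t - real n * \<tau>\<bar> \<le> real n * \<epsilon> \<and>
     exp (- (real n * (\<gamma> + \<epsilon>))) \<le> pos_prob \<omega> t \<lfloor>u * real n\<rfloor> i \<lfloor>(u + a) * real n\<rfloor> j"
  then have "\<forall>\<^sub>F n in sequentially. \<forall>i. \<exists>t j.
     \<bar>real t - real n * \<tau>\<bar> \<le> real n * \<epsilon> \<and>
     exp (- (real n * (\<gamma> + \<epsilon>))) \<le> pos_prob \<omega> t \<lfloor>u * real n\<rfloor> i \<lfloor>(u + a) * real n\<rfloor> j" by blast
  then show "\<forall>\<^sub>F n in sequentially. \<forall>i. \<exists>t j.
     \<bar>real t - real n * \<tau>\<bar> \<le> real n * \<epsilon> \<and>
     exp (- (real n * (\<gamma>' + \<epsilon>))) \<le> pos_prob \<omega> t \<lfloor>u * real n\<rfloor> i \<lfloor>(u + a) * real n\<rfloor> j"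
  proof eventually_elim
    case (elim n)
    have "exp (- (real n * (\<gamma>' + \<epsilon>))) \<le> exp (- (real n * (\<gamma> + \<epsilon>)))" using * by (simp add: mult_left_mono)
    then show ?case using elim by (meson order_trans)
  qed
qed

lemma attainable_add:
  assumes we: "walk_env \<omega>" and 1: "attainable \<omega> u a1 \<tau>1 \<gamma>1" and 2: "attainable \<omega> (u + a1) a2 \<tau>2 \<gamma>2"
  shows "attainable \<omega> u (a1 + a2) (\<tau>1 + \<tau>2) (\<gamma>1 + \<gamma>2)"
  unfolding attainable_def
proof (intro allI impI)
  fix \<epsilon> :: real assume "0 < \<epsilon>"
  then have e: "0 < \<epsilon> / 2" by simp
  show "\<forall>\<^sub>F n in sequentially. \<forall>i. \<exists>t j. \<bar>real t - real n * (\<tau>1 + \<tau>2)\<bar> \<le> real n * \<epsilon> \<and>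
     exp (- (real n * (\<gamma>1 + \<gamma>2 + \<epsilon>))) \<le> pos_prob \<omega> t \<lfloor>u * real n\<rfloor> i \<lfloor>(u + (a1 + a2)) * real n\<rfloor> j"
    using 1[unfolded attainable_def, rule_format, OF e] 2[unfolded attainable_def, rule_format, OF e]
  proof eventually_elim
    case (elim n)
    show ?case
    proof
      fix i
      obtain t1 l where t1: "\<bar>real t1 - real n * \<tau>1\<bar> \<le> real n * (\<epsilon> / 2)"
        "exp (- (real n * (\<gamma>1 + \<epsilon> / 2))) \<le> pos_prob \<omega> t1 \<lfloor>u * real n\<rfloor> i \<lfloor>(u + a1) * real n\<rfloor> l"
        using elim(1) by blast
      obtain t2 j where t2: "\<bar>real t2 - real n * \<tau>2\<bar> \<le> real n * (\<epsilon> / 2)"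
        "exp (- (real n * (\<gamma>2 + \<epsilon> / 2))) \<le> pos_prob \<omega> t2 \<lfloor>(u + a1) * real n\<rfloor> l \<lfloor>(u + a1 + a2) * real n\<rfloor> j"
        using elim(2) by blast
      have "exp (- (real n * (\<gamma>1 + \<gamma>2 + \<epsilon>))) = exp (- (real n * (\<gamma>1 + \<epsilon> / 2))) * exp (- (real n * (\<gamma>2 + \<epsilon> / 2)))"
        by (simp add: exp_add[symmetric] algebra_simps)
      also have "\<dots> \<le> pos_prob \<omega> t1 \<lfloor>u * real n\<rfloor> i \<lfloor>(u + a1) * real n\<rfloor> l * pos_prob \<omega> t2 \<lfloor>(u + a1) * real n\<rfloor> l \<lfloor>(u + a1 + a2) * real n\<rfloor> j"
        by (intro mult_mono t1 t2 pos_prob_nonneg we) simp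
      also have "\<dots> \<le> pos_prob \<omega> (t1 + t2) \<lfloor>u * real n\<rfloor> i \<lfloor>(u + (a1 + a2)) * real n\<rfloor> j"
        unfolding add.assoc[symmetric] by (rule pos_prob_add_ge[OF we])
      finally have "exp (- (real n * (\<gamma>1 + \<gamma>2 + \<epsilon>))) \<le> pos_prob \<omega> (t1 + t2) \<lfloor>u * real n\<rfloor> i \<lfloor>(u + (a1 + a2)) * real n\<rfloor> j" .
      moreover have "\<bar>real (t1 + t2) - real n * (\<tau>1 + \<tau>2)\<bar> \<le> real n * \<epsilon>"
        unfolding of_nat_add distrib_left using t1(1) t2(1) by linarith
      ultimately show "\<exists>t j. \<bar>real t - real n * (\<tau>1 + \<tau>2)\<bar> \<le> real n * \<epsilon> \<and>
        exp (- (real n * (\<gamma>1 + \<gamma>2 + \<epsilon>))) \<le> pos_prob \<omega> t \<lfloor>u * real n\<rfloor> i \<lfloor>(u + (a1 + a2)) * real n\<rfloor> j" by blast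
    qed
  qed
qed

text \<open>Confined to the starting level 0, because the loop from \<open>return_lower\<close> sits
  at a fixed level: the way there and back has bounded length and probability bounded below, both
  invisible at scale \<open>n\<close>.\<close>

lemma attainable_stay:
  fixes \<omega> :: "('d::finite) env"
  assumes cr: "\<forall>(\<omega> :: 'd env) x i j. elliptic_env \<kappa> \<omega> \<longrightarrow> (\<exists>t\<le>N. c \<le> hit_prob \<omega> (x + 1) t x i j)"
    and ell: "elliptic_env \<kappa> \<omega>" and c: "0 < c" and l0: "0 \<le> l"
    and inf: "\<And>lam. l < lam \<Longrightarrow> \<not> gf_finite \<omega> lam" and s: "0 \<le> s"
  shows "attainable \<omega> 0 0 s (s * l)"
  unfolding attainable_def
proof (intro allI impI)
  fix \<epsilon> :: real assume e: "0 < \<epsilon>"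
  \<comment> \<open>The loop is built at \<open>l + 2 * \<delta>\<close>, one \<delta> above a
    divergent parameter; the excess \<open>2 * (s * \<delta>)\<close> is at most half of \<epsilon>,
    the other half covers \<open>- ln a\<close>.\<close>
  define \<delta> where "\<delta> = \<epsilon> / (4 * (s + 1))"
  have \<delta>: "0 < \<delta>" "s * \<delta> \<le> \<epsilon> / 4" using e s by (auto simp: \<delta>_def field_simps)
  define lam' where "lam' = l + 2 * \<delta>"
  have "\<not> gf_finite \<omega> (l + \<delta>)" "l + \<delta> < lam'" using inf \<delta> by (auto simp: lam'_def)
  from return_lower[OF cr ell c this] obtain T R a where T: "0 < T" and a: "0 < a" and
    ret: "\<And>m i. \<exists>r\<le>R. \<exists>j. a * exp (- (lam' * real (m * T))) \<le> pos_prob \<omega> (m * T + r) 0 i 0 j" by blast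
  show "\<forall>\<^sub>F n in sequentially. \<forall>i. \<exists>t j. \<bar>real t - real n * s\<bar> \<le> real n * \<epsilon> \<and>
     exp (- (real n * (s * l + \<epsilon>))) \<le> pos_prob \<omega> t \<lfloor>0 * real n\<rfloor> i \<lfloor>(0 + 0) * real n\<rfloor> j"
    using eventually_linear_le[OF e, of "real T + real R"] eventually_linear_le[OF half_gt_zero[OF e], of "- ln a"]
  proof eventually_elim
    case n: (elim n)
    \<comment> \<open>The number of complete loops that fit; the remainder below \<open>T\<close>
      and the connection of length at most \<open>R\<close> fall within
      \<open>n * \<epsilon>\<close>.\<close>
    define m where "m = nat \<lfloor>real n * s / real T\<rfloor>"
    have m: "real m \<le> real n * s / real T" "real n * s / real T < real m + 1"
      unfolding m_def using s by (auto simp: of_nat_nat)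
    then have mT: "real (m * T) \<le> real n * s" "real n * s < real (m * T) + real T"
      using T by (auto simp: field_simps)
    show ?case
    proof
      fix i
      obtain r j where r: "r \<le> R" "a * exp (- (lam' * real (m * T))) \<le> pos_prob \<omega> (m * T + r) 0 i 0 j" using ret by blast
      have "\<bar>real (m * T + r) - real n * s\<bar> \<le> real n * \<epsilon>" using mT r(1) n(1) by (simp add: abs_le_iff)
      moreover have "exp (- (real n * (s * l + \<epsilon>))) \<le> pos_prob \<omega> (m * T + r) 0 i 0 j"
      proof -
        have "lam' * real (m * T) \<le> lam' * (real n * s)" using mT l0 \<delta> by (intro mult_left_mono) (auto simp: lam'_def)
        also have "\<dots> = real n * (s * l) + real n * (2 * (s * \<delta>))" by (simp add: lam'_def algebra_simps)
        also have "\<dots> \<le> real n * (s * l) + real n * (\<epsilon> / 2)" using \<delta> by (intro add_left_mono mult_left_mono) auto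
        finally have "lam' * real (m * T) \<le> real n * (s * l) + real n * (\<epsilon> / 2)" .
        then have "- (real n * (s * l + \<epsilon>)) \<le> ln a - lam' * real (m * T)" using n(2) by (simp add: algebra_simps)
        then have "exp (- (real n * (s * l + \<epsilon>))) \<le> exp (ln a + - (lam' * real (m * T)))" by simp
        also have "\<dots> = a * exp (- (lam' * real (m * T)))" using a by (simp only: exp_add exp_ln)
        finally show ?thesis using r(2) by linarith
      qed
      ultimately show "\<exists>t j. \<bar>real t - real n * s\<bar> \<le> real n * \<epsilon> \<and>
         exp (- (real n * (s * l + \<epsilon>))) \<le> pos_prob \<omega> t \<lfloor>0 * real n\<rfloor> i \<lfloor>(0 + 0) * real n\<rfloor> j"
        by (intro exI[of _ "m * T + r"] exI[of _ j]) simp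
    qed
  qed
qed

lemma floor_diff_bounds:
  fixes u a :: real
  shows "a * real n - 1 \<le> real_of_int (\<lfloor>(u + a) * real n\<rfloor> - \<lfloor>u * real n\<rfloor>)"
    "real_of_int (\<lfloor>(u + a) * real n\<rfloor> - \<lfloor>u * real n\<rfloor>) \<le> a * real n + 1"
proof -
  have "(u + a) * real n = u * real n + a * real n" by (simp add: algebra_simps)
  then show "a * real n - 1 \<le> real_of_int (\<lfloor>(u + a) * real n\<rfloor> - \<lfloor>u * real n\<rfloor>)"
    "real_of_int (\<lfloor>(u + a) * real n\<rfloor> - \<lfloor>u * real n\<rfloor>) \<le> a * real n + 1" by linarith+
qed

text \<open>Counts only the paths that jump to the right at every step.\<close>

lemma ballistic_lower:
  assumes "elliptic_env \<kappa> \<omega>" "0 < \<kappa>"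
  shows "\<kappa> ^ m \<le> (\<Sum>j\<in>UNIV. pos_prob \<omega> m x i (x + int m) j)"
proof (induction m arbitrary: x i)
  case (Suc m)
  have we: "walk_env \<omega>" by (rule elliptic_env_walk_env[OF assms(1)])
  let ?g = "\<lambda>y l. \<Sum>j\<in>UNIV. pos_prob \<omega> m y l (x + int (Suc m)) j"
  have g0: "0 \<le> ?g y l" for y l by (intro sum_nonneg pos_prob_nonneg we)
  have "\<kappa> ^ Suc m \<le> (\<Sum>l\<in>UNIV. pp (\<omega> x) $ i $ l) * \<kappa> ^ m"
    using pos_right_step_lower[OF assms(1)] assms(2) by simp
  also have "\<dots> \<le> (\<Sum>l\<in>UNIV. pp (\<omega> x) $ i $ l * ?g (x + 1) l)"
    unfolding sum_distrib_right using Suc[of "x + 1"]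
    by (intro sum_mono mult_left_mono walk_env_nonneg we) (simp add: algebra_simps)
  also have "\<dots> \<le> walk_step \<omega> ?g x i"
    unfolding walk_step_def by (intro sum_mono) (simp add: g0 walk_env_nonneg[OF we] del: of_nat_Suc)
  also have "\<dots> = (\<Sum>j\<in>UNIV. pos_prob \<omega> (Suc m) x i (x + int (Suc m)) j)"
    unfolding pos_prob_Suc walk_step_sum ..
  finally show ?case .
qed simp

lemma exists_ge_average:
  fixes f :: "'d::finite \<Rightarrow> real"
  assumes "S \<le> (\<Sum>j\<in>UNIV. f j)" shows "\<exists>j. S / real CARD('d) \<le> f j"
proof (rule ccontr)
  assume "\<not> ?thesis"
  then have "(\<Sum>j\<in>UNIV. f j) < (\<Sum>j\<in>(UNIV::'d set). S / real CARD('d))" by (intro sum_strict_mono) (auto simp: not_le)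
  then show False using assms by simp
qed

text \<open>Provides a point with time equal to displacement at finite cost; in the duality argument
  it excludes a separating functional that ignores the cost.\<close>

lemma attainable_ballistic:
  fixes \<omega> :: "('d::finite) env"
  assumes ell: "elliptic_env \<kappa> \<omega>" and \<kappa>: "0 < \<kappa>" and a: "0 \<le> a"
  shows "attainable \<omega> u a a (a * - ln \<kappa>)"
  unfolding attainable_def
proof (intro allI impI)
  fix \<epsilon> :: real assume e: "0 < \<epsilon>"
  have \<kappa>1: "\<kappa> \<le> 1" using ell in_Sigma_kappa_le[of \<kappa> "\<omega> 0"] by (simp add: elliptic_env_def)
  let ?d = "real CARD('d)"
  show "\<forall>\<^sub>F n in sequentially. \<forall>i. \<exists>t j. \<bar>real t - real n * a\<bar> \<le> real n * \<epsilon> \<and>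
     exp (- (real n * (a * - ln \<kappa> + \<epsilon>))) \<le> pos_prob \<omega> t \<lfloor>u * real n\<rfloor> i \<lfloor>(u + a) * real n\<rfloor> j"
    using eventually_linear_le[OF e, of 1] eventually_linear_le[OF e, of "ln ?d - ln \<kappa>"]
  proof eventually_elim
    case (elim n)
    define m where "m = nat (\<lfloor>(u + a) * real n\<rfloor> - \<lfloor>u * real n\<rfloor>)"
    have "u * real n \<le> (u + a) * real n" using a by (intro mult_right_mono) auto
    then have mm: "\<lfloor>(u + a) * real n\<rfloor> = \<lfloor>u * real n\<rfloor> + int m"
      unfolding m_def using floor_mono by auto
    have rm: "real m = real_of_int (\<lfloor>(u + a) * real n\<rfloor> - \<lfloor>u * real n\<rfloor>)" using mm by simp
    have m: "a * real n - 1 \<le> real m" "real m \<le> a * real n + 1"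
      unfolding rm by (rule floor_diff_bounds)+
    show ?case
    proof
      fix i
      obtain j where j: "\<kappa> ^ m / ?d \<le> pos_prob \<omega> m \<lfloor>u * real n\<rfloor> i (\<lfloor>u * real n\<rfloor> + int m) j"
        using exists_ge_average[OF ballistic_lower[OF ell \<kappa>]] by blast
      have "real m * - ln \<kappa> \<le> (a * real n + 1) * - ln \<kappa>" using m \<kappa> \<kappa>1 by (intro mult_right_mono) auto
      then have "- (real n * (a * - ln \<kappa> + \<epsilon>)) \<le> real m * ln \<kappa> - ln ?d" using elim(2) by (simp add: algebra_simps)
      then have "exp (- (real n * (a * - ln \<kappa> + \<epsilon>))) \<le> exp (real m * ln \<kappa> - ln ?d)" by simp
      also have "\<dots> = \<kappa> ^ m / ?d" using \<kappa> by (simp add: exp_diff exp_of_nat_mult)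
      finally have "exp (- (real n * (a * - ln \<kappa> + \<epsilon>))) \<le> pos_prob \<omega> m \<lfloor>u * real n\<rfloor> i \<lfloor>(u + a) * real n\<rfloor> j"
        using j mm by simp
      moreover have "\<bar>real m - real n * a\<bar> \<le> real n * \<epsilon>" using m elim(1) by (simp add: abs_le_iff mult.commute)
      ultimately show "\<exists>t j. \<bar>real t - real n * a\<bar> \<le> real n * \<epsilon> \<and>
        exp (- (real n * (a * - ln \<kappa> + \<epsilon>))) \<le> pos_prob \<omega> t \<lfloor>u * real n\<rfloor> i \<lfloor>(u + a) * real n\<rfloor> j" by blast
    qed
  qed
qed

text \<open>Chernoff bounds at \<open>lam + \<delta>\<close> and \<open>lam - \<delta>\<close> confine the law tilted by \<open>exp (lam * t)\<close>
  to the window.\<close>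
lemma tilted_window:
  fixes \<omega> :: "('d::finite) env" and \<delta> t1 t2 :: real
  assumes we: "walk_env \<omega>" and gf: "gf_finite \<omega> (lam + \<delta>)" and \<delta>: "0 \<le> \<delta>" and xz: "x \<le> z"
    and pos: "0 < hit_mgf \<omega> lam x z i"
    and up: "exp (- \<delta> * t2) * hit_mgf \<omega> (lam + \<delta>) x z i \<le> hit_mgf \<omega> lam x z i / 3"
    and lo: "exp (\<delta> * t1) * hit_mgf \<omega> (lam - \<delta>) x z i \<le> hit_mgf \<omega> lam x z i / 3"
    and t2: "0 \<le> t2"
  shows "\<exists>t j. t1 \<le> real t \<and> real t \<le> t2 \<and>
    hit_mgf \<omega> lam x z i / (3 * (t2 + 1) * real CARD('d)) \<le> exp (lam * real t) * hit_prob \<omega> z t x i j"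
proof -
  let ?A = "hit_mgf \<omega> lam x z i"
  define p where "p t = (\<Sum>j\<in>UNIV. hit_prob \<omega> z t x i j)" for t
  have p0: "0 \<le> p t" for t unfolding p_def by (intro sum_nonneg hit_prob_nonneg we)
  define W where "W = {t::nat. t1 \<le> real t \<and> real t \<le> t2}"
  have sub: "W \<subseteq> {..nat \<lfloor>t2\<rfloor>}" unfolding W_def by (auto simp: le_nat_iff le_floor_iff)
  then have fin: "finite W" by (rule finite_subset) simp
  have "card W \<le> nat \<lfloor>t2\<rfloor> + 1" using card_mono[OF _ sub] by simp
  then have cW: "real (card W) \<le> t2 + 1" using t2 by linarith
  have s: "(\<lambda>t. exp (l * real t) * p t) sums hit_mgf \<omega> l x z i" if "l \<le> lam + \<delta>" for l
    unfolding p_def by (rule hit_mgf_sums[OF we gf_finite_mono[OF we gf that] xz])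
  let ?R = "\<lambda>t. (if t \<in> W then exp (lam * real t) * p t else 0)
     + exp (- \<delta> * t2) * (exp ((lam + \<delta>) * real t) * p t) + exp (\<delta> * t1) * (exp ((lam - \<delta>) * real t) * p t)"
  have R: "?R sums ((\<Sum>t\<in>W. exp (lam * real t) * p t) + exp (- \<delta> * t2) * hit_mgf \<omega> (lam + \<delta>) x z i
     + exp (\<delta> * t1) * hit_mgf \<omega> (lam - \<delta>) x z i)"
    using \<delta> by (intro sums_add sums_mult s sums_If_finite_set fin) auto
  have A: "(\<lambda>t. exp (lam * real t) * p t) sums ?A" by (rule s) (use \<delta> in simp)
  have AR: "exp (lam * real t) * p t \<le> ?R t" for t
  proof (cases "t \<in> W")
    case True then show ?thesis using p0[of t] by simp
  next
    case False
    then consider "t2 < real t" | "real t < t1" by (auto simp: W_def)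
    then show ?thesis
    proof cases
      case 1
      have "\<delta> * t2 \<le> \<delta> * real t" using 1 \<delta> by (intro mult_left_mono) auto
      then have "exp (lam * real t) \<le> exp (- \<delta> * t2) * exp ((lam + \<delta>) * real t)"
        by (simp add: exp_add[symmetric] algebra_simps)
      then have "exp (lam * real t) * p t \<le> exp (- \<delta> * t2) * exp ((lam + \<delta>) * real t) * p t"
        by (rule mult_right_mono[OF _ p0])
      moreover have "0 \<le> exp (\<delta> * t1) * (exp ((lam - \<delta>) * real t) * p t)" using p0 by simp
      ultimately show ?thesis using False by (simp only: if_False mult.assoc)
    next
      case 2
      have "\<delta> * real t \<le> \<delta> * t1" using 2 \<delta> by (intro mult_left_mono) auto
      then have "exp (lam * real t) \<le> exp (\<delta> * t1) * exp ((lam - \<delta>) * real t)"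
        by (simp add: exp_add[symmetric] algebra_simps)
      then have "exp (lam * real t) * p t \<le> exp (\<delta> * t1) * exp ((lam - \<delta>) * real t) * p t"
        by (rule mult_right_mono[OF _ p0])
      moreover have "0 \<le> exp (- \<delta> * t2) * (exp ((lam + \<delta>) * real t) * p t)" using p0 by simp
      ultimately show ?thesis using False by (simp only: if_False mult.assoc)
    qed
  qed
  have "?A \<le> (\<Sum>t\<in>W. exp (lam * real t) * p t) + exp (- \<delta> * t2) * hit_mgf \<omega> (lam + \<delta>) x z i
     + exp (\<delta> * t1) * hit_mgf \<omega> (lam - \<delta>) x z i"
    by (rule sums_le[OF AR A R])
  then have third: "?A / 3 \<le> (\<Sum>t\<in>W. exp (lam * real t) * p t)" using up lo by simp
  \<comment> \<open>Pigeonhole over the at most \<open>t2 + 1\<close> times of the window; a second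
    average then selects the state \<open>j\<close>.\<close>
  have "\<exists>t\<in>W. ?A / (3 * (t2 + 1)) \<le> exp (lam * real t) * p t"
  proof (rule ccontr)
    assume no: "\<not> ?thesis"
    have "W \<noteq> {}" using third pos by auto
    then have "(\<Sum>t\<in>W. exp (lam * real t) * p t) < (\<Sum>t\<in>W. ?A / (3 * (t2 + 1)))"
      using no fin by (intro sum_strict_mono) (auto simp: not_le)
    also have "\<dots> = real (card W) * (?A / (3 * (t2 + 1)))" by simp
    also have "\<dots> \<le> (t2 + 1) * (?A / (3 * (t2 + 1)))" using cW pos t2 by (intro mult_right_mono) auto
    also have "\<dots> = ?A / 3" using t2 by (simp add: field_simps)
    finally show False using third by simp
  qed
  then obtain t where t: "t \<in> W" "?A / (3 * (t2 + 1)) \<le> exp (lam * real t) * p t" by blast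
  have "?A / (3 * (t2 + 1)) \<le> (\<Sum>j\<in>UNIV. exp (lam * real t) * hit_prob \<omega> z t x i j)"
    using t(2) by (simp add: p_def sum_distrib_left)
  from exists_ge_average[OF this] obtain j where
    "?A / (3 * (t2 + 1)) / real CARD('d) \<le> exp (lam * real t) * hit_prob \<omega> z t x i j" by blast
  then show ?thesis using t(1) unfolding W_def by (intro exI[of _ t] exI[of _ j]) auto
qed

text \<open>A subgradient selection is monotone, and \<open>f\<close> is differentiable where it is continuous.\<close>
lemma convex_differentiable_dense:
  fixes f :: "real \<Rightarrow> real"
  assumes cf: "convex_on I f" and ab: "a < b" and sub: "{a<..<b} \<subseteq> I"
  shows "\<exists>x D. a < x \<and> x < b \<and> (f has_field_derivative D) (at x)"
proof -
  let ?A = "{a<..<b}"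
  have cA: "convex_on ?A f" by (rule convex_on_subset[OF cf sub]) (simp add: convex_real_interval)
  define g where "g x = Inf ((\<lambda>t. (f x - f t) / (x - t)) ` ({x<..} \<inter> ?A))" for x
  have sg: "f x + g x * (y - x) \<le> f y" if "x \<in> ?A" "y \<in> ?A" for x y
    unfolding g_def by (rule convex_le_Inf_differential[OF cA]) (use that in auto)
  have "mono_on ?A g"
  proof (rule mono_onI)
    fix x y assume xy: "x \<in> ?A" "y \<in> ?A" "x \<le> y"
    show "g x \<le> g y"
    proof (cases "x = y")
      case False
      have "(g x - g y) * (y - x) \<le> 0"
        using sg[OF xy(1,2)] sg[OF xy(2,1)] by (simp add: algebra_simps)
      then show ?thesis using False xy(3) by (simp add: mult_le_0_iff)
    qed simp
  qed
  then have "countable {x \<in> ?A. \<not> isCont g x}" by (rule mono_on_ctble_discont_open[rotated]) simp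
  moreover have "uncountable ?A" using ab by (simp add: uncountable_open_interval)
  ultimately have "\<not> ?A \<subseteq> {x \<in> ?A. \<not> isCont g x}" using countable_subset by blast
  then obtain x where x: "x \<in> ?A" "isCont g x" by blast
  have "(\<lambda>y. (f y - f x) / (y - x) - g x) \<midarrow>x\<rightarrow> 0"
  proof (rule Lim_null_comparison)
    show "(\<lambda>y. norm (g y - g x)) \<midarrow>x\<rightarrow> 0"
      by (rule tendsto_norm_zero[OF LIM_zero[OF x(2)[unfolded isCont_def]]])
    have "\<forall>\<^sub>F y in at x. y \<in> ?A" using x(1) by (intro eventually_at_in_open') auto
    moreover have "\<forall>\<^sub>F y in at x. y \<noteq> x" by (simp add: eventually_at_filter)
    ultimately show "\<forall>\<^sub>F y in at x. norm ((f y - f x) / (y - x) - g x) \<le> norm (g y - g x)"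
    proof eventually_elim
      case (elim y)
      have 1: "0 \<le> (f y - f x) - g x * (y - x)" using sg[OF x(1) elim(1)] by simp
      have 2: "(f y - f x) - g x * (y - x) \<le> (g y - g x) * (y - x)"
        using sg[OF elim(1) x(1)] by (simp add: algebra_simps)
      have "norm ((f y - f x) / (y - x) - g x) = \<bar>(f y - f x) - g x * (y - x)\<bar> / \<bar>y - x\<bar>"
        using elim(2) by (simp add: abs_divide[symmetric] diff_divide_distrib)
      also have "\<dots> \<le> \<bar>(g y - g x) * (y - x)\<bar> / \<bar>y - x\<bar>"
        using 1 2 by (intro divide_right_mono) auto
      also have "\<dots> = norm (g y - g x)" using elim(2) by (simp add: abs_mult)
      finally show ?case .
    qed
  qed
  then have "(f has_field_derivative g x) (at x)"
    unfolding has_field_derivative_iff by (rule LIM_zero_cancel)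
  then show ?thesis using x(1) by auto
qed

section \<open>Typical environments and tilted crossings\<close>

context elliptic_ergodic_env
begin

text \<open>One event must serve uncountably many velocities, so the limit is required for all real
  \<open>lam\<close> below \<open>lcrit\<close> simultaneously; at \<open>lcrit\<close> itself only
  finiteness is recorded.\<close>

definition good_env :: "'d env \<Rightarrow> bool" where
  "good_env \<omega> \<longleftrightarrow> elliptic_env \<kappa> \<omega> \<and> gf_finite \<omega> lcrit \<and> (\<forall>lam>lcrit. \<not> gf_finite \<omega> lam) \<and>
     (\<forall>lam<lcrit. \<forall>i. (\<lambda>n. ln (hit_mgf \<omega> lam 0 (int n) i) / real n) \<longlonglongrightarrow> Lam lam)"

lemma Lam_continuous:
  assumes "lam < lcrit" shows "isCont Lam lam"
proof -
  have "convex_on {..<lcrit} Lam" by (rule convex_on_subset[OF Lam_convex]) (auto simp: convex_real_interval)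
  then have "continuous_on {..<lcrit} Lam" by (rule convex_on_continuous[rotated]) simp
  then show ?thesis using assms by (simp add: continuous_on_eq_continuous_at)
qed

text \<open>Rational parameters are typical at once; since \<open>hit_mgf\<close> increases in
  \<open>lam\<close> and the convex \<open>Lam\<close> is continuous below \<open>lcrit\<close>,
  they squeeze all other parameters.\<close>

lemma AE_good_env: "AE \<omega> in \<eta>. good_env \<omega>"
proof -
  have "AE \<omega> in \<eta>. \<forall>m::nat. \<not> gf_finite \<omega> (lcrit + 1 / real (Suc m))"
    unfolding AE_all_countable by (intro allI AE_not_gf_finite) simp
  moreover have "AE \<omega> in \<eta>. \<forall>r::rat. of_rat r < lcrit \<longrightarrow>
      (\<forall>i. (\<lambda>n. ln (hit_mgf \<omega> (of_rat r) 0 (int n) i) / real n) \<longlonglongrightarrow> Lam (of_rat r))"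
    unfolding AE_all_countable
  proof
    fix r :: rat
    show "AE \<omega> in \<eta>. of_rat r < lcrit \<longrightarrow>
      (\<forall>i. (\<lambda>n. ln (hit_mgf \<omega> (of_rat r) 0 (int n) i) / real n) \<longlonglongrightarrow> Lam (of_rat r))"
    proof (cases "of_rat r < lcrit")
      case True
      then have "AE \<omega> in \<eta>. \<forall>i. (\<lambda>n. ln (hit_mgf \<omega> (of_rat r) 0 (int n) i) / real n) \<longlonglongrightarrow> Lam (of_rat r)"
        by (intro AE_log_mgf_limit) simp
      then show ?thesis by eventually_elim simp
    qed simp
  qed
  ultimately show ?thesis using ell AE_gf_finite[OF order_refl]
  proof eventually_elim
    case (elim \<omega>)
    have we: "walk_env \<omega>" by (rule elliptic_env_walk_env[OF elim(3)])
    have "\<not> gf_finite \<omega> lam" if lam: "lcrit < lam" for lam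
    proof
      assume gf: "gf_finite \<omega> lam"
      obtain m where "1 / real (Suc m) < lam - lcrit" using nat_approx_posE[of "lam - lcrit"] lam by auto
      then have "gf_finite \<omega> (lcrit + 1 / real (Suc m))" by (intro gf_finite_mono[OF we gf]) simp
      then show False using elim(1) by simp
    qed
    moreover have "(\<lambda>n. ln (hit_mgf \<omega> lam 0 (int n) i) / real n) \<longlonglongrightarrow> Lam lam" if lam: "lam < lcrit" for lam i
    proof -
      let ?h = "\<lambda>l n. ln (hit_mgf \<omega> l 0 (int n) i) / real n"
      have w: "walk_gf \<omega> l (gf_const c N l)" if "l \<le> lcrit" for l
        by (rule walk_gfI[OF crossing elim(3) c gf_finite_mono[OF we elim(4) that]])
      have mono: "?h l n \<le> ?h l' n" if "l \<le> l'" "l' \<le> lcrit" for l l' n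
      proof -
        have "l \<le> lcrit" using that by simp
        then show ?thesis
          by (intro divide_right_mono ln_mono hit_mgf_mono walk_gf.hit_mgf_pos[OF w] we walk_gf.gf[OF w] that) simp_all
      qed
      show ?thesis
      proof (rule order_tendstoI)
        fix a assume a: "a < Lam lam"
        have "\<forall>\<^sub>F l in at lam. a < Lam l" using Lam_continuous[OF lam] a by (simp add: isCont_def order_tendstoD)
        then obtain d where d: "0 < d" "\<And>l. l \<noteq> lam \<Longrightarrow> dist l lam < d \<Longrightarrow> a < Lam l" by (auto simp: eventually_at)
        obtain r where r: "lam - d < of_rat r" "of_rat r < lam" using of_rat_dense[of "lam - d" lam] d by auto
        have "a < Lam (of_rat r)" using r by (intro d(2)) (auto simp: dist_real_def)
        moreover have "?h (of_rat r) \<longlonglongrightarrow> Lam (of_rat r)" using elim(2) r lam by simp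
        ultimately have "\<forall>\<^sub>F n in sequentially. a < ?h (of_rat r) n" by (simp add: order_tendstoD)
        then show "\<forall>\<^sub>F n in sequentially. a < ?h lam n"
        proof eventually_elim
          case (elim n)
          have "?h (of_rat r) n \<le> ?h lam n" using r lam by (intro mono) simp_all
          then show ?case using elim by linarith
        qed
      next
        fix a assume a: "Lam lam < a"
        have "\<forall>\<^sub>F l in at lam. Lam l < a" using Lam_continuous[OF lam] a by (simp add: isCont_def order_tendstoD)
        then obtain d where d: "0 < d" "\<And>l. l \<noteq> lam \<Longrightarrow> dist l lam < d \<Longrightarrow> Lam l < a" by (auto simp: eventually_at)
        obtain r where r: "lam < of_rat r" "of_rat r < min (lam + d) lcrit"
          using of_rat_dense[of lam "min (lam + d) lcrit"] d lam by auto
        have "Lam (of_rat r) < a" using r by (intro d(2)) (auto simp: dist_real_def)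
        moreover have "?h (of_rat r) \<longlonglongrightarrow> Lam (of_rat r)" using elim(2) r by simp
        ultimately have "\<forall>\<^sub>F n in sequentially. ?h (of_rat r) n < a" by (simp add: order_tendstoD)
        then show "\<forall>\<^sub>F n in sequentially. ?h lam n < a"
        proof eventually_elim
          case (elim n)
          have "?h lam n \<le> ?h (of_rat r) n" using r by (intro mono) simp_all
          then show ?case using elim by linarith
        qed
      qed
    qed
    ultimately show ?case using elim(3,4) by (simp add: good_env_def)
  qed
qed

lemma good_env_elliptic: "good_env \<omega> \<Longrightarrow> elliptic_env \<kappa> \<omega>"
  by (simp add: good_env_def)

lemma good_env_walk_gf:
  assumes "good_env \<omega>" "lam \<le> lcrit" shows "walk_gf \<omega> lam (gf_const c N lam)"
proof -
  have "elliptic_env \<kappa> \<omega>" "gf_finite \<omega> lcrit" using assms(1) by (simp_all add: good_env_def)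
  then show ?thesis
    by (intro walk_gfI[OF crossing _ c] gf_finite_mono[OF elliptic_env_walk_env _ assms(2)])
qed

text \<open>The finitely many early \<open>m\<close> are absorbed in \<open>K\<close>, which gives
  one estimate valid for every length and state.\<close>

lemma log_mgf_linear:
  assumes good: "good_env \<omega>" and lam: "lam < lcrit" and e: "0 < e"
  shows "\<exists>K. \<forall>m i. \<bar>ln (hit_mgf \<omega> lam 0 (int m) i) - real m * Lam lam\<bar> \<le> e * real m + K"
proof -
  let ?D = "\<lambda>i m. \<bar>ln (hit_mgf \<omega> lam 0 (int m) i) - real m * Lam lam\<bar>"
  have "\<exists>M. \<forall>m\<ge>M. ?D i m \<le> e * real m" for i
  proof -
    have "(\<lambda>n. ln (hit_mgf \<omega> lam 0 (int n) i) / real n) \<longlonglongrightarrow> Lam lam"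
      using good lam by (simp add: good_env_def)
    then obtain M where M: "\<And>n. M \<le> n \<Longrightarrow> \<bar>ln (hit_mgf \<omega> lam 0 (int n) i) / real n - Lam lam\<bar> < e"
      using e unfolding LIMSEQ_def dist_real_def by blast
    have "?D i m \<le> e * real m" if "Suc M \<le> m" for m
    proof -
      have m: "0 < real m" using that by simp
      have "ln (hit_mgf \<omega> lam 0 (int m) i) - real m * Lam lam
          = (ln (hit_mgf \<omega> lam 0 (int m) i) / real m - Lam lam) * real m"
        using m by (simp add: left_diff_distrib)
      then have "?D i m = \<bar>ln (hit_mgf \<omega> lam 0 (int m) i) / real m - Lam lam\<bar> * real m"
        by (simp add: abs_mult)
      also have "\<dots> \<le> e * real m" using M[of m] that m by (intro mult_right_mono) auto
      finally show ?thesis .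
    qed
    then show ?thesis by blast
  qed
  then have "\<forall>i. \<exists>M. \<forall>m\<ge>M. ?D i m \<le> e * real m" by blast
  then obtain M where M: "\<And>i m. M i \<le> m \<Longrightarrow> ?D i m \<le> e * real m" by metis
  define K where "K = (\<Sum>i\<in>UNIV. \<Sum>m\<le>M i. ?D i m)"
  have K0: "0 \<le> (\<Sum>m\<le>M i. ?D i m)" for i by (intro sum_nonneg) auto
  have "?D i m \<le> e * real m + K" for i m
  proof (cases "M i \<le> m")
    case True
    have "0 \<le> K" unfolding K_def by (intro sum_nonneg K0)
    then show ?thesis using M[OF True] by linarith
  next
    case False
    have "?D i m \<le> (\<Sum>m\<le>M i. ?D i m)" using False by (intro member_le_sum) auto
    also have "\<dots> \<le> K" unfolding K_def by (rule member_le_sum[of i]) (auto simp: K0)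
    finally have "?D i m \<le> K" .
    moreover have "0 \<le> e * real m" using e by simp
    ultimately show ?thesis by linarith
  qed
  then show ?thesis by blast
qed

text \<open>Up to \<open>B\<^sup>2\<close> a block is the quotient of two crossings from 0. The
  error grows with the far end \<open>b\<close> and not with \<open>b - a\<close>, as the limits are
  anchored at the origin; for ends of order \<open>n\<close> this suffices.\<close>

lemma log_mgf_block:
  assumes good: "good_env \<omega>" and lam: "lam < lcrit" and e: "0 < e"
  shows "\<exists>K. \<forall>a b i. a \<le> b \<longrightarrow>
    \<bar>ln (hit_mgf \<omega> lam (int a) (int b) i) - (real b - real a) * Lam lam\<bar> \<le> e * real b + K"
proof -
  interpret walk_gf \<omega> lam "gf_const c N lam" using good lam by (intro good_env_walk_gf) simp_all
  let ?B = "gf_const c N lam"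
  obtain K where K: "\<And>m i. \<bar>ln (hit_mgf \<omega> lam 0 (int m) i) - real m * Lam lam\<bar> \<le> e / 2 * real m + K"
    using log_mgf_linear[OF good lam, of "e / 2"] e by auto
  have "\<bar>ln (hit_mgf \<omega> lam (int a) (int b) i) - (real b - real a) * Lam lam\<bar> \<le> e * real b + (2 * K + 2 * ln ?B)"
    if ab: "a \<le> b" for a b i
  proof -
    let ?u = "hit_mgf \<omega> lam 0 (int a) i" and ?v = "hit_mgf \<omega> lam (int a) (int b) i" and ?w = "hit_mgf \<omega> lam 0 (int b) i"
    have pos: "0 < ?u" "0 < ?v" "0 < ?w" using ab by (auto intro: hit_mgf_pos)
    have "?w \<le> ?B\<^sup>2 * (?u * ?v)" using ab by (intro hit_mgf_split_upper) auto
    then have "ln ?w \<le> ln (?B\<^sup>2 * (?u * ?v))" using pos by (intro ln_mono) auto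
    also have "\<dots> = 2 * ln ?B + ln ?u + ln ?v" using pos B1 by (simp add: ln_mult ln_realpow)
    finally have 1: "ln ?w \<le> 2 * ln ?B + ln ?u + ln ?v" .
    have "?u * ?v \<le> ?B\<^sup>2 * ?w" using ab by (intro hit_mgf_split_lower) auto
    then have "ln (?u * ?v) \<le> ln (?B\<^sup>2 * ?w)" using pos by (intro ln_mono) auto
    then have 2: "ln ?u + ln ?v \<le> 2 * ln ?B + ln ?w" using pos B1 by (simp add: ln_mult ln_realpow)
    have "e / 2 * real a + e / 2 * real b \<le> e * real b" using ab e by (simp add: field_simps)
    moreover have "\<bar>ln ?v - (real b - real a) * Lam lam\<bar> \<le> 2 * ln ?B + \<bar>ln ?u - real a * Lam lam\<bar> + \<bar>ln ?w - real b * Lam lam\<bar>"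
      using 1 2 unfolding left_diff_distrib by linarith
    ultimately show ?thesis using K[of a i] K[of b i] by linarith
  qed
  then show ?thesis by blast
qed

lemma Lam_deriv_nonneg:
  assumes "lam < lcrit" "(Lam has_field_derivative \<tau>) (at lam)" shows "0 \<le> \<tau>"
proof (rule ccontr)
  assume "\<not> 0 \<le> \<tau>"
  then obtain d where d: "0 < d" "\<And>h. 0 < h \<Longrightarrow> h < d \<Longrightarrow> Lam (lam + h) < Lam lam"
    using DERIV_neg_dec_right[OF assms(2)] by auto
  define h where "h = min (d / 2) (lcrit - lam)"
  have "0 < h" "h < d" "lam + h \<le> lcrit" using d assms(1) by (auto simp: h_def)
  then show False using d(2)[of h] Lam_mono[of lam "lam + h"] by simp
qed

text \<open>Under the tilt by \<open>lam\<close> a level takes time about \<tau>: differentiability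
  makes the Chernoff bounds at \<open>lam + \<delta>\<close> and \<open>lam - \<delta>\<close>
  effective on both sides. Removing the tilt costs \<open>lam * \<tau>\<close> per level, and the
  normalisation returns \<open>Lam lam\<close>.\<close>

lemma attainable_tilt:
  assumes good: "good_env \<omega>" and lam: "lam < lcrit" and D: "(Lam has_field_derivative \<tau>) (at lam)"
    and u: "0 \<le> u" and a: "0 < a"
  shows "attainable \<omega> u a (a * \<tau>) (a * (lam * \<tau> - Lam lam))"
  unfolding attainable_def
proof (intro allI impI)
  fix \<epsilon> :: real assume eps: "0 < \<epsilon>"
  let ?d = "real CARD('d)"
  have we: "walk_env \<omega>" by (rule elliptic_env_walk_env[OF good_env_elliptic[OF good]])
  have \<tau>: "0 \<le> \<tau>" by (rule Lam_deriv_nonneg[OF lam D])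
  \<comment> \<open>Half width of the time window per unit \<open>n\<close>: at most \<epsilon>, and
    so small that \<open>lam * t\<close> varies by at most
    \<open>n * \<epsilon> / 4\<close>.\<close>
  define w where "w = min \<epsilon> (\<epsilon> / (4 * (\<bar>lam\<bar> + 1)))"
  have w: "0 < w" "w \<le> \<epsilon>" using eps by (auto simp: w_def)
  have lw: "\<bar>lam\<bar> * w \<le> \<epsilon> / 4"
  proof -
    have "\<bar>lam\<bar> * w \<le> (\<bar>lam\<bar> + 1) * (\<epsilon> / (4 * (\<bar>lam\<bar> + 1)))"
      using w by (intro mult_mono) (auto simp: w_def)
    also have "\<dots> = \<epsilon> / 4" by (simp add: field_simps)
    finally show ?thesis .
  qed
  \<comment> \<open>Tolerance in the difference quotient; over about \<open>a * n\<close> levels it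
    uses up half of the Chernoff gain \<open>n * \<delta> * w\<close>.\<close>
  define g where "g = w / (2 * a)"
  have g: "0 < g" "a * g = w / 2" using w a by (auto simp: g_def)
  have "\<forall>\<^sub>F h in at 0. \<bar>(Lam (lam + h) - Lam lam) / h - \<tau>\<bar> < g"
    using tendstoD[OF D[unfolded DERIV_def] g(1)] by (simp add: dist_real_def)
  then obtain r where r: "0 < r" "\<And>h. h \<noteq> 0 \<Longrightarrow> \<bar>h\<bar> < r \<Longrightarrow> \<bar>(Lam (lam + h) - Lam lam) / h - \<tau>\<bar> < g"
    by (auto simp: eventually_at)
  have lin: "Lam (lam + h) - Lam lam \<le> h * \<tau> + \<bar>h\<bar> * g" if "h \<noteq> 0" "\<bar>h\<bar> < r" for h
  proof -
    have "Lam (lam + h) - Lam lam - h * \<tau> = h * ((Lam (lam + h) - Lam lam) / h - \<tau>)" using that(1) by (simp add: field_simps)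
    also have "\<dots> \<le> \<bar>h\<bar> * \<bar>(Lam (lam + h) - Lam lam) / h - \<tau>\<bar>" by (metis abs_ge_self abs_mult)
    also have "\<dots> \<le> \<bar>h\<bar> * g" using r(2)[OF that] by (intro mult_left_mono) auto
    finally show ?thesis by simp
  qed
  define \<delta> where "\<delta> = min (r / 2) ((lcrit - lam) / 2)"
  have \<delta>: "0 < \<delta>" "\<delta> < r" "lam + \<delta> < lcrit" using r(1) lam by (auto simp: \<delta>_def min_def field_simps)
  have Lp: "Lam (lam + \<delta>) - Lam lam \<le> \<delta> * \<tau> + \<delta> * g" using lin[of \<delta>] \<delta> by simp
  have Lm: "Lam (lam - \<delta>) - Lam lam \<le> - (\<delta> * \<tau>) + \<delta> * g" using lin[of "- \<delta>"] \<delta> by simp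
  define v where "v = u + a"
  have v: "0 < v" using u a by (simp add: v_def)
  \<comment> \<open>Block errors enter a quotient twice, each time at most
    \<open>n * \<delta> * w / 8\<close>; a quarter of the gain remains for the constants
    \<open>C1\<close>.\<close>
  define e where "e = min (\<delta> * w / (8 * v)) (\<epsilon> / (8 * v))"
  have e: "0 < e" "e * v \<le> \<delta> * w / 8" "e * v \<le> \<epsilon> / 8" using \<delta> w v eps by (auto simp: e_def field_simps min_def)
  have lmm: "lam - \<delta> < lcrit" using lam \<delta> by simp
  obtain K0 where K0: "\<And>x z i. x \<le> z \<Longrightarrow> \<bar>ln (hit_mgf \<omega> lam (int x) (int z) i) - (real z - real x) * Lam lam\<bar> \<le> e * real z + K0"
    using log_mgf_block[OF good lam e(1)] by blast
  obtain Kp where Kp: "\<And>x z i. x \<le> z \<Longrightarrow> \<bar>ln (hit_mgf \<omega> (lam + \<delta>) (int x) (int z) i) - (real z - real x) * Lam (lam + \<delta>)\<bar> \<le> e * real z + Kp"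
    using log_mgf_block[OF good \<delta>(3) e(1)] by blast
  obtain Km where Km: "\<And>x z i. x \<le> z \<Longrightarrow> \<bar>ln (hit_mgf \<omega> (lam - \<delta>) (int x) (int z) i) - (real z - real x) * Lam (lam - \<delta>)\<bar> \<le> e * real z + Km"
    using log_mgf_block[OF good lmm e(1)] by blast
  interpret m0: walk_gf \<omega> lam "gf_const c N lam" using good lam by (intro good_env_walk_gf) simp_all
  interpret mp: walk_gf \<omega> "lam + \<delta>" "gf_const c N (lam + \<delta>)" using good \<delta> by (intro good_env_walk_gf) simp_all
  interpret mm: walk_gf \<omega> "lam - \<delta>" "gf_const c N (lam - \<delta>)" using good lmm by (intro good_env_walk_gf) simp_all
  \<comment> \<open>The pigeonhole loses a factor linear in \<open>n\<close>. Its logarithm is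
    bounded through \<open>ln (q * ?C) \<le> q * ?C - 1\<close>, and this \<open>q\<close> makes the
    growth at most \<epsilon> / 8 per unit \<open>n\<close>.\<close>
  define q where "q = \<epsilon> / (8 * (3 * ?d * (a * \<tau> + w + 1)))"
  have d0: "0 < ?d" by simp
  have s0: "0 < a * \<tau> + w + 1" using a \<tau> w by (simp add: add_nonneg_pos)
  have s1: "0 < 3 * ?d * (a * \<tau> + w + 1)" using d0 s0 by (intro mult_pos_pos) simp_all
  have q0: "\<epsilon> / (8 * s) * s = \<epsilon> / 8" if "0 < s" for s using that by simp
  have q: "0 < q" "q * (3 * ?d * (a * \<tau> + w + 1)) = \<epsilon> / 8"
    unfolding q_def using eps s1 q0[OF s1] by (auto intro!: divide_pos_pos mult_pos_pos)
  have ex: "\<delta> * w / 4 > 0" "\<epsilon> / 4 > 0" using \<delta> w eps by auto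
  define C1 where "C1 = ln 3 + K0 + Kp + Km + \<bar>K0\<bar> + \<bar>Kp\<bar> + \<bar>Km\<bar> + \<delta> * \<tau> + \<delta> * g"
  define C2 where "C2 = \<bar>Lam lam\<bar> + K0 + \<epsilon> / 8 - ln q"
  show "\<forall>\<^sub>F n in sequentially. \<forall>i. \<exists>t j. \<bar>real t - real n * (a * \<tau>)\<bar> \<le> real n * \<epsilon> \<and>
     exp (- (real n * (a * (lam * \<tau> - Lam lam) + \<epsilon>))) \<le> pos_prob \<omega> t \<lfloor>u * real n\<rfloor> i \<lfloor>(u + a) * real n\<rfloor> j"
    using eventually_linear_le[OF ex(1), of C1] eventually_linear_le[OF ex(2), of C2]
  proof eventually_elim
    case (elim n)
    define x where "x = nat \<lfloor>u * real n\<rfloor>"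
    define z where "z = nat \<lfloor>(u + a) * real n\<rfloor>"
    have un: "0 \<le> u * real n" "u * real n \<le> (u + a) * real n" using u a by (auto intro: mult_right_mono)
    have x: "int x = \<lfloor>u * real n\<rfloor>" using un by (simp add: x_def)
    have z: "int z = \<lfloor>(u + a) * real n\<rfloor>" using un by (simp add: z_def)
    have xz: "x \<le> z" unfolding x_def z_def using un by (intro nat_mono floor_mono)
    have m: "a * real n - 1 \<le> real z - real x" "real z - real x \<le> a * real n + 1"
      using floor_diff_bounds[where a = a and n = n and u = u] unfolding x[symmetric] z[symmetric] by simp_all
    have ez: "e * real z \<le> real n * (e * v)"
    proof -
      have "real z \<le> v * real n" using un unfolding v_def z_def by (simp add: of_nat_nat)
      then have "e * real z \<le> e * (v * real n)" using e by (intro mult_left_mono) auto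
      then show ?thesis by (simp add: mult_ac)
    qed
    have ez1: "e * real z \<le> real n * (\<delta> * w / 8)"
      using ez mult_left_mono[OF e(2), of "real n"] by simp
    have ez2: "e * real z \<le> real n * (\<epsilon> / 8)"
      using ez mult_left_mono[OF e(3), of "real n"] by simp
    define M where "M = real z - real x"
    have M0: "0 \<le> M" using xz by (simp add: M_def)
    define t1 where "t1 = real n * (a * \<tau> - w)"
    define t2 where "t2 = real n * (a * \<tau> + w)"
    have t20: "0 \<le> t2" unfolding t2_def using a \<tau> w by simp
    have ag: "(a * real n + 1) * (\<delta> * g) = real n * (\<delta> * w / 2) + \<delta> * g"
    proof -
      have "(a * real n + 1) * (\<delta> * g) = real n * \<delta> * (a * g) + \<delta> * g" by (simp add: algebra_simps)
      then show ?thesis by (simp add: g(2))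
    qed
    have Mg: "M * (\<delta> * g) \<le> real n * (\<delta> * w / 2) + \<delta> * g"
      unfolding ag[symmetric] using m \<delta> g by (intro mult_right_mono) (auto simp: M_def)
    have \<delta>\<tau>: "0 \<le> \<delta> * \<tau>" using \<delta> \<tau> by simp
    have up: "exp (- \<delta> * t2) * hit_mgf \<omega> (lam + \<delta>) (int x) (int z) i \<le> hit_mgf \<omega> lam (int x) (int z) i / 3" for i
    proof -
      let ?A = "hit_mgf \<omega> lam (int x) (int z) i" and ?P = "hit_mgf \<omega> (lam + \<delta>) (int x) (int z) i"
      have pos: "0 < ?A" "0 < ?P" using xz by (auto intro: m0.hit_mgf_pos mp.hit_mgf_pos)
      have "M * (Lam (lam + \<delta>) - Lam lam) \<le> M * (\<delta> * \<tau> + \<delta> * g)" using Lp M0 by (intro mult_left_mono)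
      also have "\<dots> = M * (\<delta> * \<tau>) + M * (\<delta> * g)" by (simp add: algebra_simps)
      also have "M * (\<delta> * \<tau>) \<le> (a * real n + 1) * (\<delta> * \<tau>)" using m \<delta>\<tau> by (intro mult_right_mono) (auto simp: M_def)
      finally have 1: "M * Lam (lam + \<delta>) - M * Lam lam \<le> (a * real n + 1) * (\<delta> * \<tau>) + (real n * (\<delta> * w / 2) + \<delta> * g)"
        using Mg by (simp add: right_diff_distrib)
      have "ln ?P - ln ?A \<le> M * Lam (lam + \<delta>) - M * Lam lam + 2 * (e * real z) + Kp + K0"
        using Kp[OF xz, of i] K0[OF xz, of i] unfolding M_def abs_le_iff by linarith
      then have "- \<delta> * t2 + ln ?P \<le> ln ?A - ln 3"
        using 1 ez1 elim(1) unfolding t2_def C1_def by (simp add: algebra_simps)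
      then have "exp (- \<delta> * t2 + ln ?P) \<le> exp (ln ?A - ln 3)" by simp
      then show ?thesis using pos by (simp only: exp_add exp_diff exp_ln)
    qed
    have lo: "exp (\<delta> * t1) * hit_mgf \<omega> (lam - \<delta>) (int x) (int z) i \<le> hit_mgf \<omega> lam (int x) (int z) i / 3" for i
    proof -
      let ?A = "hit_mgf \<omega> lam (int x) (int z) i" and ?P = "hit_mgf \<omega> (lam - \<delta>) (int x) (int z) i"
      have pos: "0 < ?A" "0 < ?P" using xz by (auto intro: m0.hit_mgf_pos mm.hit_mgf_pos)
      have "M * (Lam (lam - \<delta>) - Lam lam) \<le> M * (- (\<delta> * \<tau>) + \<delta> * g)" using Lm M0 by (intro mult_left_mono)
      also have "\<dots> = - (M * (\<delta> * \<tau>)) + M * (\<delta> * g)" by (simp add: algebra_simps)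
      also have "- (M * (\<delta> * \<tau>)) \<le> - ((a * real n - 1) * (\<delta> * \<tau>))"
        unfolding neg_le_iff_le using m \<delta>\<tau> by (intro mult_right_mono) (auto simp: M_def)
      finally have 1: "M * Lam (lam - \<delta>) - M * Lam lam \<le> - ((a * real n - 1) * (\<delta> * \<tau>)) + (real n * (\<delta> * w / 2) + \<delta> * g)"
        using Mg by (simp add: right_diff_distrib)
      have "ln ?P - ln ?A \<le> M * Lam (lam - \<delta>) - M * Lam lam + 2 * (e * real z) + Km + K0"
        using Km[OF xz, of i] K0[OF xz, of i] unfolding M_def abs_le_iff by linarith
      then have "\<delta> * t1 + ln ?P \<le> ln ?A - ln 3"
        using 1 ez1 elim(1) unfolding t1_def C1_def by (simp add: algebra_simps)
      then have "exp (\<delta> * t1 + ln ?P) \<le> exp (ln ?A - ln 3)" by simp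
      then show ?thesis using pos by (simp only: exp_add exp_diff exp_ln)
    qed
    show ?case
    proof
      fix i
      let ?A = "hit_mgf \<omega> lam (int x) (int z) i"
      have A: "0 < ?A" using xz by (auto intro: m0.hit_mgf_pos)
      obtain t j where t: "t1 \<le> real t" "real t \<le> t2"
        "?A / (3 * (t2 + 1) * ?d) \<le> exp (lam * real t) * hit_prob \<omega> (int z) t (int x) i j"
        using tilted_window[OF we mp.gf less_imp_le[OF \<delta>(1)] _ A up lo t20] xz by auto
      have tw: "\<bar>real t - real n * (a * \<tau>)\<bar> \<le> real n * w"
        using t(1,2) unfolding t1_def t2_def abs_le_iff by (simp add: algebra_simps)
      then have te: "\<bar>real t - real n * (a * \<tau>)\<bar> \<le> real n * \<epsilon>"
        using mult_left_mono[OF w(2), of "real n"] by simp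
      let ?C = "3 * (t2 + 1) * ?d"
      have C0: "0 < ?C" using t20 by simp
      have "ln (q * ?C) \<le> q * ?C - 1" using q C0 by (intro ln_le_minus_one) simp
      moreover have "q * ?C \<le> (real n + 1) * (\<epsilon> / 8)"
      proof -
        have "t2 + 1 \<le> (real n + 1) * (a * \<tau> + w + 1)"
          unfolding t2_def using a \<tau> w by (simp add: algebra_simps)
        then have "q * (3 * ?d) * (t2 + 1) \<le> q * (3 * ?d) * ((real n + 1) * (a * \<tau> + w + 1))"
          using q by (intro mult_left_mono) auto
        moreover have "q * ?C = q * (3 * ?d) * (t2 + 1)" by (simp only: mult_ac)
        ultimately have "q * ?C \<le> q * (3 * ?d) * ((real n + 1) * (a * \<tau> + w + 1))"
          by (rule ord_eq_le_trans[rotated])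
        also have "\<dots> = (real n + 1) * (q * (3 * ?d * (a * \<tau> + w + 1)))" by (simp add: mult_ac)
        finally show ?thesis unfolding q(2) .
      qed
      moreover have "ln (q * ?C) = ln q + ln ?C" using q(1) C0 by (rule ln_mult_pos)
      moreover have "(real n + 1) * (\<epsilon> / 8) = real n * (\<epsilon> / 8) + \<epsilon> / 8" by (simp add: algebra_simps)
      ultimately have lnC: "ln ?C \<le> real n * (\<epsilon> / 8) + \<epsilon> / 8 - ln q" by linarith
      have lt: "lam * real t \<le> real n * (a * (lam * \<tau>)) + real n * (\<epsilon> / 4)"
      proof -
        have "lam * (real t - real n * (a * \<tau>)) \<le> \<bar>lam\<bar> * \<bar>real t - real n * (a * \<tau>)\<bar>" by (metis abs_ge_self abs_mult)
        also have "\<dots> \<le> \<bar>lam\<bar> * (real n * w)" using tw by (intro mult_left_mono) auto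
        also have "\<dots> = real n * (\<bar>lam\<bar> * w)" by (simp add: mult_ac)
        also have "\<dots> \<le> real n * (\<epsilon> / 4)" using lw by (intro mult_left_mono) auto
        finally show ?thesis by (simp add: algebra_simps)
      qed
      have lA: "real n * (a * Lam lam) - \<bar>Lam lam\<bar> - real n * (\<epsilon> / 8) - K0 \<le> ln ?A"
      proof -
        have "\<bar>(M - a * real n) * Lam lam\<bar> \<le> 1 * \<bar>Lam lam\<bar>"
          unfolding abs_mult using m by (intro mult_right_mono) (auto simp: M_def abs_le_iff)
        then have "a * real n * Lam lam - \<bar>Lam lam\<bar> \<le> M * Lam lam" by (simp add: left_diff_distrib abs_le_iff)
        moreover have "M * Lam lam - e * real z - K0 \<le> ln ?A" using K0[OF xz, of i] unfolding M_def abs_le_iff by linarith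
        ultimately show ?thesis using ez2 by (simp add: mult_ac)
      qed
      have "- (real n * (a * (lam * \<tau> - Lam lam) + \<epsilon>)) \<le> ln ?A - ln ?C - lam * real t"
      proof -
        \<comment> \<open>Budget in units of \<open>n * \<epsilon>\<close>: block error 1/8, time
          window 1/4, pigeonhole 1/8, constants 1/4.\<close>
        have arith: "- (P - Q + E) \<le> h - C - T"
          if "Q - L - E / 8 - K \<le> h" "T \<le> P + E / 4" "C \<le> E / 8 + e8 - lq" "L + K + e8 - lq \<le> E / 4" "0 \<le> E"
          for P Q E h C T L K e8 lq :: real
          using that by linarith
        have E0: "0 \<le> real n * \<epsilon>" using eps by simp
        have split: "real n * (a * (lam * \<tau> - Lam lam) + \<epsilon>)
            = real n * (a * (lam * \<tau>)) - real n * (a * Lam lam) + real n * \<epsilon>"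
          by (simp add: right_diff_distrib distrib_left)
        have A: "real n * (a * Lam lam) - \<bar>Lam lam\<bar> - real n * \<epsilon> / 8 - K0 \<le> ln ?A" using lA by simp
        have T: "lam * real t \<le> real n * (a * (lam * \<tau>)) + real n * \<epsilon> / 4" using lt by simp
        have C: "ln ?C \<le> real n * \<epsilon> / 8 + \<epsilon> / 8 - ln q" using lnC by (simp only: times_divide_eq_right)
        have D: "\<bar>Lam lam\<bar> + K0 + \<epsilon> / 8 - ln q \<le> real n * \<epsilon> / 4" using elim(2) by (simp add: C2_def)
        show ?thesis unfolding split by (rule arith[OF A T C D E0])
      qed
      then have "exp (- (real n * (a * (lam * \<tau> - Lam lam) + \<epsilon>))) \<le> exp (ln ?A - ln ?C - lam * real t)" by simp
      also have "\<dots> = ?A / ?C / exp (lam * real t)" using A C0 by (simp only: exp_diff exp_ln)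
      also have "\<dots> \<le> hit_prob \<omega> (int z) t (int x) i j" 
          unfolding pos_divide_le_eq[OF exp_gt_zero] using t(3) by (simp only: mult.commute)
      also have "\<dots> \<le> pos_prob \<omega> t (int x) i (int z) j" by (rule hit_prob_le_pos_prob[OF we])
      finally have "exp (- (real n * (a * (lam * \<tau> - Lam lam) + \<epsilon>))) \<le> pos_prob \<omega> t \<lfloor>u * real n\<rfloor> i \<lfloor>(u + a) * real n\<rfloor> j"
        unfolding x z .
      then show "\<exists>t j. \<bar>real t - real n * (a * \<tau>)\<bar> \<le> real n * \<epsilon> \<and>
        exp (- (real n * (a * (lam * \<tau> - Lam lam) + \<epsilon>))) \<le> pos_prob \<omega> t \<lfloor>u * real n\<rfloor> i \<lfloor>(u + a) * real n\<rfloor> j"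
        using te by blast
    qed
  qed
qed

end

section \<open>The rate function on a half line\<close>

text \<open>The restriction to \<open>Y\<close> allows the two half lines to be estimated
  separately, one of them in the reflected environment, and glued afterwards.\<close>

definition locally_small :: "('d::finite) env \<Rightarrow> int set \<Rightarrow> real \<Rightarrow> real \<Rightarrow> bool" where
  "locally_small \<omega> Y x a \<longleftrightarrow> (\<exists>\<delta>>0. \<forall>\<^sub>F n in sequentially. \<forall>y\<in>Y. \<bar>real_of_int y - real n * x\<bar> \<le> real n * \<delta> \<longrightarrow>
     (\<forall>i j. pos_prob \<omega> n 0 i y j \<le> exp (- (real n * a))))"

text \<open>For negative \<open>x\<close> a window of half width \<open>- x / 2\<close> contains no
  nonnegative position once \<open>n > 0\<close>.\<close>

lemma locally_small_far: "x < 0 \<Longrightarrow> locally_small \<omega> {0..} x a"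
  unfolding locally_small_def
proof (intro exI conjI)
  assume x: "x < 0"
  then show "0 < - x / 2" by simp
  show "\<forall>\<^sub>F n in sequentially. \<forall>y\<in>{0..}. \<bar>real_of_int y - real n * x\<bar> \<le> real n * (- x / 2) \<longrightarrow>
     (\<forall>i j. pos_prob \<omega> n 0 i y j \<le> exp (- (real n * a)))"
    using eventually_gt_at_top[of "0::nat"]
  proof eventually_elim
    case (elim n)
    have "\<not> \<bar>real_of_int y - real n * x\<bar> \<le> real n * (- x / 2)" if "0 \<le> y" for y
    proof
      assume *: "\<bar>real_of_int y - real n * x\<bar> \<le> real n * (- x / 2)"
      have "real n * x < 0" using elim x by (simp add: mult_pos_neg)
      moreover have "0 \<le> real_of_int y" using that by simp
      ultimately show False using * by simp
    qed
    then show ?case by auto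
  qed
qed

lemma locally_small_reflect:
  assumes "locally_small (env_inv \<omega>) {0..} (- x) a" shows "locally_small \<omega> {..0} x a"
proof -
  obtain \<delta> where \<delta>: "0 < \<delta>" and ev: "\<forall>\<^sub>F n in sequentially. \<forall>y\<in>{0..}. \<bar>real_of_int y - real n * - x\<bar> \<le> real n * \<delta> \<longrightarrow>
      (\<forall>i j. pos_prob (env_inv \<omega>) n 0 i y j \<le> exp (- (real n * a)))"
    using assms unfolding locally_small_def by blast
  from ev have "\<forall>\<^sub>F n in sequentially. \<forall>y\<in>{..0}. \<bar>real_of_int y - real n * x\<bar> \<le> real n * \<delta> \<longrightarrow>
      (\<forall>i j. pos_prob \<omega> n 0 i y j \<le> exp (- (real n * a)))"
  proof eventually_elim
    case (elim n)
    show ?case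
    proof (intro ballI impI allI)
      fix y i j assume y: "y \<in> {..0}" "\<bar>real_of_int y - real n * x\<bar> \<le> real n * \<delta>"
      have "- y \<in> {0..}" "\<bar>real_of_int (- y) - real n * - x\<bar> \<le> real n * \<delta>" using y by auto
      then have "pos_prob (env_inv \<omega>) n 0 i (- y) j \<le> exp (- (real n * a))" using elim by blast
      then show "pos_prob \<omega> n 0 i y j \<le> exp (- (real n * a))" using pos_prob_env_inv[of \<omega> n 0 i y j] by simp
    qed
  qed
  then show ?thesis using \<delta> unfolding locally_small_def by blast
qed

lemma locally_small_Un:
  assumes "locally_small \<omega> Y x a" "locally_small \<omega> Z x a" shows "locally_small \<omega> (Y \<union> Z) x a"
proof -
  let ?P = "\<lambda>Y \<delta> n. \<forall>y\<in>Y. \<bar>real_of_int y - real n * x\<bar> \<le> real n * \<delta> \<longrightarrow>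
      (\<forall>i j. pos_prob \<omega> n 0 i y j \<le> exp (- (real n * a)))"
  obtain \<delta>1 \<delta>2 where \<delta>: "0 < \<delta>1" "eventually (?P Y \<delta>1) sequentially" "0 < \<delta>2" "eventually (?P Z \<delta>2) sequentially"
    using assms unfolding locally_small_def by blast
  have "eventually (?P (Y \<union> Z) (min \<delta>1 \<delta>2)) sequentially"
    using \<delta>(2,4)
  proof eventually_elim
    case (elim n)
    have "real n * min \<delta>1 \<delta>2 \<le> real n * \<delta>1" "real n * min \<delta>1 \<delta>2 \<le> real n * \<delta>2"
      by (rule mult_left_mono; simp)+
    then have "\<bar>real_of_int y - real n * x\<bar> \<le> real n * \<delta>1 \<and> \<bar>real_of_int y - real n * x\<bar> \<le> real n * \<delta>2"
      if "\<bar>real_of_int y - real n * x\<bar> \<le> real n * min \<delta>1 \<delta>2" for y :: int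
      using that by linarith
    then show ?case using elim by blast
  qed
  moreover have "0 < min \<delta>1 \<delta>2" using \<delta> by simp
  ultimately show ?thesis unfolding locally_small_def by blast
qed

context elliptic_ergodic_env
begin

text \<open>\<open>x * J_eta \<eta> (1 / x)\<close> with the factor drawn into the supremum, a form
  that also makes sense at \<open>x = 0\<close>. The open range of \<open>lam\<close> is the one on
  which \<open>good_env\<close> supplies limits.\<close>

definition half_rate :: "real \<Rightarrow> ereal" where
  "half_rate x = (SUP lam\<in>{..<lcrit}. ereal (lam - x * Lam lam))"

lemma half_rate_ge_less: "lam < lcrit \<Longrightarrow> ereal (lam - x * Lam lam) \<le> half_rate x"
  unfolding half_rate_def by (rule SUP_upper) simp

text \<open>Monotonicity of \<open>Lam\<close> lets \<open>lam - e\<close> replace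
  \<open>lam\<close> at a loss of \<open>e\<close>, so the supremum over the open range also
  dominates the endpoint \<open>lcrit\<close>.\<close>

lemma half_rate_ge:
  assumes lam: "lam \<le> lcrit" and x: "0 \<le> x"
  shows "ereal (lam - x * Lam lam) \<le> half_rate x"
proof (rule ereal_le_epsilon2)
  fix e :: real assume e: "0 < e"
  have "Lam (lam - e) \<le> Lam lam" using e lam by (intro Lam_mono) auto
  then have "x * Lam (lam - e) \<le> x * Lam lam" using x by (rule mult_left_mono)
  then have "ereal (lam - x * Lam lam) \<le> ereal (lam - e - x * Lam (lam - e)) + ereal e" by simp
  also have "\<dots> \<le> half_rate x + ereal e"
    using e lam by (intro add_right_mono half_rate_ge_less) simp
  finally show "ereal (lam - x * Lam lam) \<le> half_rate x + ereal e" .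
qed

lemma half_rate_0: "half_rate 0 = ereal lcrit"
proof (rule antisym)
  show "half_rate 0 \<le> ereal lcrit" unfolding half_rate_def by (rule SUP_least) simp
  show "ereal lcrit \<le> half_rate 0" using half_rate_ge[of lcrit 0] by simp
qed

lemma half_rate_nonneg: "0 \<le> x \<Longrightarrow> 0 \<le> half_rate x"
proof -
  assume x: "0 \<le> x"
  have "x * Lam 0 \<le> 0" using Lam_upper_nonpos[of 0] x by (simp add: mult_nonneg_nonpos)
  then have "ereal 0 \<le> ereal (0 - x * Lam 0)" by simp
  also have "\<dots> \<le> half_rate x" using lcrit_nonneg x by (rule half_rate_ge)
  finally show ?thesis by (simp add: zero_ereal_def)
qed

text \<open>Ellipticity gives \<open>Lam lam \<ge> lam + ln \<kappa>\<close>. The resulting bound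
  tends to \<open>lcrit\<close> as \<open>x\<close> tends to 0, which yields the upper half of the
  limit of \<open>J_eta \<eta> t / t\<close>.\<close>

lemma half_rate_le:
  assumes "0 \<le> x" "x \<le> 1" shows "half_rate x \<le> ereal ((1 - x) * lcrit - x * ln \<kappa>)"
  unfolding half_rate_def
proof (rule SUP_least)
  fix lam assume "lam \<in> {..<lcrit}"
  then have lam: "lam \<le> lcrit" by simp
  have "x * (lam + ln \<kappa>) \<le> x * Lam lam" using Lam_lower[OF lam] assms by (intro mult_left_mono)
  moreover have "(1 - x) * lam \<le> (1 - x) * lcrit" using lam assms by (intro mult_left_mono) auto
  ultimately show "ereal (lam - x * Lam lam) \<le> ereal ((1 - x) * lcrit - x * ln \<kappa>)"
    by (simp add: algebra_simps)
qed

text \<open>For \<open>lam \<le> 0\<close> one has \<open>Lam lam \<le> lam\<close>, so beyond speed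
  one \<open>lam - x * Lam lam\<close> is at least \<open>(1 - x) * lam\<close>, which is unbounded
  as \<open>lam\<close> decreases.\<close>

lemma half_rate_finite_imp_le_1:
  assumes "half_rate x \<le> ereal I" shows "x \<le> 1"
proof (rule ccontr)
  assume "\<not> x \<le> 1"
  then have x: "1 < x" by simp
  define lam where "lam = - (\<bar>I\<bar> + 1) / (x - 1)"
  have l: "lam < 0" using x by (simp add: lam_def divide_less_0_iff)
  have "(1 - x) * lam = \<bar>I\<bar> + 1" using x by (simp add: lam_def field_simps)
  moreover have "x * Lam lam \<le> x * lam" using Lam_upper_nonpos[of lam] l x by (intro mult_left_mono) auto
  ultimately have "\<bar>I\<bar> + 1 \<le> lam - x * Lam lam" by (simp add: algebra_simps)
  moreover have "ereal (lam - x * Lam lam) \<le> ereal I"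
    using half_rate_ge_less[of lam x] l lcrit_nonneg assms by (meson less_le_trans order_trans)
  ultimately show False by simp
qed

lemma J_eta_scaled:
  assumes x: "0 < x" shows "ereal x * J_eta \<eta> (1 / x) = half_rate x"
proof (rule antisym)
  have "J_eta \<eta> (1 / x) \<le> ereal (1 / x) * half_rate x"
    unfolding J_eta_def
  proof (rule SUP_least)
    fix lam
    show "ereal (lam * (1 / x)) - Lambda_eta \<eta> lam \<le> ereal (1 / x) * half_rate x"
    proof (cases "lam \<le> lcrit")
      case True
      have "ereal (lam * (1 / x)) - Lambda_eta \<eta> lam = ereal (1 / x) * ereal (lam - x * Lam lam)"
        using x by (simp add: Lambda_eta_eq[OF True] field_simps)
      also have "\<dots> \<le> ereal (1 / x) * half_rate x"
        using x by (intro ereal_mult_left_mono half_rate_ge True) auto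
      finally show ?thesis .
    next
      case False then show ?thesis by (simp add: Lambda_eta_infinite)
    qed
  qed
  then have "ereal x * J_eta \<eta> (1 / x) \<le> ereal x * (ereal (1 / x) * half_rate x)"
    using x by (intro ereal_mult_left_mono) auto
  also have "\<dots> = half_rate x" using x by (simp add: mult.assoc[symmetric])
  finally show "ereal x * J_eta \<eta> (1 / x) \<le> half_rate x" .
  show "half_rate x \<le> ereal x * J_eta \<eta> (1 / x)"
    unfolding half_rate_def
  proof (rule SUP_least)
    fix lam assume "lam \<in> {..<lcrit}"
    then have lam: "lam \<le> lcrit" by simp
    have "ereal (lam - x * Lam lam) = ereal x * (ereal (lam * (1 / x)) - Lambda_eta \<eta> lam)"
      using x by (simp add: Lambda_eta_eq[OF lam] field_simps)
    also have "\<dots> \<le> ereal x * J_eta \<eta> (1 / x)"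
      unfolding J_eta_def using x by (intro ereal_mult_left_mono SUP_upper) auto
    finally show "ereal (lam - x * Lam lam) \<le> ereal x * J_eta \<eta> (1 / x)" .
  qed
qed

lemma J_eta_div_tendsto: "((\<lambda>t. J_eta \<eta> t / ereal t) \<longlongrightarrow> ereal lcrit) at_top"
proof -
  have eq: "J_eta \<eta> t / ereal t = half_rate (1 / t)" if "0 < t" for t
    using J_eta_scaled[of "1 / t"] that by (simp add: divide_ereal_def mult.commute inverse_eq_divide)
  have inv: "((\<lambda>t::real. 1 / t) \<longlongrightarrow> 0) at_top"
    using tendsto_inverse_0_at_top[OF filterlim_ident] by (simp add: inverse_eq_divide)
  have "((\<lambda>t. half_rate (1 / t)) \<longlongrightarrow> ereal lcrit) at_top"
  proof (rule order_tendstoI)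
    fix a assume "a < ereal lcrit"
    then obtain lam where lam: "a < ereal lam" "lam < lcrit" using ereal_dense2 by (metis less_ereal.simps(1))
    have "((\<lambda>t. ereal (lam - 1 / t * Lam lam)) \<longlongrightarrow> ereal (lam - 0 * Lam lam)) at_top"
      by (intro tendsto_intros inv)
    then have "\<forall>\<^sub>F t in at_top. a < ereal (lam - 1 / t * Lam lam)" using lam by (intro order_tendstoD) auto
    then show "\<forall>\<^sub>F t in at_top. a < half_rate (1 / t)"
      by eventually_elim (use half_rate_ge_less[OF lam(2)] less_le_trans in blast)
  next
    fix a assume a: "ereal lcrit < a"
    have "((\<lambda>t. ereal ((1 - 1 / t) * lcrit - 1 / t * ln \<kappa>)) \<longlongrightarrow> ereal ((1 - 0) * lcrit - 0 * ln \<kappa>)) at_top"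
      by (intro tendsto_intros inv)
    then have "\<forall>\<^sub>F t in at_top. ereal ((1 - 1 / t) * lcrit - 1 / t * ln \<kappa>) < a" using a by (intro order_tendstoD) auto
    then show "\<forall>\<^sub>F t in at_top. half_rate (1 / t) < a"
      using eventually_ge_at_top[of "1::real"]
    proof eventually_elim
      case (elim t)
      have "half_rate (1 / t) \<le> ereal ((1 - 1 / t) * lcrit - 1 / t * ln \<kappa>)" using elim(2) by (intro half_rate_le) auto
      then show ?case using elim(1) by (rule le_less_trans)
    qed
  qed
  then show ?thesis
    by (rule Lim_transform_eventually)
      (use eventually_gt_at_top[of "0::real"] in \<open>eventually_elim, simp add: eq\<close>)
qed

text \<open>One \<open>lam\<close> for which the affine expression exceeds \<open>a\<close> at
  \<open>x\<close> works in a whole neighbourhood of \<open>x\<close>.\<close>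

lemma local_upper:
  assumes good: "good_env \<omega>" and x: "0 \<le> x" and a: "ereal a < half_rate x"
  shows "locally_small \<omega> {0..} x a"
proof -
  obtain lam where lam: "lam < lcrit" "a < lam - x * Lam lam"
    using a unfolding half_rate_def less_SUP_iff by auto
  interpret walk_gf \<omega> lam "gf_const c N lam" using good_env_walk_gf[OF good] lam by simp
  \<comment> \<open>The slack per unit \<open>n\<close>: a quarter for the distance of
    \<open>y\<close> from \<open>n * x\<close>, a quarter for the error in the limit, half for the
    constants.\<close>
  define g where "g = lam - x * Lam lam - a"
  have g: "0 < g" using lam by (simp add: g_def)
  define e where "e = g / (4 * (x + 1))"
  have e: "0 < e" "e * (x + 1) = g / 4" using g x by (auto simp: e_def field_simps)
  define \<delta> where "\<delta> = min 1 (g / (4 * (\<bar>Lam lam\<bar> + 1)))"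
  have \<delta>: "0 < \<delta>" "\<delta> \<le> 1" using g by (auto simp: \<delta>_def)
  have \<delta>L: "\<delta> * \<bar>Lam lam\<bar> \<le> g / 4"
  proof -
    have "\<delta> * \<bar>Lam lam\<bar> \<le> g / (4 * (\<bar>Lam lam\<bar> + 1)) * (\<bar>Lam lam\<bar> + 1)"
      using g \<delta> by (intro mult_mono) (auto simp: \<delta>_def)
    also have "\<dots> = g / 4" by (simp add: field_simps)
    finally show ?thesis .
  qed
  obtain K where K: "\<And>m i. \<bar>ln (hit_mgf \<omega> lam 0 (int m) i) - real m * Lam lam\<bar> \<le> e * real m + K"
    using log_mgf_linear[OF good lam(1) e(1)] by blast
  let ?B = "gf_const c N lam"
  have "\<forall>\<^sub>F n in sequentially. \<forall>y\<in>{0..}. \<bar>real_of_int y - real n * x\<bar> \<le> real n * \<delta> \<longrightarrow>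
    (\<forall>i j. pos_prob \<omega> n 0 i y j \<le> exp (- (real n * a)))"
    using eventually_linear_le[OF half_gt_zero[OF g], of "K + 2 * ln ?B"]
  proof eventually_elim
    case (elim n)
    show ?case
    proof (intro ballI allI impI)
      fix y :: int and i j
      assume "y \<in> {0..}" "\<bar>real_of_int y - real n * x\<bar> \<le> real n * \<delta>"
      then have y: "0 \<le> y" "\<bar>real_of_int y - real n * x\<bar> \<le> real n * \<delta>" by simp_all
      define m where "m = nat y"
      have m: "y = int m" "\<bar>real m - real n * x\<bar> \<le> real n * \<delta>" using y by (auto simp: m_def)
      have "exp (lam * real n) * pos_prob \<omega> n 0 i y j \<le> ?B\<^sup>2 * hit_mgf \<omega> lam 0 y i"
        by (rule pos_prob_upper_right[OF y(1)])
      also have "\<dots> = exp (2 * ln ?B + ln (hit_mgf \<omega> lam 0 (int m) i))"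
        using B1 hit_mgf_pos[of 0 y i] y by (simp add: m(1) exp_add exp_of_nat_mult[of 2, simplified])
      also have "\<dots> \<le> exp (lam * real n - real n * a)"
      proof -
        have "real m * Lam lam - real n * (x * Lam lam) = (real m - real n * x) * Lam lam" by (simp add: algebra_simps)
        also have "\<dots> \<le> \<bar>real m - real n * x\<bar> * \<bar>Lam lam\<bar>" by (metis abs_ge_self abs_mult)
        also have "\<dots> \<le> real n * \<delta> * \<bar>Lam lam\<bar>" using m by (intro mult_right_mono) auto
        also have "\<dots> \<le> real n * (g / 4)" unfolding mult.assoc using \<delta>L by (intro mult_left_mono) auto
        finally have 1: "real m * Lam lam \<le> real n * (x * Lam lam) + real n * (g / 4)" by simp
        have "real m \<le> real n * (x + 1)"
        proof -
          have "real n * \<delta> \<le> real n * 1" using \<delta> by (intro mult_left_mono) auto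
          then show ?thesis using m(2) by (simp add: algebra_simps abs_le_iff)
        qed
        then have "e * real m \<le> e * (real n * (x + 1))" using e by (intro mult_left_mono) auto
        also have "\<dots> = real n * (e * (x + 1))" by simp
        finally have 2: "e * real m \<le> real n * (g / 4)" unfolding e(2) .
        have "ln (hit_mgf \<omega> lam 0 (int m) i) \<le> real m * Lam lam + e * real m + K" using K[of m i] by (simp add: abs_le_iff)
        moreover have "2 * ln ?B + ln (hit_mgf \<omega> lam 0 (int m) i) \<le> lam * real n - real n * a"
        proof -
          have arith: "2 * b + h \<le> p - q"
            if "mL \<le> s + G / 4" "em \<le> G / 4" "K + 2 * b \<le> G / 2" "h \<le> mL + em + K" "G = p - s - q"
            for b h p q mL s G em K :: real
            using that by linarith
          show ?thesis
            by (rule arith[OF 1[unfolded times_divide_eq_right] 2[unfolded times_divide_eq_right]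
                  elim[unfolded times_divide_eq_right] \<open>ln _ \<le> real m * Lam lam + e * real m + K\<close>])
              (simp add: g_def algebra_simps)
        qed
        ultimately show ?thesis by simp
      qed
      also have "\<dots> = exp (lam * real n) * exp (- (real n * a))" by (simp add: exp_add[symmetric])
      finally show "pos_prob \<omega> n 0 i y j \<le> exp (- (real n * a))" by simp
    qed
  qed
  then show ?thesis using \<delta> unfolding locally_small_def by blast
qed

subsection \<open>Lower bound by convex duality\<close>

text \<open>Scaling by \<open>s\<close> is built in to make this a cone; all starting levels
  \<open>u\<close> are built in so that legs can be placed one after another.\<close>

definition attain_cone :: "'d env \<Rightarrow> (real \<times> real \<times> real) set" where
  "attain_cone \<omega> = {(a, \<tau>, \<gamma>). 0 \<le> a \<and>
     (\<forall>s\<ge>0. \<forall>u\<ge>0. attainable \<omega> u (s * a) (s * \<tau>) (s * \<gamma>))}"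

text \<open>Rest of duration \<open>s\<close> is added once, to be taken at the origin before any
  motion, where \<open>attainable_stay\<close> provides it at cost \<open>s * lcrit\<close>.\<close>

definition rest_cone :: "'d env \<Rightarrow> (real \<times> real \<times> real) set" where
  "rest_cone \<omega> = {(a, \<tau> + s, \<gamma> + s * lcrit) | a \<tau> \<gamma> s. (a, \<tau>, \<gamma>) \<in> attain_cone \<omega> \<and> 0 \<le> s}"

lemma rest_coneI:
  "(a, \<tau>, \<gamma>) \<in> attain_cone \<omega> \<Longrightarrow> 0 \<le> s \<Longrightarrow> (a, \<tau> + s, \<gamma> + s * lcrit) \<in> rest_cone \<omega>"
  unfolding rest_cone_def by blast

lemma attain_cone_add:
  assumes we: "walk_env \<omega>" and 1: "(a1, \<tau>1, \<gamma>1) \<in> attain_cone \<omega>" and 2: "(a2, \<tau>2, \<gamma>2) \<in> attain_cone \<omega>"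
  shows "(a1 + a2, \<tau>1 + \<tau>2, \<gamma>1 + \<gamma>2) \<in> attain_cone \<omega>"
  using 1 2 unfolding attain_cone_def
  by (auto simp: distrib_left intro!: attainable_add[OF we])

lemma attain_cone_scale:
  assumes "(a, \<tau>, \<gamma>) \<in> attain_cone \<omega>" "0 \<le> r"
  shows "(r * a, r * \<tau>, r * \<gamma>) \<in> attain_cone \<omega>"
  using assms unfolding attain_cone_def by (auto simp: mult.assoc[symmetric])

lemma rest_cone_scale:
  assumes "z \<in> rest_cone \<omega>" "0 \<le> r" shows "r *\<^sub>R z \<in> rest_cone \<omega>"
proof -
  obtain a \<tau> \<gamma> s where z: "z = (a, \<tau> + s, \<gamma> + s * lcrit)" "(a, \<tau>, \<gamma>) \<in> attain_cone \<omega>" "0 \<le> s"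
    using assms(1) unfolding rest_cone_def by blast
  have "(r * a, r * \<tau> + r * s, r * \<gamma> + r * s * lcrit) \<in> rest_cone \<omega>"
    using assms(2) z by (intro rest_coneI attain_cone_scale) auto
  then show ?thesis by (simp add: z(1) algebra_simps)
qed

lemma rest_cone_add:
  assumes we: "walk_env \<omega>" and "z \<in> rest_cone \<omega>" "z' \<in> rest_cone \<omega>" shows "z + z' \<in> rest_cone \<omega>"
proof -
  obtain a \<tau> \<gamma> s where z: "z = (a, \<tau> + s, \<gamma> + s * lcrit)" "(a, \<tau>, \<gamma>) \<in> attain_cone \<omega>" "0 \<le> s"
    using assms(2) unfolding rest_cone_def by blast
  obtain a' \<tau>' \<gamma>' s' where z': "z' = (a', \<tau>' + s', \<gamma>' + s' * lcrit)" "(a', \<tau>', \<gamma>') \<in> attain_cone \<omega>" "0 \<le> s'"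
    using assms(3) unfolding rest_cone_def by blast
  have "(a + a', (\<tau> + \<tau>') + (s + s'), (\<gamma> + \<gamma>') + (s + s') * lcrit) \<in> rest_cone \<omega>"
    using z z' by (intro rest_coneI attain_cone_add[OF we]) auto
  then show ?thesis by (simp add: z(1) z'(1) algebra_simps)
qed

lemma convex_rest_cone:
  assumes "walk_env \<omega>" shows "convex (rest_cone \<omega>)"
  unfolding convex_def by (auto intro!: rest_cone_add[OF assms] rest_cone_scale)

lemma attain_cone_0: "0 \<le> s \<Longrightarrow> (0, 0, s) \<in> attain_cone \<omega>"
  unfolding attain_cone_def by (auto intro: attainable_mono[OF attainable_zero])

lemma rest_cone_attainable:
  assumes good: "good_env \<omega>" and z: "(a, \<tau>, \<gamma>) \<in> rest_cone \<omega>"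
  shows "attainable \<omega> 0 a \<tau> \<gamma>"
proof -
  obtain \<tau>' \<gamma>' s where z: "\<tau> = \<tau>' + s" "\<gamma> = \<gamma>' + s * lcrit" "(a, \<tau>', \<gamma>') \<in> attain_cone \<omega>" "0 \<le> s"
    using z unfolding rest_cone_def by blast
  have ell: "elliptic_env \<kappa> \<omega>" by (rule good_env_elliptic[OF good])
  have "attainable \<omega> 0 0 s (s * lcrit)"
    by (rule attainable_stay[OF crossing ell c lcrit_nonneg]) (use good z in \<open>auto simp: good_env_def\<close>)
  moreover have "attainable \<omega> (0 + 0) (1 * a) (1 * \<tau>') (1 * \<gamma>')"
  proof -
    have "\<forall>s\<ge>0. \<forall>u\<ge>0. attainable \<omega> u (s * a) (s * \<tau>') (s * \<gamma>')"
      using z(3) by (simp add: attain_cone_def)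
    from this[rule_format, of 1 0] show ?thesis by simp
  qed
  ultimately have "attainable \<omega> 0 (0 + 1 * a) (s + 1 * \<tau>') (s * lcrit + 1 * \<gamma>')"
    by (rule attainable_add[OF elliptic_env_walk_env[OF ell]])
  then show ?thesis using z by (simp add: add.commute)
qed

text \<open>A separating functional with cost coefficient \<open>\<gamma> > 0\<close> has slope \<open>l = - \<beta> / \<gamma> \<le> lcrit\<close>,
  and the points attained by tilting at \<open>lam < l\<close> force \<open>\<alpha> / \<gamma> \<ge> Lam lam\<close>, which contradicts
  the definition of the rate as a supremum.\<close>
lemma rate_in_closure_rest_cone:
  assumes good: "good_env \<omega>" and x: "0 \<le> x" and I: "half_rate x = ereal I"
  shows "(x, 1, I) \<in> closure (rest_cone \<omega>)"
proof (rule ccontr)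
  let ?K = "closure (rest_cone \<omega>)"
  assume "(x, 1, I) \<notin> ?K"
  have ell: "elliptic_env \<kappa> \<omega>" by (rule good_env_elliptic[OF good])
  have we: "walk_env \<omega>" by (rule elliptic_env_walk_env[OF ell])
  have "convex ?K" by (intro convex_closure convex_rest_cone we)
  then obtain w b where w: "inner w (x, 1, I) < b" "\<And>z. z \<in> ?K \<Longrightarrow> b < inner w z"
    using separating_hyperplane_closed_point[OF _ closed_closure \<open>(x, 1, I) \<notin> ?K\<close>] by blast
  obtain \<alpha> \<beta> \<gamma> where w_eq: "w = (\<alpha>, \<beta>, \<gamma>)" by (cases w)
  have "0 \<in> rest_cone \<omega>"
    using rest_coneI[OF attain_cone_0[of 0 \<omega>], of 0] by (simp add: zero_prod_def)
  then have b: "b < 0" using w(2)[of 0] closure_subset[of "rest_cone \<omega>"] by auto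
  \<comment> \<open>On a cone a linear functional that is bounded below cannot take negative values:
    scaling would carry it down to \<open>b\<close>.\<close>
  have nn: "0 \<le> inner w z" if "z \<in> rest_cone \<omega>" for z
  proof (rule ccontr)
    assume "\<not> 0 \<le> inner w z"
    then have neg: "inner w z < 0" by simp
    then have "0 \<le> b / inner w z" using b by (simp add: divide_nonpos_neg)
    then have "(b / inner w z) *\<^sub>R z \<in> ?K" using rest_cone_scale[OF that] closure_subset by blast
    from w(2)[OF this] show False using neg by simp
  qed
  have tgt: "\<alpha> * x + \<beta> + \<gamma> * I < 0" using w(1) b by (simp add: w_eq)
  have "(0, 0 + 0, 1 + 0 * lcrit) \<in> rest_cone \<omega>" by (intro rest_coneI attain_cone_0) auto
  from nn[OF this] have \<gamma>: "0 \<le> \<gamma>" by (simp add: w_eq)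
  have "(0, 0 + 1, 0 + 1 * lcrit) \<in> rest_cone \<omega>" by (intro rest_coneI attain_cone_0) auto
  from nn[OF this] have stay: "0 \<le> \<beta> + \<gamma> * lcrit" by (simp add: w_eq)
  have "(1, 1, - ln \<kappa>) \<in> attain_cone \<omega>"
    unfolding attain_cone_def using attainable_ballistic[OF ell \<kappa>] by simp
  from nn[OF rest_coneI[OF this order_refl]] have bal: "0 \<le> \<alpha> + \<beta> - \<gamma> * ln \<kappa>" by (simp add: w_eq)
  have tilt: "0 \<le> \<alpha> + \<beta> * \<tau> + \<gamma> * (lam * \<tau> - Lam lam)"
    if "lam < lcrit" "(Lam has_field_derivative \<tau>) (at lam)" for lam \<tau>
  proof -
    have "attainable \<omega> u (s * 1) (s * \<tau>) (s * (lam * \<tau> - Lam lam))" if "0 \<le> s" "0 \<le> u" for s u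
    proof (cases "s = 0")
      case True then show ?thesis by (simp add: attainable_zero)
    next
      case False
      then have "0 < s" using that by simp
      from attainable_tilt[OF good \<open>lam < lcrit\<close> \<open>(Lam has_field_derivative \<tau>) (at lam)\<close> that(2) this]
      show ?thesis by simp
    qed
    then have "(1, \<tau>, lam * \<tau> - Lam lam) \<in> attain_cone \<omega>" unfolding attain_cone_def by simp
    from nn[OF rest_coneI[OF this order_refl]] show ?thesis by (simp add: w_eq)
  qed
  show False
  proof (cases "\<gamma> = 0")
    case True
    \<comment> \<open>Without a cost coefficient only displacement and time are seen. A finite rate
      forces \<open>x \<le> 1\<close>, so \<open>(x, 1)\<close> is a mixture of straight motion
      \<open>(1, 1)\<close> and rest \<open>(0, 1)\<close>, on both of which the functional is
      nonnegative.\<close>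
    have x1: "x \<le> 1" by (rule half_rate_finite_imp_le_1[of x I]) (use I in simp)
    have "0 \<le> x * (\<alpha> + \<beta>) + (1 - x) * \<beta>"
    proof (intro add_nonneg_nonneg)
      show "0 \<le> x * (\<alpha> + \<beta>)" "0 \<le> (1 - x) * \<beta>"
        using bal stay True x x1 by (intro mult_nonneg_nonneg; simp)+
    qed
    then show False using tgt True by (simp add: algebra_simps)
  next
    case False
    then have g: "0 < \<gamma>" using \<gamma> by simp
    define l where "l = - \<beta> / \<gamma>"
    define \<alpha>' where "\<alpha>' = \<alpha> / \<gamma>"
    have ab: "\<beta> = - (l * \<gamma>)" "\<alpha> = \<alpha>' * \<gamma>" using g by (auto simp: l_def \<alpha>'_def)
    have "0 \<le> \<gamma> * (lcrit - l)" using stay by (simp add: ab algebra_simps)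
    then have l: "l \<le> lcrit" using g by (simp add: zero_le_mult_iff)
    have "\<gamma> * (\<alpha>' * x - l + I) < 0" using tgt by (simp add: ab algebra_simps)
    then have t: "\<alpha>' * x - l + I < 0" using g by (simp add: mult_less_0_iff)
    \<comment> \<open>Half of the separation gap. A point of differentiability within
      \<open>e\<close> below \<open>l\<close> is strictly subcritical even when
      \<open>l = lcrit\<close>.\<close>
    define e where "e = (l - \<alpha>' * x - I) / 2"
    have e: "0 < e" using t by (simp add: e_def)
    have "{l - e<..<l} \<subseteq> {..lcrit}" using l by auto
    then obtain lam \<tau> where lam: "l - e < lam" "lam < l" "(Lam has_field_derivative \<tau>) (at lam)"
      using convex_differentiable_dense[OF Lam_convex, of "l - e" l] e by auto
    have lc: "lam < lcrit" using lam l by simp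
    have "0 \<le> \<gamma> * (\<alpha>' - l * \<tau> + (lam * \<tau> - Lam lam))"
      using tilt[OF lc lam(3)] by (simp add: ab algebra_simps)
    then have "0 \<le> \<alpha>' - l * \<tau> + (lam * \<tau> - Lam lam)" using g by (simp add: zero_le_mult_iff)
    moreover have "lam * \<tau> \<le> l * \<tau>" using lam(2) Lam_deriv_nonneg[OF lc lam(3)] by (intro mult_right_mono) auto
    ultimately have "Lam lam \<le> \<alpha>'" by linarith
    then have "x * Lam lam \<le> x * \<alpha>'" using x by (rule mult_left_mono)
    moreover have "lam - x * Lam lam \<le> I" using half_rate_ge_less[OF lc, of x] by (simp add: I)
    ultimately have "l - e - x * \<alpha>' \<le> I" using lam(1) by linarith
    moreover have "2 * e = l - \<alpha>' * x - I" by (simp add: e_def)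
    ultimately have "e \<le> 0" by (simp add: mult.commute)
    then show False using e by simp
  qed
qed

text \<open>A cone point close to \<open>(x, 1, I)\<close> gives the right probability at a time
  close to \<open>n\<close>; \<open>pos_prob_near\<close> then passes to time \<open>n\<close>
  exactly.\<close>

lemma local_lower:
  assumes good: "good_env \<omega>" and x: "0 \<le> x" and I: "half_rate x = ereal I" and \<epsilon>: "0 < \<epsilon>"
  shows "\<forall>\<^sub>F n in sequentially. \<forall>i. exp (- (real n * (I + \<epsilon>))) \<le>
    (\<Sum>y\<in>{y\<in>{- int n..int n}. \<bar>real_of_int y - real n * x\<bar> < real n * \<epsilon>}. \<Sum>j\<in>UNIV. pos_prob \<omega> n 0 i y j)"
proof -
  have we: "walk_env \<omega>" by (rule elliptic_env_walk_env[OF good_env_elliptic[OF good]])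
  \<comment> \<open>Spatial errors: rounding at most \<open>n * e\<close>, \<open>a\<close> against
    \<open>x\<close> at most \<open>n * e\<close>, timing at most \<open>2 * n * e\<close>; in total
    less than \<open>n * \<epsilon>\<close>.\<close>
  define e where "e = \<epsilon> / 8"
  have e: "0 < e" using \<epsilon> by (simp add: e_def)
  obtain z where z: "z \<in> rest_cone \<omega>" "dist z (x, 1, I) < e"
    using rate_in_closure_rest_cone[OF good x I] e unfolding closure_approachable by blast
  obtain a \<tau> \<gamma> where z_eq: "z = (a, \<tau>, \<gamma>)" by (cases z)
  have d: "\<bar>a - x\<bar> < e" "\<bar>\<tau> - 1\<bar> < e" "\<bar>\<gamma> - I\<bar> < e"
  proof -
    have "dist a x \<le> dist z (x, 1, I)" using dist_fst_le[of z "(x, 1, I)"] by (simp add: z_eq)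
    moreover have "dist (\<tau>, \<gamma>) (1, I) \<le> dist z (x, 1, I)" using dist_snd_le[of z "(x, 1, I)"] by (simp add: z_eq)
    moreover have "dist \<tau> 1 \<le> dist (\<tau>, \<gamma>) (1, I)" using dist_fst_le[of "(\<tau>, \<gamma>)" "(1, I)"] by simp
    moreover have "dist \<gamma> I \<le> dist (\<tau>, \<gamma>) (1, I)" using dist_snd_le[of "(\<tau>, \<gamma>)" "(1, I)"] by simp
    ultimately show "\<bar>a - x\<bar> < e" "\<bar>\<tau> - 1\<bar> < e" "\<bar>\<gamma> - I\<bar> < e" using z(2) by (auto simp: dist_real_def)
  qed
  have "attainable \<omega> 0 a \<tau> \<gamma>" using rest_cone_attainable[OF good] z(1) by (simp add: z_eq)
  then have "\<forall>\<^sub>F n in sequentially. \<forall>i. \<exists>t j. \<bar>real t - real n * \<tau>\<bar> \<le> real n * e \<and>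
     exp (- (real n * (\<gamma> + e))) \<le> pos_prob \<omega> t \<lfloor>0 * real n\<rfloor> i \<lfloor>(0 + a) * real n\<rfloor> j"
    using e unfolding attainable_def by blast
  then show ?thesis
    using eventually_linear_le[OF e, of 1] eventually_gt_at_top[of "0::nat"]
  proof eventually_elim
    case (elim n)
    show ?case
    proof
      fix i
      let ?S = "{y\<in>{- int n..int n}. \<bar>real_of_int y - real n * x\<bar> < real n * \<epsilon>}"
      obtain t j where t: "\<bar>real t - real n * \<tau>\<bar> \<le> real n * e"
        "exp (- (real n * (\<gamma> + e))) \<le> pos_prob \<omega> t 0 i \<lfloor>a * real n\<rfloor> j" using elim(1)[rule_format, of i] by auto
      let ?k = "\<lfloor>a * real n\<rfloor>" and ?r = "\<bar>int n - int t\<bar>"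
      let ?Y = "{?k - ?r..?k + ?r}"
      have n: "0 < real n" using elim(3) by simp
      have r: "real_of_int ?r \<le> real n * (2 * e)"
      proof -
        have "\<bar>real n * \<tau> - real n * 1\<bar> \<le> real n * e"
          unfolding right_diff_distrib[symmetric] abs_mult using d(2) n by (intro mult_mono) auto
        then show ?thesis using t(1) by simp
      qed
      have ax: "\<bar>real n * a - real n * x\<bar> \<le> real n * e"
        unfolding right_diff_distrib[symmetric] abs_mult using d(1) n by (intro mult_mono) auto
      have Y: "y \<in> ?S" if "y \<in> ?Y" "y \<in> {- int n..int n}" for y
      proof -
        have "\<bar>real_of_int y - real_of_int ?k\<bar> \<le> real_of_int ?r" using that(1) by auto
        moreover have "\<bar>real_of_int ?k - real n * a\<bar> \<le> 1" by (simp add: mult.commute abs_le_iff) linarith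
        ultimately have "\<bar>real_of_int y - real n * x\<bar> \<le> real n * (4 * e)" using r ax elim(2) by simp
        also have "\<dots> < real n * \<epsilon>" using n \<epsilon> by (simp add: e_def)
        finally show ?thesis using that(2) by simp
      qed
      have "exp (- (real n * (I + \<epsilon>))) \<le> exp (- (real n * (\<gamma> + e)))"
      proof -
        have "\<gamma> + e \<le> I + \<epsilon>" using d(3) \<epsilon> unfolding e_def abs_less_iff by linarith
        then have "real n * (\<gamma> + e) \<le> real n * (I + \<epsilon>)" by (intro mult_left_mono) auto
        then show ?thesis by simp
      qed
      also have "\<dots> \<le> pos_prob \<omega> t 0 i ?k j" by (rule t(2))
      also have "\<dots> \<le> (\<Sum>y\<in>?Y. \<Sum>l\<in>UNIV. pos_prob \<omega> n 0 i y l)"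
        by (rule pos_prob_near[OF we]) auto
      also have "\<dots> = (\<Sum>y\<in>?Y \<inter> {- int n..int n}. \<Sum>l\<in>UNIV. pos_prob \<omega> n 0 i y l)"
        by (rule sum.mono_neutral_right) (auto simp: pos_prob_eq_0 intro!: sum.neutral)
      also have "\<dots> \<le> (\<Sum>y\<in>?S. \<Sum>l\<in>UNIV. pos_prob \<omega> n 0 i y l)"
      proof (rule sum_mono2)
        show "finite ?S" by (rule finite_subset[of _ "{- int n..int n}"]) auto
        show "?Y \<inter> {- int n..int n} \<subseteq> ?S" using Y by blast
      qed (intro sum_nonneg pos_prob_nonneg we)
      finally show "exp (- (real n * (I + \<epsilon>))) \<le> (\<Sum>y\<in>?S. \<Sum>l\<in>UNIV. pos_prob \<omega> n 0 i y l)" .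
    qed
  qed
qed

end

section \<open>From local estimates to the large deviation principle\<close>

lemma convex_on_max_fun:
  fixes f g :: "real \<Rightarrow> real"
  assumes "convex_on S f" "convex_on S g" shows "convex_on S (\<lambda>x. max (f x) (g x))"
proof (rule convex_onI)
  show "convex S" using assms(1) by (rule convex_on_imp_convex)
  fix t x y :: real assume t: "0 < t" "t < 1" and xy: "x \<in> S" "y \<in> S"
  let ?z = "(1 - t) *\<^sub>R x + t *\<^sub>R y"
  have "f ?z \<le> (1 - t) * f x + t * f y" "g ?z \<le> (1 - t) * g x + t * g y"
    using convex_onD[OF assms(1), of t x y] convex_onD[OF assms(2), of t x y] t xy by auto
  moreover have "(1 - t) * f x + t * f y \<le> (1 - t) * max (f x) (g x) + t * max (f y) (g y)"
    "(1 - t) * g x + t * g y \<le> (1 - t) * max (f x) (g x) + t * max (f y) (g y)"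
    using t by (auto intro!: add_mono mult_left_mono)
  ultimately show "max (f ?z) (g ?z) \<le> (1 - t) * max (f x) (g x) + t * max (f y) (g y)" by linarith
qed

lemma convex_ereal_fun_SUP:
  fixes f :: "'a \<Rightarrow> real \<Rightarrow> real"
  assumes "\<And>l. l \<in> S \<Longrightarrow> convex_on UNIV (f l)"
  shows "convex_ereal_fun (\<lambda>x. SUP l\<in>S. ereal (f l x))"
  unfolding convex_ereal_fun_def
proof (intro allI impI SUP_least, elim conjE)
  fix x y t :: real and l assume t: "0 \<le> t" "t \<le> 1" and l: "l \<in> S"
  have "f l (t * x + (1 - t) * y) \<le> t * f l x + (1 - t) * f l y"
    using convex_onD[OF assms[OF l], of t y x] t by (simp add: add.commute)
  then have "ereal (f l (t * x + (1 - t) * y)) \<le> ereal t * ereal (f l x) + ereal (1 - t) * ereal (f l y)" by simp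
  also have "\<dots> \<le> ereal t * (SUP l\<in>S. ereal (f l x)) + ereal (1 - t) * (SUP l\<in>S. ereal (f l y))"
    using t l by (intro add_mono ereal_mult_left_mono SUP_upper) auto
  finally show "ereal (f l (t * x + (1 - t) * y)) \<le> ereal t * (SUP l\<in>S. ereal (f l x)) + ereal (1 - t) * (SUP l\<in>S. ereal (f l y))" .
qed

lemma lower_semicont_SUP:
  fixes f :: "'a \<Rightarrow> real \<Rightarrow> real"
  assumes "\<And>l x. l \<in> S \<Longrightarrow> isCont (f l) x"
  shows "lower_semicont (\<lambda>x. SUP l\<in>S. ereal (f l x))"
  unfolding lower_semicont_def
proof (intro allI impI)
  fix x c assume "c < (SUP l\<in>S. ereal (f l x))"
  then obtain l where l: "l \<in> S" "c < ereal (f l x)" unfolding less_SUP_iff by blast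
  have "((\<lambda>y. ereal (f l y)) \<longlongrightarrow> ereal (f l x)) (at x)"
    using assms[OF l(1), of x] by (intro tendsto_ereal) (simp add: isCont_def)
  then have "\<forall>\<^sub>F y in at x. c < ereal (f l y)" using l(2) by (rule order_tendstoD)
  then show "\<forall>\<^sub>F y in at x. c < (SUP l\<in>S. ereal (f l y))"
    by eventually_elim (use l(1) in \<open>auto simp: less_SUP_iff\<close>)
qed

lemma ereal_ln_div_le:
  assumes "p \<le> exp (- (real n * a))" "0 < n" shows "ereal_ln p / ereal (real n) \<le> ereal (- a)"
proof (cases "p \<le> 0")
  case True then show ?thesis using assms(2) by (simp add: ereal_ln_def)
next
  case False
  then have "ln p \<le> ln (exp (- (real n * a)))" using assms(1) by (intro ln_mono) auto
  then have "ln p / real n \<le> - a" using assms(2) by (simp add: field_simps)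
  then show ?thesis using False assms(2) by (simp add: ereal_ln_def)
qed

lemma ereal_ln_div_ge:
  assumes "exp (- (real n * a)) \<le> p" "0 < n" shows "ereal (- a) \<le> ereal_ln p / ereal (real n)"
proof -
  have p: "0 < p" using assms(1) exp_gt_zero less_le_trans by blast
  then have "ln (exp (- (real n * a))) \<le> ln p" using assms(1) by (intro ln_mono) auto
  then have "- a \<le> ln p / real n" using assms(2) by (simp add: field_simps)
  then show ?thesis using p assms(2) by (simp add: ereal_ln_def)
qed

text \<open>Speeds lie in \<open>{- 1..1}\<close>, so finitely many local windows cover the relevant
  part of a closed set. The weights \<pi> only average bounds that hold for every starting
  state.\<close>

lemma satisfies_LDP_of_local:
  fixes \<omega> :: "('d::finite) env"
  assumes we: "walk_env \<omega>" and \<pi>: "prob_vec \<pi>" and rate: "rate_function I"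
    and U: "\<And>x a. ereal a < I x \<Longrightarrow> locally_small \<omega> UNIV x a"
    and L: "\<And>x v \<epsilon>. I x = ereal v \<Longrightarrow> 0 < \<epsilon> \<Longrightarrow> \<forall>\<^sub>F n in sequentially. \<forall>i. exp (- (real n * (v + \<epsilon>))) \<le>
        (\<Sum>y\<in>{y\<in>{- int n..int n}. \<bar>real_of_int y - real n * x\<bar> < real n * \<epsilon>}. \<Sum>j\<in>UNIV. pos_prob \<omega> n 0 i y j)"
  shows "satisfies_LDP (law_Xn_over_n \<omega> \<pi>) I"
proof -
  let ?P = "law_Xn_over_n \<omega> \<pi>"
  let ?S = "\<lambda>n A. {y\<in>{- int n..int n}. real_of_int y / real n \<in> A}"
  have fin: "finite (?S n A)" for n A by (rule finite_subset[of _ "{- int n..int n}"]) auto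
  have \<pi>0: "0 \<le> \<pi> i" and \<pi>1: "(\<Sum>i\<in>UNIV. \<pi> i) = 1" for i using \<pi> by (auto simp: prob_vec_def)
  have upper: "limsup (\<lambda>n. ereal_ln (?P n A) / ereal (real n)) \<le> ereal (- a)"
    if a: "ereal a < (INF x\<in>closure A. I x)" for A a
  proof -
    obtain a' where a': "ereal a < ereal a'" "ereal a' < (INF x\<in>closure A. I x)" using ereal_dense2[OF a] by auto
    define e where "e = a' - a"
    have e: "0 < e" using a' by (simp add: e_def)
    let ?K = "closure A \<inter> {- 1..1}"
    define Q where "Q x \<delta> \<longleftrightarrow> (\<forall>\<^sub>F n in sequentially. \<forall>y. \<bar>real_of_int y - real n * x\<bar> \<le> real n * \<delta> \<longrightarrow>
        (\<forall>i j. pos_prob \<omega> n 0 i y j \<le> exp (- (real n * a'))))" for x \<delta>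
    have "\<forall>x\<in>?K. \<exists>\<delta>. 0 < \<delta> \<and> Q x \<delta>"
    proof
      fix x assume "x \<in> ?K"
      then have "ereal a' < I x" by (intro less_le_trans[OF a'(2)] INF_lower) simp
      from U[OF this] show "\<exists>\<delta>. 0 < \<delta> \<and> Q x \<delta>" unfolding Q_def locally_small_def by simp
    qed
    from bchoice[OF this] obtain \<delta> where \<delta>: "\<And>x. x \<in> ?K \<Longrightarrow> 0 < \<delta> x" "\<And>x. x \<in> ?K \<Longrightarrow> Q x (\<delta> x)" by blast
    have "compact ?K" by (intro closed_Int_compact) auto
    moreover have "?K \<subseteq> (\<Union>x\<in>?K. ball x (\<delta> x))" using \<delta>(1) by auto
    ultimately obtain D where D: "D \<subseteq> ?K" "finite D" "?K \<subseteq> (\<Union>x\<in>D. ball x (\<delta> x))"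
      by (elim compactE_image[where f = "\<lambda>x. ball x (\<delta> x)"]) auto
    have "\<forall>\<^sub>F n in sequentially. \<forall>x\<in>D. \<forall>y. \<bar>real_of_int y - real n * x\<bar> \<le> real n * \<delta> x \<longrightarrow>
        (\<forall>i j. pos_prob \<omega> n 0 i y j \<le> exp (- (real n * a')))"
    proof (rule eventually_ball_finite[OF D(2)])
      have "\<forall>x\<in>D. Q x (\<delta> x)" using D(1) \<delta>(2) by blast
      then show "\<forall>x\<in>D. \<forall>\<^sub>F n in sequentially. \<forall>y. \<bar>real_of_int y - real n * x\<bar> \<le> real n * \<delta> x \<longrightarrow>
        (\<forall>i j. pos_prob \<omega> n 0 i y j \<le> exp (- (real n * a')))" unfolding Q_def .
    qed
    \<comment> \<open>Once \<open>6 * CARD('d) \<le> n * e\<^sup>2\<close>, the number of positions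
      and states, at most \<open>3 * n * CARD('d)\<close>, is below
      \<open>(n * e)\<^sup>2 / 2\<close> and so below \<open>exp (n * e)\<close>; the gap between
      \<open>a\<close> and \<open>a'\<close> absorbs it.\<close>
    then have "\<forall>\<^sub>F n in sequentially. ereal_ln (?P n A) / ereal (real n) \<le> ereal (- a)"
      using eventually_linear_le[OF zero_less_power[OF e, of 2], of "6 * real CARD('d)"] eventually_gt_at_top[of "0::nat"]
    proof eventually_elim
      case (elim n)
      have n: "1 \<le> real n" using elim(3) by simp
      have pt: "pos_prob \<omega> n 0 i y j \<le> exp (- (real n * a'))" if "y \<in> ?S n A" for i y j
      proof -
        have "\<bar>real_of_int y\<bar> \<le> real n" using that by auto
        then have "real_of_int y / real n \<in> {- 1..1}" using n by (simp add: abs_le_iff field_simps)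
        moreover have "real_of_int y / real n \<in> closure A" using that closure_subset by auto
        ultimately obtain x where x: "x \<in> D" "real_of_int y / real n \<in> ball x (\<delta> x)" using D(3) by blast
        have "real_of_int y - real n * x = real n * (real_of_int y / real n - x)" using n by (simp add: right_diff_distrib)
        then have "\<bar>real_of_int y - real n * x\<bar> = real n * \<bar>real_of_int y / real n - x\<bar>" by (simp add: abs_mult)
        also have "\<dots> \<le> real n * \<delta> x" using x(2) by (intro mult_left_mono) (auto simp: dist_real_def abs_minus_commute)
        finally show ?thesis using elim(1) x(1) by blast
      qed
      let ?d = "real CARD('d)" and ?E = "exp (- (real n * a'))"
      have "?P n A = (\<Sum>i\<in>UNIV. \<pi> i * (\<Sum>y\<in>?S n A. \<Sum>j\<in>UNIV. pos_prob \<omega> n 0 i y j))"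
        by (simp add: law_Xn_over_n_def)
      also have "\<dots> \<le> (\<Sum>i\<in>UNIV. \<pi> i * ((2 * real n + 1) * ?d * ?E))"
      proof (intro sum_mono mult_left_mono \<pi>0)
        fix i
        have "(\<Sum>y\<in>?S n A. \<Sum>j\<in>UNIV. pos_prob \<omega> n 0 i y j) \<le> (\<Sum>y\<in>?S n A. \<Sum>j\<in>(UNIV::'d set). ?E)"
          by (intro sum_mono pt)
        also have "\<dots> = real (card (?S n A)) * (?d * ?E)" by simp
        also have "\<dots> \<le> (2 * real n + 1) * (?d * ?E)"
        proof (intro mult_right_mono)
          have "card (?S n A) \<le> card {- int n..int n}" by (rule card_mono) auto
          then show "real (card (?S n A)) \<le> 2 * real n + 1" by simp
        qed simp
        finally show "(\<Sum>y\<in>?S n A. \<Sum>j\<in>UNIV. pos_prob \<omega> n 0 i y j) \<le> (2 * real n + 1) * ?d * ?E"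
          by (simp only: mult.assoc)
      qed
      also have "\<dots> = (2 * real n + 1) * ?d * ?E" using \<pi>1 by (simp flip: sum_distrib_right)
      also have "\<dots> \<le> exp (real n * e) * ?E"
      proof (rule mult_right_mono)
        have "(2 * real n + 1) * ?d \<le> (3 * real n) * ?d" using n by (intro mult_right_mono) auto
        also have "\<dots> = real n * (6 * ?d) / 2" by simp
        also have "\<dots> \<le> real n * (real n * e\<^sup>2) / 2" using elim(2) by (intro divide_right_mono mult_left_mono) auto
        also have "\<dots> = (real n * e)\<^sup>2 / 2" by (simp add: power2_eq_square)
        also have "\<dots> \<le> exp (real n * e)"
          using exp_lower_Taylor_quadratic[of "real n * e"] mult_nonneg_nonneg[of "real n" e] e by linarith
        finally show "(2 * real n + 1) * ?d \<le> exp (real n * e)" .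
      qed simp
      also have "\<dots> = exp (- (real n * a))" by (simp add: exp_add[symmetric] e_def algebra_simps)
      finally show ?case using elim(3) by (rule ereal_ln_div_le)
    qed
    then show ?thesis by (rule Limsup_bounded)
  qed
  have lower: "ereal (- (v + e)) \<le> liminf (\<lambda>n. ereal_ln (?P n A) / ereal (real n))"
    if x: "x \<in> interior A" and v: "I x = ereal v" and e: "0 < e" for A x v e
  proof -
    obtain r where r: "0 < r" "ball x r \<subseteq> A" using x mem_interior by blast
    define \<epsilon> where "\<epsilon> = min r e"
    have \<epsilon>: "0 < \<epsilon>" using r e by (simp add: \<epsilon>_def)
    have "\<forall>\<^sub>F n in sequentially. ereal (- (v + e)) \<le> ereal_ln (?P n A) / ereal (real n)"
      using L[OF v \<epsilon>] eventually_gt_at_top[of "0::nat"]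
    proof eventually_elim
      case (elim n)
      let ?T = "{y\<in>{- int n..int n}. \<bar>real_of_int y - real n * x\<bar> < real n * \<epsilon>}"
      have sub: "?T \<subseteq> ?S n A"
      proof
        fix y assume y: "y \<in> ?T"
        have n: "0 < real n" using elim(2) by simp
        have "real_of_int y / real n - x = (real_of_int y - real n * x) / real n" using n by (simp add: field_simps)
        then have "\<bar>real_of_int y / real n - x\<bar> = \<bar>real_of_int y - real n * x\<bar> / real n" using n by simp
        also have "\<dots> < \<epsilon>" using y n by (simp add: pos_divide_less_eq mult.commute)
        finally have "real_of_int y / real n \<in> ball x r" by (simp add: dist_real_def \<epsilon>_def abs_minus_commute)
        then show "y \<in> ?S n A" using r(2) y by auto
      qed
      have "exp (- (real n * (v + e))) \<le> exp (- (real n * (v + \<epsilon>)))"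
      proof -
        have "real n * (v + \<epsilon>) \<le> real n * (v + e)" by (intro mult_left_mono) (auto simp: \<epsilon>_def)
        then show ?thesis by simp
      qed
      also have "\<dots> = (\<Sum>i\<in>UNIV. \<pi> i * exp (- (real n * (v + \<epsilon>))))" using \<pi>1 by (simp flip: sum_distrib_right)
      also have "\<dots> \<le> (\<Sum>i\<in>UNIV. \<pi> i * (\<Sum>y\<in>?S n A. \<Sum>j\<in>UNIV. pos_prob \<omega> n 0 i y j))"
      proof (intro sum_mono mult_left_mono \<pi>0)
        fix i
        have "exp (- (real n * (v + \<epsilon>))) \<le> (\<Sum>y\<in>?T. \<Sum>j\<in>UNIV. pos_prob \<omega> n 0 i y j)" using elim(1) by blast
        also have "\<dots> \<le> (\<Sum>y\<in>?S n A. \<Sum>j\<in>UNIV. pos_prob \<omega> n 0 i y j)"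
          by (rule sum_mono2[OF fin sub]) (intro sum_nonneg pos_prob_nonneg we)
        finally show "exp (- (real n * (v + \<epsilon>))) \<le> (\<Sum>y\<in>?S n A. \<Sum>j\<in>UNIV. pos_prob \<omega> n 0 i y j)" .
      qed
      also have "\<dots> = ?P n A" by (simp add: law_Xn_over_n_def)
      finally show ?case using elim(2) by (rule ereal_ln_div_ge)
    qed
    then show ?thesis by (rule Liminf_bounded)
  qed
  show ?thesis
    unfolding satisfies_LDP_def
  proof (intro conjI ballI rate)
    fix A :: "real set"
    let ?l = "liminf (\<lambda>n. ereal_ln (?P n A) / ereal (real n))" and ?u = "limsup (\<lambda>n. ereal_ln (?P n A) / ereal (real n))"
    show "- (INF x\<in>interior A. I x) \<le> ?l"
    proof -
      have "- ?l \<le> (INF x\<in>interior A. I x)"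
      proof (rule INF_greatest)
        fix x assume x: "x \<in> interior A"
        have "0 \<le> I x" using rate by (simp add: rate_function_def)
        then consider "I x = \<infinity>" | v where "I x = ereal v" by (cases "I x") auto
        then show "- ?l \<le> I x"
        proof cases
          case 2
          show ?thesis unfolding 2
          proof (rule ereal_le_epsilon2)
            fix e :: real assume "0 < e"
            from lower[OF x 2 this] have "- ?l \<le> - ereal (- (v + e))" by (simp only: ereal_minus_le_minus)
            then show "- ?l \<le> ereal v + ereal e" by (simp add: add.commute)
          qed
        qed simp
      qed
      then show ?thesis by (simp add: ereal_uminus_le_reorder)
    qed
    show "?u \<le> - (INF x\<in>closure A. I x)"
    proof (rule ccontr)
      assume "\<not> ?thesis"
      then have "- (INF x\<in>closure A. I x) < ?u" by simp
      then obtain a where a: "- (INF x\<in>closure A. I x) < ereal a" "ereal a < ?u" using ereal_dense2 by blast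
      have "ereal (- a) < (INF x\<in>closure A. I x)" using a(1) by (simp add: ereal_uminus_less_reorder)
      from upper[OF this] show False using a(2) by simp
    qed
  qed
qed

section \<open>Reflection of the environment\<close>

definition unshift :: "('d::finite) env \<Rightarrow> 'd env" where
  "unshift \<omega> = (\<lambda>k. \<omega> (k - 1))"

lemma shift_unshift [simp]: "shift (unshift \<omega>) = \<omega>" "unshift (shift \<omega>) = \<omega>"
  by (auto simp: shift_def unshift_def)

lemma shift_env_inv: "shift (env_inv \<omega>) = env_inv (unshift \<omega>)"
  by (auto simp: shift_def unshift_def env_inv_def)

lemma env_inv_shift: "env_inv (shift \<omega>) = unshift (env_inv \<omega>)"
  by (metis env_inv_env_inv shift_env_inv shift_unshift)

lemma shift_measurable [measurable]: "(shift :: ('d::finite) env \<Rightarrow> 'd env) \<in> borel_measurable borel"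
  unfolding shift_def
  by (intro borel_measurable_continuous_onI continuous_on_coordinatewise_then_product continuous_intros)

lemma unshift_measurable [measurable]: "(unshift :: ('d::finite) env \<Rightarrow> 'd env) \<in> borel_measurable borel"
  unfolding unshift_def
  by (intro borel_measurable_continuous_onI continuous_on_coordinatewise_then_product continuous_intros)

context elliptic_ergodic_env
begin

abbreviation reflected :: "'d env measure" where
  "reflected \<equiv> distr \<eta> borel env_inv"

lemma env_inv_meas: "env_inv \<in> measurable \<eta> borel"
  by (rule borel_meas) measurable

text \<open>\<open>P\<close> is arbitrary, so a measurable null set covering the exceptions is
  transported instead; reflection is an involution, hence the image of that set is a preimage and
  measurable.\<close>

lemma AE_reflectedI:
  assumes "AE \<omega> in \<eta>. P (env_inv \<omega>)" shows "AE \<omega> in reflected. P \<omega>"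
proof -
  obtain Z where Z: "{\<omega>\<in>space \<eta>. \<not> P (env_inv \<omega>)} \<subseteq> Z" "Z \<in> sets \<eta>" "emeasure \<eta> Z = 0"
    using assms by (rule AE_E)
  have Zb: "Z \<in> sets borel" using Z(2) sets_eq by simp
  have Y: "env_inv -` Z \<in> sets borel" using measurable_sets[OF env_inv_measurable Zb] by simp
  show ?thesis
  proof (rule AE_I')
    have "env_inv -` (env_inv -` Z) \<inter> space \<eta> = Z" by auto
    then show "env_inv -` Z \<in> null_sets reflected"
      using Y Z(3) by (simp add: null_sets_def emeasure_distr[OF env_inv_meas])
    show "{\<omega>\<in>space reflected. \<not> P \<omega>} \<subseteq> env_inv -` Z" using Z(1) by (force simp: subset_iff)
  qed
qed

lemma reflected_reflected: "distr reflected borel env_inv = \<eta>"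
proof -
  have "distr reflected borel env_inv = distr \<eta> borel (\<lambda>\<omega>. \<omega>)"
    by (subst distr_distr[OF env_inv_measurable env_inv_meas]) (simp add: comp_def)
  also have "\<dots> = \<eta>" using sets_eq by (intro distr_id2) simp
  finally show ?thesis .
qed

lemma distr_unshift: "distr \<eta> borel unshift = \<eta>"
proof -
  have u: "unshift \<in> measurable \<eta> borel" by (rule borel_meas) measurable
  have "distr \<eta> borel unshift = distr (distr \<eta> \<eta> shift) borel unshift" by (simp only: T_pres)
  also have "\<dots> = distr \<eta> borel (\<lambda>\<omega>. \<omega>)" by (subst distr_distr[OF u T_meas]) (simp add: comp_def)
  also have "\<dots> = \<eta>" using sets_eq by (intro distr_id2) simp
  finally show ?thesis .
qed

text \<open>Reflection conjugates the shift to its inverse, which preserves the law and has the same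
  invariant sets. The constants stay the same, since ellipticity is symmetric and
  \<open>crossing\<close> covers all elliptic environments; every right half line result thus
  applies to the left.\<close>

lemma reflected_env: "elliptic_ergodic_env reflected \<kappa> c N"
proof (rule elliptic_ergodic_env.intro)
  show ps: "prob_space reflected" by (rule prob_space_distr[OF env_inv_meas])
  show "sets reflected = sets borel" by simp
  show "AE \<omega> in reflected. elliptic_env \<kappa> \<omega>" using ell by (intro AE_reflectedI) (simp add: elliptic_env_inv)
  show "stationary_ergodic reflected"
    unfolding stationary_ergodic_def
  proof (intro conjI ballI impI)
    show "shift \<in> measurable reflected reflected" by simp
    have u: "unshift \<in> measurable \<eta> borel" by (rule borel_meas) measurable
    have "distr reflected reflected shift = distr reflected borel shift" by (rule distr_cong) simp_all
    also have "\<dots> = distr \<eta> borel (env_inv \<circ> unshift)"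
      by (subst distr_distr[OF shift_measurable env_inv_meas]) (simp add: comp_def shift_env_inv)
    also have "\<dots> = distr (distr \<eta> borel unshift) borel env_inv" by (rule distr_distr[symmetric, OF env_inv_measurable u])
    finally show "distr reflected reflected shift = reflected" by (simp only: distr_unshift)
  next
    fix A assume A: "A \<in> sets reflected" and inv: "shift -` A \<inter> space reflected = A"
    have Ab: "A \<in> sets borel" using A by simp
    have sA: "shift \<omega> \<in> A \<longleftrightarrow> \<omega> \<in> A" for \<omega> using inv by auto
    let ?B = "env_inv -` A"
    have B: "?B \<in> sets \<eta>" using measurable_sets[OF env_inv_meas Ab] by simp
    have "shift -` ?B \<inter> space \<eta> = ?B"
    proof (intro set_eqI)
      fix \<omega>
      show "\<omega> \<in> shift -` ?B \<inter> space \<eta> \<longleftrightarrow> \<omega> \<in> ?B"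
        using sA[of "unshift (env_inv \<omega>)"] by (simp add: env_inv_shift)
    qed
    then have "prob ?B = 0 \<or> prob ?B = 1" by (rule T_erg[OF B])
    moreover have "prob_space.prob reflected A = prob ?B"
      using measure_distr[OF env_inv_meas Ab] by simp
    ultimately show "prob_space.prob reflected A = 0 \<or> prob_space.prob reflected A = 1" by simp
  qed
qed (use \<kappa> c crossing in auto)

section \<open>Joining the two half lines\<close>

lemma lcrit_reflected_le: "elliptic_ergodic_env.lcrit reflected \<le> lcrit"
proof (rule ccontr)
  interpret r: elliptic_ergodic_env reflected \<kappa> c N by (rule reflected_env)
  assume "\<not> r.lcrit \<le> lcrit"
  \<comment> \<open>Returns to level 0 have the same probabilities in both environments. The upper
    bound in the reflected one makes them decay at rate \<open>lam\<close>, whereas resting shows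
    that they decay no faster than at rate \<open>lcrit\<close>.\<close>
  then obtain lam where lam: "lcrit < lam" "lam < r.lcrit" using dense[of lcrit r.lcrit] by auto
  have lam0: "0 < lam" using lam lcrit_nonneg by simp
  have "AE \<omega> in \<eta>. good_env \<omega> \<and> r.good_env (env_inv \<omega>)"
    using AE_good_env AE_distrD[OF env_inv_meas r.AE_good_env] by eventually_elim (rule conjI)
  from AE_witness[OF this] obtain \<omega> :: "'d env" where good: "good_env \<omega>" "r.good_env (env_inv \<omega>)" by blast
  interpret w: walk_gf "env_inv \<omega>" lam "gf_const c N lam"
    by (rule r.good_env_walk_gf[OF good(2)]) (use lam in simp)
  let ?B = "gf_const c N lam"
  have ell: "elliptic_env \<kappa> \<omega>" by (rule good_env_elliptic[OF good(1)])
  have att: "attainable \<omega> 0 0 1 (1 * lcrit)"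
    by (rule attainable_stay[OF crossing ell c lcrit_nonneg]) (use good(1) in \<open>auto simp: good_env_def\<close>)
  \<comment> \<open>Errors in cost and in time add up to \<open>e * (1 + lam)\<close> per unit
    \<open>n\<close>, which is half of the gap.\<close>
  define e where "e = (lam - lcrit) / (2 * (1 + lam))"
  have e: "0 < e" "e * (1 + lam) = (lam - lcrit) / 2" using lam lam0 by (auto simp: e_def field_simps)
  have "\<forall>\<^sub>F n in sequentially. 2 * ln ?B + 1 \<le> real n * ((lam - lcrit) / 2)"
    using lam by (intro eventually_linear_le) simp
  then have "\<forall>\<^sub>F n::nat in sequentially. False"
    using att[unfolded attainable_def, rule_format, OF e(1)]
  proof eventually_elim
    case (elim n)
    obtain t j where t: "\<bar>real t - real n * 1\<bar> \<le> real n * e"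
      "exp (- (real n * (1 * lcrit + e))) \<le> pos_prob \<omega> t 0 undefined 0 j"
      using elim(2)[rule_format, of undefined] by auto
    have "exp (lam * real t) * pos_prob \<omega> t 0 undefined 0 j \<le> ?B\<^sup>2"
      using w.pos_prob_upper_right[of 0 0 t undefined j] pos_prob_env_inv[of \<omega> t 0 undefined 0 j] by (simp add: hit_mgf_self)
    then have "exp (lam * real t) * exp (- (real n * (1 * lcrit + e))) \<le> ?B\<^sup>2"
      using t(2) by (meson exp_ge_zero mult_left_mono order_trans)
    then have "exp (lam * real t - real n * (lcrit + e)) \<le> exp (2 * ln ?B)"
    proof -
      have "0 < ?B" using w.B1 by linarith
      then have "?B\<^sup>2 = exp (2 * ln ?B)" using exp_of_nat_mult[of 2 "ln ?B"] by (simp only: exp_ln of_nat_numeral)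
      moreover have "exp (lam * real t - real n * (lcrit + e)) = exp (lam * real t) * exp (- (real n * (1 * lcrit + e)))"
        unfolding exp_add[symmetric] by (simp only: mult_1_left diff_conv_add_uminus)
      ultimately show ?thesis using \<open>exp (lam * real t) * exp (- (real n * (1 * lcrit + e))) \<le> ?B\<^sup>2\<close>
        by (simp only:)
    qed
    then have 1: "lam * real t - real n * (lcrit + e) \<le> 2 * ln ?B" by simp
    have "lam * (real n - real n * e) \<le> lam * real t" using t(1) lam0 by (intro mult_left_mono) (auto simp: abs_le_iff)
    moreover have "lam * (real n - real n * e) - real n * (lcrit + e) = real n * (lam - lcrit - e * (1 + lam))" by (simp add: algebra_simps)
    moreover have "x - x / 2 = x / 2" for x :: real by simp
    then have "lam - lcrit - e * (1 + lam) = (lam - lcrit) / 2" unfolding e(2) .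
    ultimately have "real n * ((lam - lcrit) / 2) \<le> 2 * ln ?B" using 1 by (metis diff_right_mono order_trans)
    then show ?case using elim(1) by linarith
  qed
  then show False by simp
qed

lemma lcrit_reflected: "elliptic_ergodic_env.lcrit reflected = lcrit"
  using lcrit_reflected_le elliptic_ergodic_env.lcrit_reflected_le[OF reflected_env]
  unfolding reflected_reflected by (rule antisym)

text \<open>A crossing to the left followed by a crossing to the right is a return, and the return
  probabilities decay at rate \<open>lcrit\<close>.\<close>
lemma Lam_reflected_le:
  assumes lam: "lam < lcrit"
  shows "Lam lam + elliptic_ergodic_env.Lam reflected lam \<le> 0"
proof -
  interpret r: elliptic_ergodic_env reflected \<kappa> c N by (rule reflected_env)
  have rl: "r.lcrit = lcrit" by (rule lcrit_reflected)
  \<comment> \<open>The room between \<open>lam\<close> and \<open>lam'\<close> turns the sum over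
    crossing times into a convergent geometric series with sum \<open>S\<close>.\<close>
  obtain lam' where lam': "lam < lam'" "lam' < lcrit" using dense[OF lam] by blast
  let ?B = "gf_const c N lam'" and ?C = "gf_const c N lam"
  define S where "S = (\<Sum>t. exp (lam - lam') ^ t)"
  have sg: "summable (\<lambda>t. exp (lam - lam') ^ t)" using lam' by (intro summable_geometric) simp
  have S0: "0 < S" unfolding S_def using lam' by (subst suminf_geometric) auto
  define D where "D = real CARD('d) * ?B ^ 4 * S"
  let ?i = "undefined :: 'd"
  define f where "f m \<omega> = ln (hit_mgf (env_inv \<omega>) lam 0 (int m) ?i)" for m \<omega>
  define g where "g m \<omega> = ln (hit_mgf \<omega> lam (- int m) 0 ?i)" for m \<omega>
  have "AE \<omega> in \<eta>. r.good_env (env_inv \<omega>)" by (rule AE_distrD[OF env_inv_meas r.AE_good_env])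
  then have AE: "AE \<omega> in \<eta>. f m \<omega> + g m \<omega> \<le> ln D" for m
    using AE_good_env
  proof eventually_elim
    case (elim \<omega>)
    interpret a: walk_gf "env_inv \<omega>" lam ?C by (rule r.good_env_walk_gf[OF elim(1)]) (use lam rl in simp)
    interpret b: walk_gf \<omega> lam' ?B by (rule good_env_walk_gf[OF elim(2)]) (use lam' in simp)
    interpret b': walk_gf \<omega> lam ?C by (rule good_env_walk_gf[OF elim(2)]) (use lam in simp)
    let ?u = "hit_mgf \<omega> lam (- int m) 0 ?i" and ?v = "hit_mgf (env_inv \<omega>) lam 0 (int m) ?i"
    have u: "0 < ?u" by (rule b'.hit_mgf_pos) simp
    have v: "0 < ?v" by (rule a.hit_mgf_pos) simp
    have summand: "exp (lam * real t) * hit_prob (env_inv \<omega>) (int m) t 0 ?i j * ?u \<le> ?B ^ 4 * exp (lam - lam') ^ t" for t j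
    proof -
      let ?p = "pos_prob \<omega> t 0 ?i (- int m) j"
      have p0: "0 \<le> ?p" by (rule pos_prob_nonneg[OF b.we])
      have "hit_prob (env_inv \<omega>) (int m) t 0 ?i j = hit_prob \<omega> (- int m) t 0 ?i j"
        using hit_prob_env_inv[of \<omega> "- int m" t 0 ?i j] by simp
      also have "\<dots> \<le> ?p" by (rule hit_prob_le_pos_prob[OF b.we])
      finally have 1: "hit_prob (env_inv \<omega>) (int m) t 0 ?i j \<le> ?p" .
      have "?u \<le> hit_mgf \<omega> lam' (- int m) 0 ?i" using lam' by (intro hit_mgf_mono b.we b.gf) auto
      also have "\<dots> \<le> ?B\<^sup>2 * hit_mgf \<omega> lam' (- int m) 0 j" by (rule b.hit_mgf_compare) simp
      finally have 2: "?u \<le> ?B\<^sup>2 * hit_mgf \<omega> lam' (- int m) 0 j" .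
      have "exp (lam * real t) * hit_prob (env_inv \<omega>) (int m) t 0 ?i j * ?u
          \<le> exp (lam * real t) * ?p * (?B\<^sup>2 * hit_mgf \<omega> lam' (- int m) 0 j)"
        using 1 2 u p0 hit_prob_nonneg[OF a.we] by (intro mult_mono) auto
      also have "\<dots> = exp (lam - lam') ^ t * ?B\<^sup>2 * (exp (lam' * real t) * ?p * hit_mgf \<omega> lam' (- int m) 0 j)"
      proof -
        have "exp (lam * real t) = exp (lam - lam') ^ t * exp (lam' * real t)"
          by (simp add: exp_of_nat_mult[symmetric] exp_add[symmetric] algebra_simps)
        then show ?thesis by (simp only: mult_ac)
      qed
      also have "\<dots> \<le> exp (lam - lam') ^ t * ?B\<^sup>2 * ?B\<^sup>2"
        by (intro mult_left_mono b.pos_prob_upper_left) auto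
      finally show ?thesis by (simp add: power2_eq_square power4_eq_xxxx mult_ac)
    qed
    have "hit_gf (env_inv \<omega>) lam 0 (int m) ?i j * ?u \<le> ?B ^ 4 * S" for j
    proof -
      have sh: "summable (\<lambda>t. exp (lam * real t) * hit_prob (env_inv \<omega>) (int m) t 0 ?i j)"
        by (rule summable_hit[OF a.we a.gf]) simp
      have "hit_gf (env_inv \<omega>) lam 0 (int m) ?i j * ?u
          = (\<Sum>t. exp (lam * real t) * hit_prob (env_inv \<omega>) (int m) t 0 ?i j * ?u)"
        unfolding hit_gf_def by (rule suminf_mult2[OF sh])
      also have "\<dots> \<le> (\<Sum>t. ?B ^ 4 * exp (lam - lam') ^ t)"
        by (intro suminf_le summand summable_mult2 sh summable_mult sg)
      also have "\<dots> = ?B ^ 4 * S" unfolding S_def by (rule suminf_mult[OF sg])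
      finally show ?thesis .
    qed
    then have "(\<Sum>j\<in>UNIV. hit_gf (env_inv \<omega>) lam 0 (int m) ?i j * ?u) \<le> (\<Sum>j\<in>(UNIV::'d set). ?B ^ 4 * S)"
      by (intro sum_mono)
    then have "?v * ?u \<le> D" by (simp add: hit_mgf_def[of "env_inv \<omega>"] D_def sum_distrib_right)
    then have "ln (?v * ?u) \<le> ln D" using u v by (intro ln_mono) auto
    then show ?case using u v by (simp add: f_def g_def ln_mult_pos)
  qed
  \<comment> \<open>In expectation both logarithms are linear in \<open>m\<close> up to constants,
    and \<open>D\<close> does not depend on \<open>m\<close>.\<close>
  have bound: "real m * (Lam lam + r.Lam lam) \<le> ln D + 4 * ln ?C" for m
  proof -
    have lc: "lam \<le> lcrit" "lam \<le> r.lcrit" using lam rl by auto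
    note ef = r.expectation_log_mgf[OF lc(2), of 0 m ?i, simplified]
    note eg = expectation_log_mgf[OF lc(1), of "- int m" m ?i, simplified]
    have hm: "(\<lambda>\<omega>. ln (hit_mgf \<omega> lam 0 (int m) ?i)) \<in> borel_measurable borel" by measurable
    have fi: "integrable \<eta> (f m)" unfolding f_def
      using ef(1) integrable_distr_eq[OF env_inv_meas hm] by simp
    have fe: "(\<integral>\<omega>. f m \<omega> \<partial>\<eta>) = (\<integral>\<omega>. ln (hit_mgf \<omega> lam 0 (int m) ?i) \<partial>reflected)"
      unfolding f_def by (rule integral_distr[OF env_inv_meas hm, symmetric])
    have gi: "integrable \<eta> (g m)" unfolding g_def by (rule eg(1))
    have "(\<integral>\<omega>. f m \<omega> + g m \<omega> \<partial>\<eta>) \<le> ln D"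
      by (rule integral_le_const[OF Bochner_Integration.integrable_add[OF fi gi] AE])
    then have "(\<integral>\<omega>. f m \<omega> \<partial>\<eta>) + (\<integral>\<omega>. g m \<omega> \<partial>\<eta>) \<le> ln D"
      by (simp only: Bochner_Integration.integral_add[OF fi gi])
    moreover have "real m * r.Lam lam - 2 * ln ?C \<le> (\<integral>\<omega>. f m \<omega> \<partial>\<eta>)"
      using ef(2) unfolding fe abs_le_iff by linarith
    moreover have "real m * Lam lam - 2 * ln ?C \<le> (\<integral>\<omega>. g m \<omega> \<partial>\<eta>)"
      using eg(2) unfolding g_def abs_le_iff by linarith
    ultimately show ?thesis unfolding distrib_left by linarith
  qed
  show "Lam lam + r.Lam lam \<le> 0"
  proof (rule ccontr)
    assume "\<not> ?thesis"
    then have "0 < Lam lam + r.Lam lam" by simp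
    then obtain m :: nat where "ln D + 4 * ln ?C < real m * (Lam lam + r.Lam lam)"
      using reals_Archimedean3 by blast
    then show False using bound[of m] by simp
  qed
qed

lemma I_eta_pos: "0 < x \<Longrightarrow> I_eta \<eta> x = half_rate x"
  by (simp add: I_eta_def J_eta_scaled)

lemma I_eta_0: "I_eta \<eta> 0 = half_rate 0"
  unfolding half_rate_0 I_eta_def using tendsto_Lim[OF _ J_eta_div_tendsto] by simp

lemma I_eta_nonneg_arg: "0 \<le> x \<Longrightarrow> I_eta \<eta> x = half_rate x"
  using I_eta_pos I_eta_0 by (cases "x = 0") auto

lemma I_eta_nonpos_arg:
  assumes "x \<le> 0" shows "I_eta \<eta> x = elliptic_ergodic_env.half_rate reflected (- x)"
proof -
  interpret r: elliptic_ergodic_env reflected \<kappa> c N by (rule reflected_env)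
  show "I_eta \<eta> x = r.half_rate (- x)"
  proof (cases "x = 0")
    case True
    then show ?thesis using I_eta_0 by (simp add: half_rate_0 r.half_rate_0 lcrit_reflected)
  next
    case False
    then show ?thesis using assms r.J_eta_scaled[of "- x"] by (simp add: I_eta_def)
  qed
qed

text \<open>By \<open>Lam_reflected_le\<close> the affine function belonging to the opposite half
  line is the smaller of the two, so inserting it through \<open>max\<close> leaves the supremum
  unchanged on each side.\<close>

lemma I_eta_eq_SUP:
  "I_eta \<eta> x = (SUP lam\<in>{..<lcrit}. ereal (max (lam - x * Lam lam) (lam + x * elliptic_ergodic_env.Lam reflected lam)))"
proof -
  interpret r: elliptic_ergodic_env reflected \<kappa> c N by (rule reflected_env)
  show "I_eta \<eta> x = (SUP lam\<in>{..<lcrit}. ereal (max (lam - x * Lam lam) (lam + x * r.Lam lam)))"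
  proof (cases "0 \<le> x")
    case True
    have "max (lam - x * Lam lam) (lam + x * r.Lam lam) = lam - x * Lam lam" if "lam < lcrit" for lam
    proof -
      have "x * (Lam lam + r.Lam lam) \<le> 0" using Lam_reflected_le[OF that] True by (rule mult_nonneg_nonpos[rotated])
      then show ?thesis by (simp add: algebra_simps)
    qed
    then show ?thesis unfolding I_eta_nonneg_arg[OF True] half_rate_def by (intro SUP_cong) auto
  next
    case False
    then have x: "x \<le> 0" by simp
    have "max (lam - x * Lam lam) (lam + x * r.Lam lam) = lam - (- x) * r.Lam lam" if "lam < lcrit" for lam
    proof -
      have "0 \<le> x * (Lam lam + r.Lam lam)" using Lam_reflected_le[OF that] x by (rule mult_nonpos_nonpos[rotated])
      then show ?thesis by (simp add: algebra_simps)
    qed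
    then show ?thesis unfolding I_eta_nonpos_arg[OF x] r.half_rate_def lcrit_reflected by (intro SUP_cong) auto
  qed
qed

lemma convex_I_eta: "convex_ereal_fun (I_eta \<eta>)"
  unfolding I_eta_eq_SUP[abs_def]
proof (rule convex_ereal_fun_SUP)
  have aff: "convex_on UNIV (\<lambda>x::real. p + x * q)" for p q :: real
    by (rule convex_onI) (simp_all add: algebra_simps)
  fix lam
  show "convex_on UNIV (\<lambda>x. max (lam - x * Lam lam) (lam + x * elliptic_ergodic_env.Lam reflected lam))"
    using convex_on_max_fun[OF aff[of lam "- Lam lam"] aff[of lam]] by simp
qed

lemma lower_semicont_I_eta: "lower_semicont (I_eta \<eta>)"
  unfolding I_eta_eq_SUP[abs_def] by (rule lower_semicont_SUP) (intro continuous_intros)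

lemma rate_function_I_eta: "rate_function (I_eta \<eta>)"
proof -
  interpret r: elliptic_ergodic_env reflected \<kappa> c N by (rule reflected_env)
  have "0 \<le> I_eta \<eta> x" for x
    using I_eta_nonneg_arg[of x] I_eta_nonpos_arg[of x] half_rate_nonneg[of x] r.half_rate_nonneg[of "- x"]
    by (cases "0 \<le> x") auto
  then show ?thesis by (simp add: rate_function_def lower_semicont_I_eta)
qed

text \<open>The exceptional set is fixed before \<pi> enters, so initial distributions that depend
  on the environment are covered.\<close>

lemma AE_satisfies_LDP: "AE \<omega> in \<eta>. \<forall>\<pi>. prob_vec \<pi> \<longrightarrow> satisfies_LDP (law_Xn_over_n \<omega> \<pi>) (I_eta \<eta>)"
proof -
  interpret r: elliptic_ergodic_env reflected \<kappa> c N by (rule reflected_env)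
  have "AE \<omega> in \<eta>. r.good_env (env_inv \<omega>)" by (rule AE_distrD[OF env_inv_meas r.AE_good_env])
  with AE_good_env show ?thesis
  proof eventually_elim
    case (elim \<omega>)
    note good = elim(1) and rgood = elim(2)
    have we: "walk_env \<omega>" by (rule elliptic_env_walk_env[OF good_env_elliptic[OF good]])
    \<comment> \<open>For \<open>x \<noteq> 0\<close> one half line is void near \<open>x\<close> by
      \<open>locally_small_far\<close>; at 0 both contribute and their rates agree.\<close>
    have U: "locally_small \<omega> UNIV x a" if a: "ereal a < I_eta \<eta> x" for x a
    proof -
      have "locally_small \<omega> {0..} x a"
        using local_upper[OF good, of x a] locally_small_far[of x] a I_eta_nonneg_arg[of x] by (cases "0 \<le> x") auto
      moreover have "locally_small (env_inv \<omega>) {0..} (- x) a"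
        using r.local_upper[OF rgood, of "- x" a] locally_small_far[of "- x"] a I_eta_nonpos_arg[of x] by (cases "x \<le> 0") auto
      ultimately have "locally_small \<omega> ({0..} \<union> {..0}) x a"
        by (intro locally_small_Un locally_small_reflect)
      moreover have "{0..} \<union> {..0} = (UNIV :: int set)" by auto
      ultimately show ?thesis by simp
    qed
    have L: "\<forall>\<^sub>F n in sequentially. \<forall>i. exp (- (real n * (v + \<epsilon>))) \<le>
        (\<Sum>y\<in>{y\<in>{- int n..int n}. \<bar>real_of_int y - real n * x\<bar> < real n * \<epsilon>}. \<Sum>j\<in>UNIV. pos_prob \<omega> n 0 i y j)"
      if v: "I_eta \<eta> x = ereal v" and e: "0 < \<epsilon>" for x v \<epsilon>
    proof (cases "0 \<le> x")
      case True
      show ?thesis by (rule local_lower[OF good True _ e]) (use v I_eta_nonneg_arg[OF True] in simp)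
    next
      case False
      then have x: "x \<le> 0" "0 \<le> - x" by auto
      have "r.half_rate (- x) = ereal v" using v I_eta_nonpos_arg[OF x(1)] by simp
      from r.local_lower[OF rgood x(2) this e] show ?thesis
      proof eventually_elim
        case (elim n)
        have "(\<Sum>y\<in>{y\<in>{- int n..int n}. \<bar>real_of_int y - real n * - x\<bar> < real n * \<epsilon>}. \<Sum>j\<in>UNIV. pos_prob (env_inv \<omega>) n 0 i y j)
          = (\<Sum>y\<in>{y\<in>{- int n..int n}. \<bar>real_of_int y - real n * x\<bar> < real n * \<epsilon>}. \<Sum>j\<in>UNIV. pos_prob \<omega> n 0 i y j)" for i
          by (rule sum.reindex_bij_witness[where i = uminus and j = uminus])
            (auto simp: abs_less_iff pos_prob_env_inv[of \<omega> n 0, simplified, symmetric])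
        then show ?case using elim by simp
      qed
    qed
    show ?case
      by (intro allI impI satisfies_LDP_of_local[OF we _ rate_function_I_eta U L])
  qed
qed

end

theorem theorem3:
  fixes \<eta> :: "('d::finite) env measure"
  assumes "prob_space \<eta>"
    and "sets \<eta> = sets borel"
    and A1: "stationary_ergodic \<eta>"
    and A2: "uniformly_elliptic \<eta>"
  shows "((\<lambda>t. J_eta \<eta> t / ereal t) \<longlongrightarrow> I_eta \<eta> 0) at_top \<and>
         convex_ereal_fun (I_eta \<eta>) \<and>
         lower_semicont (I_eta \<eta>) \<and>
         (AE \<omega> in \<eta>. \<forall>\<pi>. prob_vec \<pi> \<longrightarrow> satisfies_LDP (law_Xn_over_n \<omega> \<pi>) (I_eta \<eta>))"
proof -
  obtain \<kappa> where \<kappa>: "0 < \<kappa>" "AE \<omega> in \<eta>. elliptic_env \<kappa> \<omega>"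
    using A2 by (auto simp: uniformly_elliptic_def elliptic_env_def)
  obtain N c where c: "0 < c" "\<forall>(\<omega> :: 'd env) x i j. elliptic_env \<kappa> \<omega> \<longrightarrow> (\<exists>t\<le>N. c \<le> hit_prob \<omega> (x + 1) t x i j)"
    using hit_right_lower[OF \<kappa>(1), where 'd = 'd] by blast
  interpret elliptic_ergodic_env \<eta> \<kappa> c N
    by (rule elliptic_ergodic_env.intro) (fact assms \<kappa> c)+
  show ?thesis
    using J_eta_div_tendsto convex_I_eta lower_semicont_I_eta AE_satisfies_LDP
    by (simp add: I_eta_0 half_rate_0)
qed

end
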